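(* Let $m\ge1$ and, for each $1\le k\le m$, let $FP_k(z_1,\dots,z_k)$ be a formal power series (in $q,t$ and possibly further variables) whose coefficients are Laurent polynomials in $z_1,\dots,z_k$. Then $$\sum_{k=1}^m\Big(F\Big[X+\sum_{i=1}^k\tfrac M{z_i}\Big]\prod_{i=1}^k\Omega[-z_iX]\,FP_k(z_1,\dots,z_k)\prod_{1\le i<j\le k}\Omega\big[-M\tfrac{z_i}{z_j}\big]\Big)\Big|_{z_1^0\cdots z_m^0}=0$$ holds for all symmetric functions $F[X]$ if and only if, for each $1\le k\le m$, $$\mathrm{Sym}_k\Big(FP_k(z_1,\dots,z_k)\prod_{1\le i<j\le k}\Omega[-Mz_i/z_j]\Big)=0.$$ In particular, an operator $\mathbf V=\sum_{k=1}^m\mathbf V_k$ with $\mathbf V_k=\sum_a c^{(k)}_{a_1,\dots,a_k}D_{a_k}\cdots D_{a_2}D_{a_1}$ (finite sums over integer vectors $a$) acts by zero on symmetric functions if and only if, for every $1\le k\le m$, setting $\Pi_{\mathbf V_k}(z_1,\dots,z_k)=\sum_ac^{(k)}_{a_1,\dots,a_k}\frac{1}{z_1^{a_1}\cdots z_k^{a_k}}$, we have $\mathrm{Sym}_k\big(\Pi_{\mathbf V_k}\prod_{1\le i<j\le k}\Omega[-Mz_i/z_j]\big)=0$.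
   Context: Work over $\mathbb{Q}(q,t)$; $\Lambda$ is the algebra of symmetric functions in an infinite alphabet $X=x_1+x_2+\cdots$. Plethystic notation: $p_k[E]$ is $E$ with every variable (including $q,t$) raised to the $k$-th power; $F[E]$ substitutes $p_k\mapsto p_k[E]$ in the power-sum expansion of $F$. $\Omega[E]=\exp(\sum_{k\ge1}p_k[E]/k)$; in particular $\Omega[-uM]=1+\sum_{r\ge1}u^rh_r[-M]=\frac{(1-u)(1-qtu)}{(1-tu)(1-qu)}$, expanded in powers of $u$, with $M=(1-t)(1-q)$. For $k\in\mathbb{Z}$, $D_kF[X]=F[X+\tfrac Mz]\Omega[-zX]|_{z^k}$ (coefficient of $z^k$). $|_{z_1^0\cdots z_m^0}$ denotes the constant term in $z_1,\dots,z_m$. $\mathrm{Sym}_k$ is the symmetrizer $f\mapsto\frac1{k!}\sum_{\sigma\in S_k}f(z_{\sigma(1)},\dots,z_{\sigma(k)})$, applied coefficientwise. *)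

theory Defs
  imports
    "HOL-Library.Poly_Mapping"
    "HOL-Combinatorics.Permutations"
    "HOL-Computational_Algebra.Formal_Power_Series"
    "HOL-Computational_Algebra.Fraction_Field"
begin

text \<open>Formal power series in variables indexed by \<open>'v\<close>, as functions on monomials.\<close>

typedef ('v, 'a) mps = "UNIV :: (('v \<Rightarrow>\<^sub>0 nat) \<Rightarrow> 'a) set"
  morphisms mps_nth Abs_mps by simp

setup_lifting type_definition_mps

lemma mps_eqI: "(\<And>\<mu>. mps_nth f \<mu> = mps_nth g \<mu>) \<Longrightarrow> f = g"
  by transfer auto

lemma mps_eq_iff: "f = g \<longleftrightarrow> (\<forall>\<mu>. mps_nth f \<mu> = mps_nth g \<mu>)"
  by transfer auto

lemma mps_nth_Abs [simp]: "mps_nth (Abs_mps f) = f"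
  by (simp add: Abs_mps_inverse)

lemma finite_bounded_monomials:
  assumes "finite S"
  shows "finite {\<alpha> :: 'v \<Rightarrow>\<^sub>0 nat. Poly_Mapping.keys \<alpha> \<subseteq> S \<and> (\<forall>v. Poly_Mapping.lookup \<alpha> v \<le> d)}"
    (is "finite ?A")
proof (rule finite_imageD)
  have "Poly_Mapping.lookup ` ?A \<subseteq> {f. \<forall>x. (x \<in> S \<longrightarrow> f x \<in> {..d}) \<and> (x \<notin> S \<longrightarrow> f x = 0)}"
    by (auto simp: in_keys_iff subset_eq)
  moreover have "finite \<dots>"
    by (intro finite_set_of_finite_funs assms) auto
  ultimately show "finite (Poly_Mapping.lookup ` ?A)"
    by (rule finite_subset)
  show "inj_on Poly_Mapping.lookup ?A"
    by (auto intro!: inj_onI poly_mapping_eqI)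
qed

definition splits :: "('v \<Rightarrow>\<^sub>0 nat) \<Rightarrow> (('v \<Rightarrow>\<^sub>0 nat) \<times> ('v \<Rightarrow>\<^sub>0 nat)) set" where
  "splits \<mu> = {(\<alpha>, \<beta>). \<alpha> + \<beta> = \<mu>}"

lemma finite_splits [simp, intro]: "finite (splits \<mu>)"
proof -
  define d where "d = Max (Poly_Mapping.lookup \<mu> ` Poly_Mapping.keys \<mu>)"
  define A where "A = {\<alpha>. Poly_Mapping.keys \<alpha> \<subseteq> Poly_Mapping.keys \<mu> \<and> (\<forall>v. Poly_Mapping.lookup \<alpha> v \<le> d)}"
  have "finite A"
    unfolding A_def by (rule finite_bounded_monomials) simp
  have *: "\<alpha> \<in> A" if "\<alpha> + \<beta> = \<mu>" for \<alpha> \<beta>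
  proof -
    have le: "Poly_Mapping.lookup \<alpha> v \<le> Poly_Mapping.lookup \<mu> v" for v
      using that by (auto simp: lookup_add)
    have k: "Poly_Mapping.keys \<alpha> \<subseteq> Poly_Mapping.keys \<mu>"
    proof
      fix v assume "v \<in> Poly_Mapping.keys \<alpha>"
      then show "v \<in> Poly_Mapping.keys \<mu>" using le[of v] by (simp add: in_keys_iff)
    qed
    have "Poly_Mapping.lookup \<alpha> v \<le> d" for v
    proof (cases "v \<in> Poly_Mapping.keys \<mu>")
      case True
      then have "Poly_Mapping.lookup \<mu> v \<le> d" unfolding d_def by (intro Max_ge) auto
      with le[of v] show ?thesis by linarith
    next
      case False
      then show ?thesis using le[of v] by (simp add: in_keys_iff)
    qed
    with k show ?thesis by (simp add: A_def)
  qed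
  have "splits \<mu> \<subseteq> A \<times> A"
  proof
    fix x assume "x \<in> splits \<mu>"
    then obtain \<alpha> \<beta> where x: "x = (\<alpha>, \<beta>)" "\<alpha> + \<beta> = \<mu>" by (auto simp: splits_def)
    then show "x \<in> A \<times> A" using *[of \<alpha> \<beta>] *[of \<beta> \<alpha>] by (simp add: add.commute)
  qed
  with \<open>finite A\<close> show ?thesis by (meson finite_SigmaI finite_subset)
qed

lemma splits_0 [simp]: "splits 0 = {(0, 0)}"
  by (auto simp: splits_def poly_mapping_eq_iff lookup_add fun_eq_iff plus_poly_mapping.rep_eq)

instantiation mps :: (type, zero) zero
begin
lift_definition zero_mps :: "('a, 'b) mps" is "\<lambda>_. 0" .
instance ..
end

instantiation mps :: (type, zero_neq_one) one
begin
lift_definition one_mps :: "('a, 'b) mps" is "\<lambda>\<mu>. if \<mu> = 0 then 1 else 0" .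
instance ..
end

instantiation mps :: (type, comm_ring_1) comm_ring_1
begin

lift_definition plus_mps :: "('a, 'b) mps \<Rightarrow> ('a, 'b) mps \<Rightarrow> ('a, 'b) mps"
  is "\<lambda>f g \<mu>. f \<mu> + g \<mu>" .

lift_definition minus_mps :: "('a, 'b) mps \<Rightarrow> ('a, 'b) mps \<Rightarrow> ('a, 'b) mps"
  is "\<lambda>f g \<mu>. f \<mu> - g \<mu>" .

lift_definition uminus_mps :: "('a, 'b) mps \<Rightarrow> ('a, 'b) mps"
  is "\<lambda>f \<mu>. - f \<mu>" .

lift_definition times_mps :: "('a, 'b) mps \<Rightarrow> ('a, 'b) mps \<Rightarrow> ('a, 'b) mps"
  is "\<lambda>f g \<mu>. \<Sum>(\<alpha>, \<beta>)\<in>splits \<mu>. f \<alpha> * g \<beta>" .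

instance
proof
  fix f g h :: "('a, 'b) mps"
  show "f + g + h = f + (g + h)" by transfer (simp add: add.assoc)
  show "f + g = g + f" by transfer (simp add: add.commute)
  show "0 + f = f" by transfer simp
  show "- f + f = 0" by transfer simp
  show "f - g = f + - g" by transfer simp
  show "(f + g) * h = f * h + g * h"
    by transfer (simp add: distrib_right sum.distrib split_beta)
  show "(0 :: ('a, 'b) mps) \<noteq> 1"
    by transfer (auto simp: fun_eq_iff)
  show "f * g = g * f"
  proof (transfer, rule ext)
    fix f g :: "('a \<Rightarrow>\<^sub>0 nat) \<Rightarrow> 'b" and \<mu>
    show "(\<Sum>(\<alpha>, \<beta>)\<in>splits \<mu>. f \<alpha> * g \<beta>) = (\<Sum>(\<alpha>, \<beta>)\<in>splits \<mu>. g \<alpha> * f \<beta>)"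
      by (rule sum.reindex_bij_witness[where i = prod.swap and j = prod.swap])
         (auto simp: splits_def add.commute mult.commute)
  qed
  show "1 * f = f"
  proof (transfer, rule ext)
    fix f :: "('a \<Rightarrow>\<^sub>0 nat) \<Rightarrow> 'b" and \<mu>
    have "(\<Sum>(\<alpha>, \<beta>)\<in>splits \<mu>. (if \<alpha> = 0 then 1 else 0) * f \<beta>) =
          (\<Sum>(\<alpha>, \<beta>)\<in>{(0 :: 'a \<Rightarrow>\<^sub>0 nat, \<mu>)}. (if \<alpha> = 0 then 1 else 0) * f \<beta>)"
      by (intro sum.mono_neutral_right finite_splits) (auto simp: splits_def split: if_splits)
    then show "(\<Sum>(\<alpha>, \<beta>)\<in>splits \<mu>. (if \<alpha> = 0 then 1 else 0) * f \<beta>) = f \<mu>"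
      by simp
  qed
  show "f * g * h = f * (g * h)"
  proof (transfer, rule ext)
    fix f g h :: "('a \<Rightarrow>\<^sub>0 nat) \<Rightarrow> 'b" and \<mu>
    have "(\<Sum>(\<alpha>, \<beta>)\<in>splits \<mu>. (\<Sum>(\<gamma>, \<delta>)\<in>splits \<alpha>. f \<gamma> * g \<delta>) * h \<beta>) =
      (\<Sum>((\<alpha>, \<beta>), (\<gamma>, \<delta>))\<in>Sigma (splits \<mu>) (\<lambda>(\<alpha>, \<beta>). splits \<alpha>). f \<gamma> * g \<delta> * h \<beta>)"
      by (subst sum.Sigma[symmetric]) (auto simp: sum_distrib_right split_beta)
    also have "\<dots> =
      (\<Sum>((\<alpha>, \<beta>), (\<gamma>, \<delta>))\<in>Sigma (splits \<mu>) (\<lambda>(\<alpha>, \<beta>). splits \<beta>). f \<alpha> * (g \<gamma> * h \<delta>))"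
      by (rule sum.reindex_bij_witness[where
            i = "\<lambda>((\<alpha>, \<beta>), (\<gamma>, \<delta>)). ((\<alpha> + \<gamma>, \<delta>), (\<alpha>, \<gamma>))" and
            j = "\<lambda>((\<alpha>, \<beta>), (\<gamma>, \<delta>)). ((\<gamma>, \<delta> + \<beta>), (\<delta>, \<beta>))"])
         (auto simp: splits_def add.assoc mult.assoc)
    also have "\<dots> = (\<Sum>(\<alpha>, \<beta>)\<in>splits \<mu>. f \<alpha> * (\<Sum>(\<gamma>, \<delta>)\<in>splits \<beta>. g \<gamma> * h \<delta>))"
      by (subst sum.Sigma[symmetric]) (auto simp: sum_distrib_left split_beta)
    finally show "(\<Sum>(\<alpha>, \<beta>)\<in>splits \<mu>. (\<Sum>(\<gamma>, \<delta>)\<in>splits \<alpha>. f \<gamma> * g \<delta>) * h \<beta>) =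
      (\<Sum>(\<alpha>, \<beta>)\<in>splits \<mu>. f \<alpha> * (\<Sum>(\<gamma>, \<delta>)\<in>splits \<beta>. g \<gamma> * h \<delta>))" .
  qed
qed

end

lemma mps_nth_0 [simp]: "mps_nth 0 \<mu> = 0"
  and mps_nth_1: "mps_nth 1 \<mu> = (if \<mu> = 0 then 1 else 0)"
  and mps_nth_add [simp]: "mps_nth (f + g) \<mu> = mps_nth f \<mu> + mps_nth g \<mu>"
  and mps_nth_diff [simp]: "mps_nth (f - g) \<mu> = mps_nth f \<mu> - mps_nth g \<mu>"
  and mps_nth_uminus [simp]: "mps_nth (- f) \<mu> = - mps_nth f \<mu>"
  and mps_nth_mult: "mps_nth (f * g) \<mu> = (\<Sum>(\<alpha>, \<beta>)\<in>splits \<mu>. mps_nth f \<alpha> * mps_nth g \<beta>)"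
  by (transfer; simp)+

lemma mps_no_zero_divisors_aux:
  fixes f g :: "('v, 'a :: idom) mps"
  assumes "f \<noteq> 0" "g \<noteq> 0"
  shows "f * g \<noteq> 0"
proof -
  obtain \<alpha>0 \<beta>0 where 0: "mps_nth f \<alpha>0 \<noteq> 0" "mps_nth g \<beta>0 \<noteq> 0"
    using assms by (auto simp: mps_eq_iff)
  define S where "S = Poly_Mapping.keys \<alpha>0 \<union> Poly_Mapping.keys \<beta>0"
  have finS: "finite S" by (simp add: S_def)
  define D where "D = (\<lambda>\<alpha> :: 'v \<Rightarrow>\<^sub>0 nat. \<Sum>v\<in>S. Poly_Mapping.lookup \<alpha> v)"
  have D_add: "D (\<alpha> + \<beta>) = D \<alpha> + D \<beta>" for \<alpha> \<beta>
    by (simp add: D_def lookup_add sum.distrib)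
  obtain e n where e: "S = e ` {i::nat. i < n}" "inj_on e {i. i < n}"
    using finite_imp_nat_seg_image_inj_on[OF finS] by blast
  define \<kappa> where "\<kappa> = (\<lambda>\<alpha> :: 'v \<Rightarrow>\<^sub>0 nat.
    Abs_poly_mapping (\<lambda>i. if i < n then Poly_Mapping.lookup \<alpha> (e i) else 0))"
  have \<kappa>: "Poly_Mapping.lookup (\<kappa> \<alpha>) i = (if i < n then Poly_Mapping.lookup \<alpha> (e i) else 0)" for \<alpha> i
    unfolding \<kappa>_def by (subst lookup_Abs_poly_mapping) (auto intro: finite_subset[of _ "{..<n}"])
  have \<kappa>_add: "\<kappa> (\<alpha> + \<beta>) = \<kappa> \<alpha> + \<kappa> \<beta>" for \<alpha> \<beta>
    by (rule poly_mapping_eqI) (simp add: \<kappa> lookup_add)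
  have \<kappa>_inj: "\<alpha> = \<beta>" if "\<kappa> \<alpha> = \<kappa> \<beta>" "Poly_Mapping.keys \<alpha> \<subseteq> S" "Poly_Mapping.keys \<beta> \<subseteq> S" for \<alpha> \<beta>
  proof (rule poly_mapping_eqI)
    fix v
    show "Poly_Mapping.lookup \<alpha> v = Poly_Mapping.lookup \<beta> v"
    proof (cases "v \<in> S")
      case True
      then obtain i where "i < n" "v = e i" using e by auto
      then show ?thesis using \<kappa>[of \<alpha> i] \<kappa>[of \<beta> i] that(1) by simp
    next
      case False
      then have "v \<notin> Poly_Mapping.keys \<alpha>" "v \<notin> Poly_Mapping.keys \<beta>" using that by auto
      then show ?thesis by (simp add: in_keys_iff)
    qed
  qed
  have minimal: "\<exists>\<alpha>. Poly_Mapping.keys \<alpha> \<subseteq> S \<and> mps_nth F \<alpha> \<noteq> 0 \<and>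
      (\<forall>\<gamma>. Poly_Mapping.keys \<gamma> \<subseteq> S \<longrightarrow> mps_nth F \<gamma> \<noteq> 0 \<longrightarrow>
        D \<alpha> < D \<gamma> \<or> (D \<alpha> = D \<gamma> \<and> \<kappa> \<alpha> \<le> \<kappa> \<gamma>))"
    if F: "mps_nth F \<alpha>1 \<noteq> 0" "Poly_Mapping.keys \<alpha>1 \<subseteq> S" for F :: "('v, 'a) mps" and \<alpha>1
  proof -
    define P where "P = (\<lambda>\<alpha>. Poly_Mapping.keys \<alpha> \<subseteq> S \<and> mps_nth F \<alpha> \<noteq> 0)"
    obtain \<alpha>2 where \<alpha>2: "P \<alpha>2" "\<And>\<gamma>. P \<gamma> \<Longrightarrow> D \<alpha>2 \<le> D \<gamma>"
      using ex_has_least_nat[of P \<alpha>1 D] F by (auto simp: P_def)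
    define A where "A = {\<alpha>. P \<alpha> \<and> D \<alpha> = D \<alpha>2}"
    have "A \<subseteq> {\<alpha>. Poly_Mapping.keys \<alpha> \<subseteq> S \<and> (\<forall>v. Poly_Mapping.lookup \<alpha> v \<le> D \<alpha>2)}"
    proof safe
      fix \<alpha> v assume "\<alpha> \<in> A"
      then have *: "Poly_Mapping.keys \<alpha> \<subseteq> S" "D \<alpha> = D \<alpha>2" by (auto simp: A_def P_def)
      show "v \<in> Poly_Mapping.keys \<alpha> \<Longrightarrow> v \<in> S" using * by auto
      show "Poly_Mapping.lookup \<alpha> v \<le> D \<alpha>2"
      proof (cases "v \<in> S")
        case True
        then have "Poly_Mapping.lookup \<alpha> v \<le> D \<alpha>"
          unfolding D_def using finS by (intro member_le_sum) auto
        with * show ?thesis by simp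
      next
        case False
        with * have "v \<notin> Poly_Mapping.keys \<alpha>" by auto
        then show ?thesis by (simp add: in_keys_iff)
      qed
    qed
    then have "finite A" using finite_bounded_monomials[OF finS] finite_subset by blast
    moreover have "A \<noteq> {}" using \<alpha>2 by (auto simp: A_def)
    ultimately have m: "Min (\<kappa> ` A) \<in> \<kappa> ` A" "\<And>\<gamma>. \<gamma> \<in> A \<Longrightarrow> Min (\<kappa> ` A) \<le> \<kappa> \<gamma>" by auto
    then obtain \<alpha> where \<alpha>: "\<alpha> \<in> A" "\<And>\<gamma>. \<gamma> \<in> A \<Longrightarrow> \<kappa> \<alpha> \<le> \<kappa> \<gamma>" by auto
    have "D \<alpha> < D \<gamma> \<or> (D \<alpha> = D \<gamma> \<and> \<kappa> \<alpha> \<le> \<kappa> \<gamma>)" if "P \<gamma>" for \<gamma>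
    proof (cases "D \<gamma> = D \<alpha>2")
      case True
      then show ?thesis using \<alpha> that by (auto simp: A_def)
    next
      case False
      then show ?thesis using \<alpha>2(2)[OF that] \<alpha>(1) by (auto simp: A_def)
    qed
    then show ?thesis using \<alpha>(1) unfolding A_def P_def by blast
  qed
  obtain \<alpha> where \<alpha>: "Poly_Mapping.keys \<alpha> \<subseteq> S" "mps_nth f \<alpha> \<noteq> 0"
    "\<And>\<gamma>. Poly_Mapping.keys \<gamma> \<subseteq> S \<Longrightarrow> mps_nth f \<gamma> \<noteq> 0 \<Longrightarrow>
       D \<alpha> < D \<gamma> \<or> (D \<alpha> = D \<gamma> \<and> \<kappa> \<alpha> \<le> \<kappa> \<gamma>)"
    using minimal[OF 0(1)] by (auto simp: S_def)
  obtain \<beta> where \<beta>: "Poly_Mapping.keys \<beta> \<subseteq> S" "mps_nth g \<beta> \<noteq> 0"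
    "\<And>\<gamma>. Poly_Mapping.keys \<gamma> \<subseteq> S \<Longrightarrow> mps_nth g \<gamma> \<noteq> 0 \<Longrightarrow>
       D \<beta> < D \<gamma> \<or> (D \<beta> = D \<gamma> \<and> \<kappa> \<beta> \<le> \<kappa> \<gamma>)"
    using minimal[OF 0(2)] by (auto simp: S_def)
  have only: "\<gamma> = \<alpha> \<and> \<delta> = \<beta>"
    if eq: "\<gamma> + \<delta> = \<alpha> + \<beta>" and nz: "mps_nth f \<gamma> \<noteq> 0" "mps_nth g \<delta> \<noteq> 0" for \<gamma> \<delta>
  proof -
    have lk: "Poly_Mapping.lookup \<gamma> v + Poly_Mapping.lookup \<delta> v = Poly_Mapping.lookup \<alpha> v + Poly_Mapping.lookup \<beta> v" for v
      using arg_cong[OF eq, of "\<lambda>x. Poly_Mapping.lookup x v"] by (simp add: lookup_add)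
    have out: "Poly_Mapping.lookup \<gamma> v = 0 \<and> Poly_Mapping.lookup \<delta> v = 0" if "v \<notin> S" for v
    proof -
      have "v \<notin> Poly_Mapping.keys \<alpha>" "v \<notin> Poly_Mapping.keys \<beta>" using that \<alpha>(1) \<beta>(1) by auto
      then show ?thesis using lk[of v] by (simp add: in_keys_iff)
    qed
    have kS: "Poly_Mapping.keys \<gamma> \<subseteq> S" "Poly_Mapping.keys \<delta> \<subseteq> S"
      using out by (auto simp: in_keys_iff)
    have Deq: "D \<gamma> + D \<delta> = D \<alpha> + D \<beta>" and \<kappa>eq: "\<kappa> \<gamma> + \<kappa> \<delta> = \<kappa> \<alpha> + \<kappa> \<beta>"
      using arg_cong[OF eq, of D] arg_cong[OF eq, of \<kappa>] by (simp_all add: D_add \<kappa>_add)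
    have le: "\<kappa> \<alpha> \<le> \<kappa> \<gamma>" "\<kappa> \<beta> \<le> \<kappa> \<delta>"
      using \<alpha>(3)[OF kS(1) nz(1)] \<beta>(3)[OF kS(2) nz(2)] Deq by auto
    have "\<kappa> \<gamma> = \<kappa> \<alpha>"
    proof (rule ccontr)
      assume "\<kappa> \<gamma> \<noteq> \<kappa> \<alpha>"
      with le have "\<kappa> \<alpha> + \<kappa> \<beta> < \<kappa> \<gamma> + \<kappa> \<delta>" by (intro add_less_le_mono) auto
      with \<kappa>eq show False by simp
    qed
    then have "\<gamma> = \<alpha>" using \<kappa>_inj kS \<alpha> by blast
    with eq show ?thesis by simp
  qed
  have "mps_nth (f * g) (\<alpha> + \<beta>) = (\<Sum>(\<gamma>, \<delta>)\<in>{(\<alpha>, \<beta>)}. mps_nth f \<gamma> * mps_nth g \<delta>)"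
    unfolding mps_nth_mult using only
    by (intro sum.mono_neutral_right finite_splits) (auto simp: splits_def)
  then have "mps_nth (f * g) (\<alpha> + \<beta>) \<noteq> 0" using \<alpha> \<beta> by simp
  then show ?thesis by auto
qed

instance mps :: (type, idom) idom
  by standard (rule mps_no_zero_divisors_aux)

definition mps_const :: "'a \<Rightarrow> ('v, 'a :: zero) mps" where
  "mps_const c = Abs_mps (\<lambda>\<mu>. if \<mu> = 0 then c else 0)"

definition mps_var :: "'v \<Rightarrow> ('v, 'a :: zero_neq_one) mps" where
  "mps_var v = Abs_mps (\<lambda>\<mu>. if \<mu> = Poly_Mapping.single v 1 then 1 else 0)"

lemma of_nat_mps: "(of_nat n :: ('v, 'a :: comm_ring_1) mps) = mps_const (of_nat n)"
  by (induction n) (auto simp: mps_eq_iff mps_const_def mps_nth_1)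

instance mps :: (type, "{idom, ring_char_0}") ring_char_0
proof
  show "inj (of_nat :: nat \<Rightarrow> ('a, 'b) mps)"
  proof (rule injI)
    fix m n assume "(of_nat m :: ('a, 'b) mps) = of_nat n"
    then have "mps_nth (of_nat m :: ('a, 'b) mps) 0 = mps_nth (of_nat n :: ('a, 'b) mps) 0" by simp
    then show "m = n" by (simp add: of_nat_mps mps_const_def)
  qed
qed

instance fract :: ("{idom, ring_char_0}") field_char_0
proof
  show "inj (of_nat :: nat \<Rightarrow> 'a fract)"
    by (rule injI) (simp add: of_nat_fract eq_fract)
qed

datatype 'w qtvar = VarQ | VarT | VarW 'w

text \<open>
  The field \<open>'w qtfield\<close> contains both the power series in $q$, $t$ and further variables
  indexed by \<open>'w\<close>, and the ground field $\mathbb{Q}(q,t)$.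
\<close>

type_synonym 'w qtseries = "('w qtvar, rat) mps"
type_synonym 'w qtfield = "('w qtvar, rat) mps fract"

definition qt_polys :: "'w qtseries set" where
  "qt_polys = {f. finite {\<mu>. mps_nth f \<mu> \<noteq> 0} \<and>
     (\<forall>\<mu>. mps_nth f \<mu> \<noteq> 0 \<longrightarrow> Poly_Mapping.keys \<mu> \<subseteq> {VarQ, VarT})}"

definition Qqt :: "'w qtfield set" where
  "Qqt = {Fract f g | f g. f \<in> qt_polys \<and> g \<in> qt_polys \<and> g \<noteq> 0}"

text \<open>
  Laurent polynomials in $z_1, z_2, \dots$: the exponent vector \<open>a\<close> stands for
  $\prod_i z_i^{a_i}$. The variables of an object in $z_1,\dots,z_k$ are the indices in \<open>{1..k}\<close>.
\<close>

type_synonym 'a laurent = "(nat \<Rightarrow>\<^sub>0 int) \<Rightarrow>\<^sub>0 'a"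

definition laurent_in :: "nat \<Rightarrow> 'a :: zero laurent \<Rightarrow> bool" where
  "laurent_in k f \<longleftrightarrow> (\<forall>a\<in>Poly_Mapping.keys f. Poly_Mapping.keys a \<subseteq> {1..k})"

text \<open>
  Symmetric functions over $\mathbb{Q}(q,t)$ in the alphabet $X = x_0 + x_1 + \cdots$: formal power
  series of bounded degree that are invariant under all permutations of the variables.
\<close>

definition symfuns :: "(nat, 'w qtfield) mps set" where
  "symfuns = {F. (\<forall>\<mu>. mps_nth F \<mu> \<in> Qqt) \<and>
     (\<exists>d. \<forall>\<mu>. mps_nth F \<mu> \<noteq> 0 \<longrightarrow> (\<Sum>i\<in>Poly_Mapping.keys \<mu>. Poly_Mapping.lookup \<mu> i) \<le> d) \<and>
     (\<forall>\<pi> \<mu>. bij \<pi> \<longrightarrow> mps_nth F (Poly_Mapping.map_key \<pi> \<mu>) = mps_nth F \<mu>)}"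

definition psum :: "nat \<Rightarrow> (nat, 'a :: zero_neq_one) mps" where
  "psum n = Abs_mps (\<lambda>\<mu>. if \<exists>i. \<mu> = Poly_Mapping.single i n then 1 else 0)"

text \<open>
  Polynomials in the power sums are elements of \<open>(nat \<Rightarrow>\<^sub>0 nat) \<Rightarrow>\<^sub>0 'a\<close>, where the variable with
  index \<open>i\<close> stands for $p_{i+1}$. The argument \<open>e\<close> gives the values \<open>e n\<close> substituted for $p_n$,
  and \<open>\<iota>\<close> embeds the scalars. In characteristic 0 the power sums are algebraically independent
  generators of the symmetric functions, so every symmetric function has exactly one expansion.
\<close>

definition subst_psums :: "('a :: zero \<Rightarrow> 'b :: comm_ring_1) \<Rightarrow> (nat \<Rightarrow> 'b) \<Rightarrow> ((nat \<Rightarrow>\<^sub>0 nat) \<Rightarrow>\<^sub>0 'a) \<Rightarrow> 'b" where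
  "subst_psums \<iota> e P = (\<Sum>\<nu>\<in>Poly_Mapping.keys P. \<iota> (Poly_Mapping.lookup P \<nu>) *
      (\<Prod>i\<in>Poly_Mapping.keys \<nu>. e (Suc i) ^ Poly_Mapping.lookup \<nu> i))"

definition psum_expansion :: "(nat, 'a :: field_char_0) mps \<Rightarrow> ((nat \<Rightarrow>\<^sub>0 nat) \<Rightarrow>\<^sub>0 'a)" where
  "psum_expansion F = (THE P. F = subst_psums mps_const psum P)"

text \<open>
  A plethystic argument $E$ is given by the sequence $n \mapsto p_n[E]$. As $p_n[\cdot]$ raises every
  variable to the $n$-th power, it is additive and multiplicative in $E$ and sends a variable $v$
  to $v^n$; in particular $p_n[-E] = -p_n[E]$ and $p_n[X]$ is \<open>psum n\<close>.
\<close>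

definition pleth :: "(nat, 'a :: field_char_0) mps \<Rightarrow> (nat \<Rightarrow> (nat, 'a laurent) mps) \<Rightarrow> (nat, 'a laurent) mps" where
  "pleth F e = subst_psums (\<lambda>c. mps_const (Poly_Mapping.single 0 c)) e (psum_expansion F)"

text \<open>$p_n[M] = (1 - t^n)(1 - q^n)$\<close>

definition pM :: "nat \<Rightarrow> 'w qtseries" where
  "pM n = (1 - mps_var VarT ^ n) * (1 - mps_var VarQ ^ n)"

text \<open>$p_n[X + \sum_{i=1}^k M / z_i]$\<close>

definition pXM :: "nat \<Rightarrow> nat \<Rightarrow> (nat, 'w qtfield laurent) mps" where
  "pXM k n = psum n +
     (\<Sum>i=1..k. mps_const (Poly_Mapping.single (Poly_Mapping.single i (- int n)) (Fract (pM n) 1)))"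

text \<open>
  $\Omega[uE] = \exp(\sum_{n \ge 1} p_n[E] u^n / n)$ as a power series in $u$; its coefficients
  are the $h_r[E]$.
\<close>

definition Omega :: "(nat \<Rightarrow> ('v, 'a :: field_char_0) mps) \<Rightarrow> ('v, 'a) mps fps" where
  "Omega e = Abs_fps (\<lambda>j. mps_const (inverse (fact j))) oo
             Abs_fps (\<lambda>n. if n = 0 then 0 else mps_const (inverse (of_nat n)) * e n)"

text \<open>
  $\Omega[z^a E]$, that is $\Omega[uE]$ expanded in powers of $u$ and then evaluated at $u = z^a$.
  The result is read as a power series in the variables of $E$ with Laurent polynomials in the
  $z_i$ as coefficients, so that for each monomial \<open>\<mu>\<close> in the variables of $E$ the powers of $u$
  are collected. For $E = -X$ and $E = -M$, the only arguments used below, every \<open>\<mu>\<close> occurs in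
  only finitely many $h_r[E]$: $h_r[-X]$ is homogeneous of degree $r$, and all monomials of
  $h_r[-M]$ have degree at least $r - 1$ in $q, t$.
\<close>

definition Omega_at :: "(nat \<Rightarrow> ('v, 'a :: field_char_0) mps) \<Rightarrow> (nat \<Rightarrow>\<^sub>0 int) \<Rightarrow> ('v, 'a laurent) mps" where
  "Omega_at e a = Abs_mps (\<lambda>\<mu>. Sum_any (\<lambda>r.
     Poly_Mapping.single (Poly_Mapping.map (\<lambda>x. int r * x) a) (mps_nth (fps_nth (Omega e) r) \<mu>)))"

text \<open>$F[X + \sum_{i=1}^k M/z_i] \prod_{i=1}^k \Omega[-z_i X]$\<close>

definition X_part :: "nat \<Rightarrow> (nat, 'w qtfield) mps \<Rightarrow> (nat, 'w qtfield laurent) mps" where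
  "X_part k F = pleth F (pXM k) * (\<Prod>i=1..k. Omega_at (\<lambda>n. - psum n) (Poly_Mapping.single i 1))"

text \<open>$\prod_{1 \le i < j \le k} \Omega[-M z_i / z_j]$\<close>

definition Omega_pairs :: "nat \<Rightarrow> ('w qtvar, rat laurent) mps" where
  "Omega_pairs k = (\<Prod>(i, j)\<in>{(i, j). 1 \<le> i \<and> i < j \<and> j \<le> k}.
     Omega_at (\<lambda>n. - pM n) (Poly_Mapping.single i 1 - Poly_Mapping.single j 1))"

text \<open>
  Laurent series in the $z_i$ are given by their coefficient functions. In \<open>zcoeff\<close>, a power
  series with Laurent polynomial coefficients is reordered by powers of the $z_i$.
\<close>

type_synonym 'a zseries = "(nat \<Rightarrow>\<^sub>0 int) \<Rightarrow> 'a"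

definition zcoeff :: "('w qtvar, rat laurent) mps \<Rightarrow> 'w qtfield zseries" where
  "zcoeff G a = Fract (Abs_mps (\<lambda>\<mu>. Poly_Mapping.lookup (mps_nth G \<mu>) a)) 1"

definition zmult :: "'a :: comm_ring_1 laurent \<Rightarrow> 'a zseries \<Rightarrow> 'a zseries" where
  "zmult h g c = (\<Sum>a\<in>Poly_Mapping.keys h. Poly_Mapping.lookup h a * g (c - a))"

text \<open>
  The constant term in the $z_i$ of a product \<open>H * G\<close>, taken separately in front of each monomial
  in the variables $x_i$.
\<close>

definition const_term :: "(nat, 'w qtfield laurent) mps \<Rightarrow> 'w qtfield zseries \<Rightarrow> (nat, 'w qtfield) mps" where
  "const_term H G = Abs_mps (\<lambda>\<mu>. zmult (mps_nth H \<mu>) G 0)"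

text \<open>The coefficient of $z^b$ in $f(z_{\sigma(1)}, \dots, z_{\sigma(k)})$ is that of
  $z^{b \circ \sigma}$ in $f$.\<close>

definition Sym :: "nat \<Rightarrow> 'a :: field_char_0 zseries \<Rightarrow> 'a zseries" where
  "Sym k f b = inverse (fact k) * (\<Sum>\<sigma> | \<sigma> permutes {1..k}. f (Poly_Mapping.map_key \<sigma> b))"

definition D_op :: "int \<Rightarrow> (nat, 'w qtfield) mps \<Rightarrow> (nat, 'w qtfield) mps" where
  "D_op k F = Abs_mps (\<lambda>\<mu>. Poly_Mapping.lookup (mps_nth (X_part 1 F) \<mu>) (Poly_Mapping.single 1 k))"

text \<open>$D_{a_k} \cdots D_{a_2} D_{a_1}$\<close>

definition D_word :: "nat \<Rightarrow> (nat \<Rightarrow>\<^sub>0 int) \<Rightarrow> (nat, 'w qtfield) mps \<Rightarrow> (nat, 'w qtfield) mps" where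
  "D_word k a F = fold (\<lambda>i. D_op (Poly_Mapping.lookup a i)) [1..<Suc k] F"

text \<open>
  The finite families $(c_a)$ with $a \in \mathbb{Z}^k$ are elements of \<open>'w qtfield laurent\<close>
  satisfying \<open>laurent_in k\<close>.
\<close>

definition V_op :: "nat \<Rightarrow> 'w qtfield laurent \<Rightarrow> (nat, 'w qtfield) mps \<Rightarrow> (nat, 'w qtfield) mps" where
  "V_op k c F = (\<Sum>a\<in>Poly_Mapping.keys c. mps_const (Poly_Mapping.lookup c a) * D_word k a F)"

definition Pi_V :: "'w qtfield laurent \<Rightarrow> 'w qtfield laurent" where
  "Pi_V c = (\<Sum>a\<in>Poly_Mapping.keys c. Poly_Mapping.single (- a) (Poly_Mapping.lookup c a))"

end

theory Submission
  imports Defs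
begin

text \<open>
  The series $F[X+\sum_i M/z_i]\prod_i\Omega[-z_iX]$ is symmetric in the $z_i$, so pairing it with a
  series in the $z_i$ only sees the symmetrization of the latter. Conversely, take for $F$ the
  products of power sums. As $p_n[X]$ does not involve the $z_i$, the values
  $p_n[X] + p_n[M]\sum_i z_i^{-n}$ may be replaced by $\sum_i z_i^{-n}$. In
  $\prod_i\Omega[-z_iX] = \prod_{i,j}(1 - z_ix_j)$ the coefficient of $(x_0\cdots x_{N-1})^m$ is
  $\pm(z_1\cdots z_m)^N$ for $m$ variables and $0$ for fewer, so that only the top index $m$
  survives; products of power sums span the monomial symmetric functions, and with $N$ arbitrary
  all symmetric Laurent polynomials are reached. Then induct on $m$.

  For the operators, $D_{a_k}\cdots D_{a_1}F$ is the coefficient of $z^a$ in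
  $F[X+\sum_i M/z_i]\prod_i\Omega[-z_iX]\prod_{i<j}\Omega[-Mz_i/z_j]$, by peeling off $D_{a_1}$ first and
  using $\Omega[-z_1(X+\sum_{j>1}M/z_j)] = \Omega[-z_1X]\prod_{j>1}\Omega[-Mz_1/z_j]$.
\<close>

text \<open>Two kinds of infinite sums are kept apart. Omega[-M z_i/z_j] contains arbitrarily high
  powers of z_i/z_j, but only finitely many in front of each monomial in q and t, so products of
  such factors are formed with q and t as outer variables. After \<open>zcoeff\<close> has reordered
  the result by powers of the z_i, its coefficients may be infinite series in q and t, and only
  Laurent polynomials act on it.

  The sum over k mixes constant terms in different numbers of variables. The exponent of a single
  x_j tells them apart: each factor 1 - z_i x_j supplies x_j at most once, so k variables never
  reach x_j^m for m > k.

  In a word of operators, the variable z_1 of the operator applied first occurs in Omega[-M z_1/z_j]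
  with nonnegative powers only. Fixing its exponent leaves a finite sum and eliminates z_1, which is
  why words are taken apart from the side of D_(a_1). The next operator needs the power sum
  expansion of its argument, so polynomials in the power sums are followed through the word.\<close>

abbreviation lookup where "lookup \<equiv> Poly_Mapping.lookup"
abbreviation keys where "keys \<equiv> Poly_Mapping.keys"
abbreviation single where "single \<equiv> Poly_Mapping.single"
abbreviation map_key where "map_key \<equiv> Poly_Mapping.map_key"

section \<open>Evaluation of finitely supported functions\<close>

text \<open>Coefficient embeddings, plethystic substitutions, permutations of the z_i and
  evaluations at 1/z_j are all instances, so one set of rules moves them past sums and
  products.\<close>

locale ring_morphism =
  fixes \<phi> :: "'a :: comm_ring_1 \<Rightarrow> 'b :: comm_ring_1"
  assumes one [simp]: "\<phi> 1 = 1"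
    and add: "\<phi> (x + y) = \<phi> x + \<phi> y"
    and mult: "\<phi> (x * y) = \<phi> x * \<phi> y"
begin

lemma zero [simp]: "\<phi> 0 = 0"
  using add[of 0 0] by simp

lemma uminus: "\<phi> (- x) = - \<phi> x"
  using add[of "- x" x] by (simp add: eq_neg_iff_add_eq_0)

lemma diff: "\<phi> (x - y) = \<phi> x - \<phi> y"
  using add[of x "- y"] by (simp add: uminus)

lemma sum: "\<phi> (sum f A) = (\<Sum>x\<in>A. \<phi> (f x))"
  by (induction A rule: infinite_finite_induct) (auto simp: add)

lemma prod: "\<phi> (prod f A) = (\<Prod>x\<in>A. \<phi> (f x))"
  by (induction A rule: infinite_finite_induct) (auto simp: mult)

lemma power: "\<phi> (x ^ n) = \<phi> x ^ n"
  by (induction n) (auto simp: mult)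

lemma of_nat: "\<phi> (of_nat n) = of_nat n"
  by (induction n) (auto simp: add)

end

lemma ring_morphism_comp:
  assumes "ring_morphism \<phi>" "ring_morphism \<psi>"
  shows "ring_morphism (\<lambda>x. \<phi> (\<psi> x))"
proof -
  interpret f: ring_morphism \<phi> by fact
  interpret g: ring_morphism \<psi> by fact
  show ?thesis by standard (auto simp: f.add g.add f.mult g.mult)
qed

lemma poly_mapping_eq_sum_single: "p = (\<Sum>a\<in>keys p. single a (lookup p a))"
proof (rule poly_mapping_eqI)
  fix k
  have "lookup (\<Sum>a\<in>keys p. single a (lookup p a)) k = (\<Sum>a\<in>keys p. if a = k then lookup p a else 0)"
    unfolding lookup_sum by (intro sum.cong refl) (auto simp: lookup_single when_def)
  also have "\<dots> = lookup p k" by (simp add: in_keys_iff)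
  finally show "lookup p k = lookup (\<Sum>a\<in>keys p. single a (lookup p a)) k" by simp
qed

lemma lookup_mult_single:
  fixes h :: "'k :: ab_group_add \<Rightarrow>\<^sub>0 'a :: comm_ring_1"
  shows "lookup (h * single a x) c = lookup h (c - a) * x"
proof -
  have "h * single a x = (\<Sum>b\<in>keys h. single (b + a) (lookup h b * x))"
    by (subst poly_mapping_eq_sum_single[of h]) (simp add: sum_distrib_right mult_single)
  then have "lookup (h * single a x) c = (\<Sum>b\<in>keys h. if b = c - a then lookup h b * x else 0)"
    unfolding lookup_sum by (auto simp: lookup_sum lookup_single when_def eq_diff_eq intro!: sum.cong)
  also have "\<dots> = lookup h (c - a) * x" by (auto simp: in_keys_iff)
  finally show ?thesis .
qed

text \<open>Evaluation on a monoid algebra. It serves Laurent polynomials, polynomials in the power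
  sums, and polynomials in y with coefficients of the latter kind.\<close>

definition pm_eval :: "('a :: comm_ring_1 \<Rightarrow> 'b :: comm_ring_1) \<Rightarrow> ('m \<Rightarrow> 'b) \<Rightarrow> ('m \<Rightarrow>\<^sub>0 'a) \<Rightarrow> 'b" where
  "pm_eval \<phi> \<chi> p = (\<Sum>a\<in>keys p. \<phi> (lookup p a) * \<chi> a)"

lemma pm_eval_superset:
  assumes "\<phi> 0 = 0" "finite S" "keys p \<subseteq> S"
  shows "pm_eval \<phi> \<chi> p = (\<Sum>a\<in>S. \<phi> (lookup p a) * \<chi> a)"
  unfolding pm_eval_def by (rule sum.mono_neutral_left) (use assms in \<open>auto simp: in_keys_iff\<close>)

lemma pm_eval_single: "\<phi> 0 = 0 \<Longrightarrow> pm_eval \<phi> \<chi> (single a c) = \<phi> c * \<chi> a"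
  by (subst pm_eval_superset[of _ "{a}"]) auto

lemma (in ring_morphism) pm_eval_add: "pm_eval \<phi> \<chi> (p + q) = pm_eval \<phi> \<chi> p + pm_eval \<phi> \<chi> q"
proof -
  have "pm_eval \<phi> \<chi> r = (\<Sum>a\<in>keys p \<union> keys q. \<phi> (lookup r a) * \<chi> a)" if "r \<in> {p, q, p + q}" for r
    using that by (intro pm_eval_superset) (auto dest: set_mp[OF keys_add])
  then show ?thesis by (simp add: lookup_add add distrib_right sum.distrib)
qed

lemma (in ring_morphism) pm_eval_sum: "pm_eval \<phi> \<chi> (sum p A) = (\<Sum>x\<in>A. pm_eval \<phi> \<chi> (p x))"
  by (induction A rule: infinite_finite_induct) (auto simp: pm_eval_add pm_eval_def[of _ _ 0])

lemma (in ring_morphism) ring_morphism_pm_eval: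
  fixes \<chi> :: "'m :: comm_monoid_add \<Rightarrow> 'b"
  assumes "\<chi> 0 = 1" "\<And>a b. \<chi> (a + b) = \<chi> a * \<chi> b"
  shows "ring_morphism (pm_eval \<phi> \<chi>)"
proof
  show "pm_eval \<phi> \<chi> 1 = 1"
    by (simp add: assms pm_eval_single flip: single_one)
  fix p q :: "'m \<Rightarrow>\<^sub>0 'a"
  show "pm_eval \<phi> \<chi> (p + q) = pm_eval \<phi> \<chi> p + pm_eval \<phi> \<chi> q"
    by (rule pm_eval_add)
  have "p * q = (\<Sum>a\<in>keys p. \<Sum>b\<in>keys q. single (a + b) (lookup p a * lookup q b))"
    by (subst poly_mapping_eq_sum_single[of p], subst poly_mapping_eq_sum_single[of q])
       (simp add: sum_product mult_single)
  then have "pm_eval \<phi> \<chi> (p * q) =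
      (\<Sum>a\<in>keys p. \<Sum>b\<in>keys q. \<phi> (lookup p a * lookup q b) * \<chi> (a + b))"
    by (simp add: pm_eval_sum pm_eval_single)
  also have "\<dots> = pm_eval \<phi> \<chi> p * pm_eval \<phi> \<chi> q"
    by (simp add: pm_eval_def sum_product assms mult mult_ac)
  finally show "pm_eval \<phi> \<chi> (p * q) = pm_eval \<phi> \<chi> p * pm_eval \<phi> \<chi> q" .
qed

definition mon_val :: "(nat \<Rightarrow> 'b :: comm_ring_1) \<Rightarrow> (nat \<Rightarrow>\<^sub>0 nat) \<Rightarrow> 'b" where
  "mon_val e \<nu> = (\<Prod>i\<in>keys \<nu>. e (Suc i) ^ lookup \<nu> i)"

lemma mon_val_superset:
  "finite S \<Longrightarrow> keys \<nu> \<subseteq> S \<Longrightarrow> mon_val e \<nu> = (\<Prod>i\<in>S. e (Suc i) ^ lookup \<nu> i)"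
  unfolding mon_val_def by (rule prod.mono_neutral_left) (auto simp: in_keys_iff)

lemma mon_val_0 [simp]: "mon_val e 0 = 1"
  by (simp add: mon_val_def)

lemma mon_val_add: "mon_val e (\<nu> + \<nu>') = mon_val e \<nu> * mon_val e \<nu>'"
proof -
  have "mon_val e \<rho> = (\<Prod>i\<in>keys \<nu> \<union> keys \<nu>'. e (Suc i) ^ lookup \<rho> i)"
    if "\<rho> \<in> {\<nu>, \<nu>', \<nu> + \<nu>'}" for \<rho>
    using that by (intro mon_val_superset) (auto dest: set_mp[OF keys_add])
  then show ?thesis by (simp add: lookup_add power_add prod.distrib)
qed

lemma mon_val_single: "mon_val e (single i n) = e (Suc i) ^ n"
  by (subst mon_val_superset[of "{i}"]) auto

lemma (in ring_morphism) mon_val: "\<phi> (mon_val e \<nu>) = mon_val (\<lambda>n. \<phi> (e n)) \<nu>"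
  by (simp add: mon_val_def prod power)

lemma mon_val_times: "mon_val (\<lambda>n. e n * e' n) \<nu> = mon_val e \<nu> * mon_val e' \<nu>"
  by (simp add: mon_val_def power_mult_distrib prod.distrib)

lemma monomial_induct [case_names zero add]:
  fixes \<nu> :: "'v \<Rightarrow>\<^sub>0 nat"
  assumes "P 0" "\<And>i \<nu>. P \<nu> \<Longrightarrow> P (single i 1 + \<nu>)"
  shows "P \<nu>"
proof (induction "\<Sum>i\<in>keys \<nu>. lookup \<nu> i" arbitrary: \<nu> rule: less_induct)
  case less
  show ?case
  proof (cases "\<nu> = 0")
    case False
    then obtain i where i: "i \<in> keys \<nu>" by (metis keys_eq_empty ex_in_conv poly_mapping_eqI in_keys_iff lookup_zero)
    define \<nu>' where "\<nu>' = \<nu> - single i 1"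
    have lk: "lookup \<nu>' j = lookup \<nu> j - (if j = i then 1 else 0)" for j
      by (simp add: \<nu>'_def lookup_minus lookup_single when_def)
    have eq: "\<nu> = single i 1 + \<nu>'"
      using i by (intro poly_mapping_eqI) (auto simp: lookup_add lk lookup_single when_def in_keys_iff)
    have "(\<Sum>j\<in>keys \<nu>'. lookup \<nu>' j) = (\<Sum>j\<in>keys \<nu>. lookup \<nu>' j)"
      by (rule sum.mono_neutral_left) (auto simp: in_keys_iff lk)
    also have "\<dots> < (\<Sum>j\<in>keys \<nu>. lookup \<nu> j)"
      using i by (intro sum_strict_mono_ex1) (auto simp: lk in_keys_iff)
    finally have "P \<nu>'" by (rule less)
    then show ?thesis using assms(2)[of \<nu>' i] eq by simp
  qed (use assms in auto)
qed

lemma subst_psums_eq_pm_eval: "subst_psums \<phi> e P = pm_eval \<phi> (mon_val e) P"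
  by (simp add: subst_psums_def pm_eval_def mon_val_def)

lemma (in ring_morphism) ring_morphism_subst_psums: "ring_morphism (subst_psums \<phi> e)"
  unfolding subst_psums_eq_pm_eval[abs_def] by (rule ring_morphism_pm_eval) (auto simp: mon_val_add)

lemma subst_psums_single:
  fixes \<phi> :: "'a :: comm_ring_1 \<Rightarrow> 'b :: comm_ring_1"
  shows "\<phi> 0 = 0 \<Longrightarrow> subst_psums \<phi> e (single \<nu> c) = \<phi> c * mon_val e \<nu>"
  by (simp add: subst_psums_eq_pm_eval pm_eval_single)

lemma ring_morphism_subst_eqI:
  fixes \<Phi> \<Psi> :: "((nat \<Rightarrow>\<^sub>0 nat) \<Rightarrow>\<^sub>0 'a :: comm_ring_1) \<Rightarrow> 'b :: comm_ring_1"
  assumes "ring_morphism \<Phi>" "ring_morphism \<Psi>"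
    and const: "\<And>c. \<Phi> (single 0 c) = \<Psi> (single 0 c)"
    and var: "\<And>i. \<Phi> (single (single i 1) 1) = \<Psi> (single (single i 1) 1)"
  shows "\<Phi> P = \<Psi> P"
proof -
  interpret f: ring_morphism \<Phi> by fact
  interpret g: ring_morphism \<Psi> by fact
  have mon: "\<Phi> (single \<nu> 1) = \<Psi> (single \<nu> 1)" for \<nu>
  proof (induction \<nu> rule: monomial_induct)
    case (add i \<nu>)
    have "single (single i 1 + \<nu>) 1 = single (single i 1) (1::'a) * single \<nu> 1" by (simp add: mult_single)
    then show ?case using add var[of i] by (simp add: f.mult g.mult)
  qed simp
  have "\<Phi> (single \<nu> c) = \<Psi> (single \<nu> c)" for \<nu> c
  proof -
    have "single \<nu> c = single 0 c * single \<nu> (1::'a)" by (simp add: mult_single)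
    then show ?thesis by (simp add: f.mult g.mult mon const)
  qed
  then show ?thesis
    by (subst (1 2) poly_mapping_eq_sum_single) (simp add: f.sum g.sum)
qed

section \<open>Power series in several variables\<close>

definition mdeg :: "('v \<Rightarrow>\<^sub>0 nat) \<Rightarrow> nat" where
  "mdeg \<mu> = (\<Sum>i\<in>keys \<mu>. lookup \<mu> i)"

lemma mdeg_superset: "finite S \<Longrightarrow> keys \<mu> \<subseteq> S \<Longrightarrow> mdeg \<mu> = (\<Sum>i\<in>S. lookup \<mu> i)"
  unfolding mdeg_def by (rule sum.mono_neutral_left) (auto simp: in_keys_iff)

lemma mdeg_0 [simp]: "mdeg 0 = 0"
  by (simp add: mdeg_def)

lemma mdeg_add: "mdeg (\<alpha> + \<beta>) = mdeg \<alpha> + mdeg \<beta>"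
proof -
  have "mdeg \<rho> = (\<Sum>i\<in>keys \<alpha> \<union> keys \<beta>. lookup \<rho> i)" if "\<rho> \<in> {\<alpha>, \<beta>, \<alpha> + \<beta>}" for \<rho>
    using that by (intro mdeg_superset) (auto dest: set_mp[OF keys_add])
  then show ?thesis by (simp add: lookup_add sum.distrib)
qed

lemma mdeg_single [simp]: "mdeg (single i n) = n"
  by (subst mdeg_superset[of "{i}"]) auto

lemma mps_nth_const: "mps_nth (mps_const c) \<mu> = (if \<mu> = 0 then c else 0)"
  by (simp add: mps_const_def)

lemma mps_nth_sum: "mps_nth (sum f A) \<mu> = (\<Sum>x\<in>A. mps_nth (f x) \<mu>)"
  by (induction A rule: infinite_finite_induct) auto

lemma mps_nth_const_mult:
  fixes f :: "('v, 'a :: comm_ring_1) mps"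
  shows "mps_nth (mps_const c * f) \<mu> = c * mps_nth f \<mu>"
proof -
  have "mps_nth (mps_const c * f) \<mu> =
      (\<Sum>(\<alpha>, \<beta>)\<in>{(0, \<mu>)}. mps_nth (mps_const c :: ('v, 'a) mps) \<alpha> * mps_nth f \<beta>)"
    unfolding mps_nth_mult
    by (intro sum.mono_neutral_right finite_splits) (auto simp: splits_def mps_nth_const split: if_splits)
  then show ?thesis by (simp add: mps_nth_const)
qed

lemma mps_nth_mult_const:
  fixes f :: "('v, 'a :: comm_ring_1) mps"
  shows "mps_nth (f * mps_const c) \<mu> = mps_nth f \<mu> * c"
  using mps_nth_const_mult[of c f \<mu>] by (simp add: mult.commute)

lemma ring_morphism_mps_const: "ring_morphism (mps_const :: 'a :: comm_ring_1 \<Rightarrow> ('v, 'a) mps)"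
  by standard (auto intro!: mps_eqI simp: mps_nth_const mps_nth_1 mps_nth_const_mult)

definition mps_map :: "('a \<Rightarrow> 'b) \<Rightarrow> ('v, 'a) mps \<Rightarrow> ('v, 'b) mps" where
  "mps_map \<phi> f = Abs_mps (\<lambda>\<mu>. \<phi> (mps_nth f \<mu>))"

lemma mps_nth_map [simp]: "mps_nth (mps_map \<phi> f) \<mu> = \<phi> (mps_nth f \<mu>)"
  by (simp add: mps_map_def)

lemma (in ring_morphism) ring_morphism_mps_map: "ring_morphism (mps_map \<phi>)"
  by standard (auto intro!: mps_eqI simp: mps_nth_1 add mps_nth_mult sum mult split_beta)

lemma (in ring_morphism) mps_map_const: "mps_map \<phi> (mps_const c) = mps_const (\<phi> c)"
  by (auto intro!: mps_eqI simp: mps_nth_const)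

lemma ring_morphism_single: "ring_morphism (single (0 :: 'm :: comm_monoid_add) :: 'a :: comm_ring_1 \<Rightarrow> _)"
  by standard (auto simp: single_add mult_single)

lemma ring_morphism_Fract: "ring_morphism (\<lambda>x :: 'a :: idom. Fract x 1)"
  by standard (auto simp: One_fract_def)

lemma mps_nth_var: "mps_nth (mps_var v) \<mu> = (if \<mu> = single v 1 then 1 else 0)"
  by (simp add: mps_var_def)

lemma mps_nth_var_power: "mps_nth (mps_var v ^ n :: ('v, 'a :: comm_ring_1) mps) \<mu> = (if \<mu> = single v n then 1 else 0)"
proof (induction n arbitrary: \<mu>)
  case (Suc n)
  have "mps_nth (mps_var v ^ Suc n :: ('v, 'a) mps) \<mu> =
      (\<Sum>x\<in>splits \<mu>. if x = (single v 1, single v n) then 1 else 0)"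
    unfolding power_Suc mps_nth_mult
    by (intro sum.cong refl) (auto simp: mps_nth_var Suc split: if_splits)
  also have "\<dots> = (if (single v 1, single v n) \<in> splits \<mu> then 1 else 0)"
    by simp
  also have "(single v 1, single v n) \<in> splits \<mu> \<longleftrightarrow> \<mu> = single v (Suc n)"
    by (auto simp: splits_def simp flip: single_add)
  finally show ?case .
qed (auto simp: mps_nth_1)

section \<open>Plethystic exponentials\<close>

text \<open>$\Omega[uE]$ is the solution of $g' = g\sum_n p_{n+1}[E]u^n$ with $g(0) = 1$; identities between
  such exponentials are proved by comparing these differential equations.\<close>

definition exp_solution :: "(nat \<Rightarrow> 'a :: comm_ring_1) \<Rightarrow> 'a fps \<Rightarrow> bool" where
  "exp_solution e g \<longleftrightarrow> fps_nth g 0 = 1 \<and> fps_deriv g = g * Abs_fps (\<lambda>n. e (Suc n))"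

text \<open>Newton's identity between the h_n and the p_n. It is free of division and so makes sense
  over every commutative ring.\<close>

lemma exp_solution_iff:
  "exp_solution e g \<longleftrightarrow> fps_nth g 0 = 1 \<and>
    (\<forall>n. of_nat (Suc n) * fps_nth g (Suc n) = (\<Sum>i\<le>n. fps_nth g i * e (Suc (n - i))))"
  by (auto simp: exp_solution_def fps_eq_iff fps_mult_nth atLeast0AtMost)

lemma exp_solution_mult:
  assumes "exp_solution e g" "exp_solution e' g'"
  shows "exp_solution (\<lambda>n. e n + e' n) (g * g')"
proof -
  have "Abs_fps (\<lambda>n. e (Suc n) + e' (Suc n)) = Abs_fps (\<lambda>n. e (Suc n)) + Abs_fps (\<lambda>n. e' (Suc n))"
    by (simp add: fps_eq_iff)
  then show ?thesis using assms by (simp add: exp_solution_def algebra_simps)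
qed

lemma exp_solution_1: "exp_solution (\<lambda>_. 0) 1"
  by (simp add: exp_solution_def fps_eq_iff flip: fps_const_0_eq_0)

lemma exp_solution_prod:
  "(\<And>i. i \<in> I \<Longrightarrow> exp_solution (e i) (g i)) \<Longrightarrow> exp_solution (\<lambda>n. \<Sum>i\<in>I. e i n) (\<Prod>i\<in>I. g i)"
  by (induction I rule: infinite_finite_induct) (auto simp: exp_solution_1 intro: exp_solution_mult)

text \<open>Newton's recursion determines each coefficient up to the factor \<open>Suc k\<close>,
  which cancels in characteristic 0.\<close>

lemma exp_solution_unique:
  fixes g g' :: "'a :: {idom, ring_char_0} fps"
  assumes "exp_solution e g" "exp_solution e g'"
  shows "g = g'"
proof (rule fps_ext)
  fix n show "fps_nth g n = fps_nth g' n"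
  proof (induction n rule: less_induct)
    case (less n)
    show ?case
    proof (cases n)
      case (Suc k)
      have "of_nat (Suc k) * fps_nth g (Suc k) = of_nat (Suc k) * fps_nth g' (Suc k)"
        using assms less Suc by (simp add: exp_solution_iff del: of_nat_Suc)
      then show ?thesis using Suc by (simp del: of_nat_Suc)
    qed (use assms in \<open>simp add: exp_solution_def\<close>)
  qed
qed

text \<open>Newton's recursion has integer coefficients and survives every ring morphism, although
  \<open>Omega\<close> itself is defined with inverses of integers.\<close>

lemma (in ring_morphism) exp_solution_map:
  assumes "exp_solution e g"
  shows "exp_solution (\<lambda>n. \<phi> (e n)) (Abs_fps (\<lambda>n. \<phi> (fps_nth g n)))"
proof -
  have "of_nat (Suc n) * \<phi> (fps_nth g (Suc n)) = (\<Sum>i\<le>n. \<phi> (fps_nth g i) * \<phi> (e (Suc (n - i))))" for n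
  proof -
    have "of_nat (Suc n) * \<phi> (fps_nth g (Suc n)) = \<phi> (of_nat (Suc n) * fps_nth g (Suc n))"
      by (simp only: mult of_nat)
    also have "of_nat (Suc n) * fps_nth g (Suc n) = (\<Sum>i\<le>n. fps_nth g i * e (Suc (n - i)))"
      using assms by (simp add: exp_solution_iff del: of_nat_Suc)
    finally show ?thesis by (simp only: sum mult)
  qed
  then show ?thesis using assms by (simp add: exp_solution_iff del: of_nat_Suc)
qed

text \<open>The substitution of \<open>x * u\<close> for u, applied below with \<open>x\<close>
  equal to 1/z_i.\<close>

lemma exp_solution_scale:
  assumes "exp_solution e g"
  shows "exp_solution (\<lambda>n. x ^ n * e n) (Abs_fps (\<lambda>n. x ^ n * fps_nth g n))"
proof -
  have "of_nat (Suc n) * (x ^ Suc n * fps_nth g (Suc n)) =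
        (\<Sum>i\<le>n. x ^ i * fps_nth g i * (x ^ Suc (n - i) * e (Suc (n - i))))" for n
  proof -
    have "of_nat (Suc n) * (x ^ Suc n * fps_nth g (Suc n)) =
          x ^ Suc n * (of_nat (Suc n) * fps_nth g (Suc n))"
      by (simp only: mult_ac)
    also have "\<dots> = x ^ Suc n * (\<Sum>i\<le>n. fps_nth g i * e (Suc (n - i)))"
      using assms by (simp add: exp_solution_iff)
    also have "\<dots> = (\<Sum>i\<le>n. x ^ i * fps_nth g i * (x ^ Suc (n - i) * e (Suc (n - i))))"
      unfolding sum_distrib_left
    proof (intro sum.cong refl)
      fix i assume "i \<in> {..n}"
      then have "x ^ Suc n = x ^ i * x ^ Suc (n - i)"
        by (metis add_Suc_right atMost_iff le_add_diff_inverse power_add)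
      then show "x ^ Suc n * (fps_nth g i * e (Suc (n - i))) =
          x ^ i * fps_nth g i * (x ^ Suc (n - i) * e (Suc (n - i)))" by (simp only: mult_ac)
    qed
    finally show ?thesis .
  qed
  then show ?thesis using assms by (simp add: exp_solution_iff)
qed

text \<open>A one-letter alphabet x has Omega[ux] = 1/(1 - ux); \<open>exp_solution_linear\<close>
  is the counterpart Omega[-ux] = 1 - ux.\<close>

lemma exp_solution_geometric: "exp_solution (\<lambda>n. x ^ n) (Abs_fps (\<lambda>n. x ^ n))"
proof -
  have "x ^ i * x ^ Suc (n - i) = x ^ Suc n" if "i \<le> n" for i n
    using that by (metis add_Suc_right le_add_diff_inverse power_add)
  then show ?thesis by (simp add: exp_solution_iff del: power_Suc)
qed

lemma exp_solution_linear: "exp_solution (\<lambda>n. - (x ^ n)) (1 - fps_const x * fps_X)"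
proof -
  have eq: "fps_nth (1 - fps_const x * fps_X) i = (if i = 0 then 1 else if i = 1 then - x else 0)" for i
    by (auto simp: fps_X_def)
  have "(\<Sum>i\<le>n. fps_nth (1 - fps_const x * fps_X) i * - (x ^ Suc (n - i))) = (if n = 0 then - x else 0)" for n
  proof (cases n)
    case (Suc k)
    have "(\<Sum>i\<le>n. fps_nth (1 - fps_const x * fps_X) i * - (x ^ Suc (n - i))) =
        (\<Sum>i\<in>{0, 1}. fps_nth (1 - fps_const x * fps_X) i * - (x ^ Suc (n - i)))"
      using Suc by (intro sum.mono_neutral_right) (auto simp: eq)
    then show ?thesis using Suc by (simp add: eq)
  qed (simp add: eq)
  then show ?thesis by (simp add: exp_solution_iff eq)
qed

text \<open>Chain rule: the exponential series \<open>E\<close> is its own derivative, and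
  differentiating \<open>L\<close> cancels the denominators n.\<close>

lemma exp_solution_Omega: "exp_solution e (Omega e)"
proof -
  define E :: "('a, 'b) mps fps" where "E = Abs_fps (\<lambda>j. mps_const (inverse (fact j)))"
  define L where "L = Abs_fps (\<lambda>n. if n = 0 then 0 else mps_const (inverse (of_nat n)) * e n)"
  interpret ring_morphism "mps_const :: 'b \<Rightarrow> ('a, 'b) mps" by (rule ring_morphism_mps_const)
  have E: "fps_deriv E = E"
  proof (rule fps_ext)
    fix n
    have "of_nat (Suc n) * mps_const (inverse (fact (Suc n))) =
        (mps_const (of_nat (Suc n) * inverse (fact (Suc n))) :: ('a, 'b) mps)"
      by (simp only: mult of_nat)
    also have "of_nat (Suc n) * inverse (fact (Suc n)) = inverse (fact n :: 'b)"
      by (simp add: fact_Suc divide_simps del: of_nat_Suc)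
    finally show "fps_nth (fps_deriv E) n = fps_nth E n" by (simp add: E_def)
  qed
  have L: "fps_deriv L = Abs_fps (\<lambda>n. e (Suc n))"
  proof (rule fps_ext)
    fix n
    have "of_nat (Suc n) * mps_const (inverse (of_nat (Suc n))) =
        (mps_const (of_nat (Suc n) * inverse (of_nat (Suc n))) :: ('a, 'b) mps)"
      by (simp only: mult of_nat)
    then have "of_nat (Suc n) * mps_const (inverse (of_nat (Suc n))) = (1 :: ('a, 'b) mps)"
      by (simp del: of_nat_Suc)
    then show "fps_nth (fps_deriv L) n = fps_nth (Abs_fps (\<lambda>n. e (Suc n))) n"
      by (simp add: L_def mult.assoc[symmetric] del: of_nat_Suc)
  qed
  have "fps_deriv (E oo L) = (fps_deriv E oo L) * fps_deriv L"
    by (rule fps_compose_deriv) (simp add: L_def)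
  then show ?thesis by (simp add: exp_solution_def Omega_def E L flip: E_def L_def) (simp add: E_def)
qed

section \<open>Power sums\<close>

lemma mps_nth_psum: "mps_nth (psum n) \<mu> = (if \<exists>i. \<mu> = single i n then 1 else 0)"
  by (simp add: psum_def)

text \<open>For \<open>n > 0\<close> distinct i give distinct monomials x_i^n, and only finitely
  many of them divide \<mu>.\<close>

lemma mps_nth_psum_mult:
  fixes g :: "(nat, 'a :: comm_ring_1) mps"
  assumes "n > 0"
  shows "mps_nth (psum n * g) \<mu> = (\<Sum>i | n \<le> lookup \<mu> i. mps_nth g (\<mu> - single i n))"
proof -
  define S where "S = {i. n \<le> lookup \<mu> i}"
  have S: "finite S" by (rule finite_subset[of _ "keys \<mu>"]) (use assms in \<open>auto simp: S_def in_keys_iff\<close>)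
  have eq: "single i n + (\<mu> - single i n) = \<mu>" if "i \<in> S" for i
    using that by (intro poly_mapping_eqI) (auto simp: lookup_add lookup_minus lookup_single when_def S_def)
  have "mps_nth (psum n * g) \<mu> =
      (\<Sum>(\<alpha>, \<beta>)\<in>(\<lambda>i. (single i n, \<mu> - single i n)) ` S. mps_nth (psum n) \<alpha> * mps_nth g \<beta>)"
    unfolding mps_nth_mult
  proof (intro sum.mono_neutral_right finite_splits ballI)
    show "(\<lambda>i. (single i n, \<mu> - single i n)) ` S \<subseteq> splits \<mu>" using eq by (auto simp: splits_def)
    fix x assume x: "x \<in> splits \<mu> - (\<lambda>i. (single i n, \<mu> - single i n)) ` S"
    then obtain \<alpha> \<beta> where ab: "x = (\<alpha>, \<beta>)" "\<alpha> + \<beta> = \<mu>" by (auto simp: splits_def)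
    have "\<alpha> \<noteq> single i n" for i
    proof
      assume a: "\<alpha> = single i n"
      then have "i \<in> S" using ab by (auto simp: S_def lookup_add)
      moreover have "\<beta> = \<mu> - single i n" using ab a by auto
      ultimately show False using x ab a by auto
    qed
    then show "(case x of (\<alpha>, \<beta>) \<Rightarrow> mps_nth (psum n) \<alpha> * mps_nth g \<beta>) = 0"
      by (simp add: ab mps_nth_psum)
  qed
  also have "\<dots> = (\<Sum>i\<in>S. mps_nth g (\<mu> - single i n))"
  proof (subst sum.reindex)
    have "i = j" if "single i n = single j n" for i j :: nat
      using arg_cong[OF that, of keys] assms by simp
    then show "inj_on (\<lambda>i. (single i n, \<mu> - single i n)) S" by (auto simp: inj_on_def)
    have "\<exists>i. single x n = single i n" for x :: nat by blast
    then show "sum ((\<lambda>(\<alpha>, \<beta>). mps_nth (psum n) \<alpha> * mps_nth g \<beta>) \<circ> (\<lambda>i. (single i n, \<mu> - single i n))) S =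
        (\<Sum>i\<in>S. mps_nth g (\<mu> - single i n))"
      by (simp add: mps_nth_psum)
  qed
  finally show ?thesis by (simp add: S_def)
qed

section \<open>Coefficients of Omega[-uX] and Omega[-uM]\<close>

definition squarefree_mon :: "('v \<Rightarrow>\<^sub>0 nat) \<Rightarrow> bool" where
  "squarefree_mon \<mu> \<longleftrightarrow> (\<forall>i. lookup \<mu> i \<le> 1)"

text \<open>Taking x_j^s out of \<mu> can leave a squarefree monomial only if \<open>s\<close> is
  the exponent of x_j or one less. An exponent of at least 2 allows both values, with opposite
  signs; for exponent 1 only s = 1 is in range.\<close>

lemma newton_inner_sum:
  assumes "0 < lookup \<mu> j" "lookup \<mu> j \<le> D"
  shows "(\<Sum>s=1..lookup \<mu> j. if squarefree_mon (\<mu> - single j s) then (- 1) ^ (D - s) else 0) =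
         (if squarefree_mon \<mu> then (- 1) ^ (D - 1) else 0 :: 'a :: comm_ring_1)"
proof -
  define a where "a = lookup \<mu> j"
  define others where "others \<longleftrightarrow> (\<forall>i. i \<noteq> j \<longrightarrow> lookup \<mu> i \<le> 1)"
  have sq: "squarefree_mon (\<mu> - single j s) \<longleftrightarrow> others \<and> a - s \<le> 1" for s
    unfolding squarefree_mon_def others_def a_def
    by (auto simp: lookup_minus lookup_single when_def)
  have sq0: "squarefree_mon \<mu> \<longleftrightarrow> others \<and> a \<le> 1" using sq[of 0] by simp
  have "(\<Sum>s=1..a. if others \<and> a - s \<le> 1 then (- 1) ^ (D - s) else 0) =
         (if others \<and> a \<le> 1 then (- 1) ^ (D - 1) else 0 :: 'a)"
  proof (cases "others \<and> a > 1")
    case True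
    then have "(\<Sum>s=1..a. if others \<and> a - s \<le> 1 then (- 1) ^ (D - s) else 0) =
        (\<Sum>s\<in>{a - 1, a}. if others \<and> a - s \<le> 1 then (- 1) ^ (D - s) else 0 :: 'a)"
      by (intro sum.mono_neutral_right) auto
    also have "\<dots> = (-1) ^ (D - (a - 1)) + (-1) ^ (D - a)"
    proof -
      have "a - 1 \<noteq> a" using True by auto
      then show ?thesis using True by (simp del: One_nat_def)
    qed
    also have "D - (a - 1) = Suc (D - a)" using True assms by (simp add: a_def)
    finally show ?thesis using True by simp
  next
    case False
    moreover have "a > 0" using assms by (simp add: a_def)
    ultimately have "\<not> others \<or> a = 1" by linarith
    then show ?thesis by auto
  qed
  then show ?thesis by (simp add: sq sq0 flip: a_def)
qed

lemma squarefree_mon_card_keys: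
  assumes "squarefree_mon \<mu>"
  shows "mdeg \<mu> = card (keys \<mu>)"
proof -
  have "lookup \<mu> i = 1" if "i \<in> keys \<mu>" for i
    using assms that unfolding squarefree_mon_def in_keys_iff by (metis One_nat_def le_Suc_eq le_zero_eq)
  then show ?thesis by (simp add: mdeg_def)
qed

text \<open>Omega[-uX] is the product of all 1 - u x_i, so h_r[-X] is (-1)^r times the elementary
  symmetric function e_r. This candidate is checked against Newton's recursion: the
  \<open>Suc n\<close> variables of a squarefree monomial contribute equally.\<close>

lemma Omega_minus_psum:
  "mps_nth (fps_nth (Omega (\<lambda>n. - psum n :: (nat, 'a :: field_char_0) mps)) r) \<mu> =
     (if squarefree_mon \<mu> \<and> mdeg \<mu> = r then (- 1) ^ r else 0)"
proof -
  define g :: "(nat, 'a) mps fps" where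
    "g = Abs_fps (\<lambda>r. Abs_mps (\<lambda>\<mu>. if squarefree_mon \<mu> \<and> mdeg \<mu> = r then (- 1) ^ r else 0))"
  have g: "mps_nth (fps_nth g r) \<mu> = (if squarefree_mon \<mu> \<and> mdeg \<mu> = r then (- 1) ^ r else 0)" for r \<mu>
    by (simp add: g_def)
  have "fps_nth g 0 = 1"
  proof (rule mps_eqI)
    fix \<mu> :: "nat \<Rightarrow>\<^sub>0 nat"
    have "mdeg \<mu> = 0 \<longleftrightarrow> \<mu> = 0"
      by (auto simp: mdeg_def in_keys_iff intro!: poly_mapping_eqI)
    then show "mps_nth (fps_nth g 0) \<mu> = mps_nth 1 \<mu>"
      by (auto simp: g mps_nth_1 squarefree_mon_def)
  qed
  moreover have "of_nat (Suc n) * fps_nth g (Suc n) = (\<Sum>i\<le>n. fps_nth g i * - psum (Suc (n - i)))" for n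
  proof (rule mps_eqI)
    fix \<mu> :: "nat \<Rightarrow>\<^sub>0 nat"
    have fin: "finite {j. Suc l \<le> lookup \<mu> j}" for l
      by (rule finite_subset[of _ "keys \<mu>"]) (auto simp: in_keys_iff)
    have mdeg: "mdeg (\<mu> - single j s) = mdeg \<mu> - s" "s \<le> mdeg \<mu>" if "s \<le> lookup \<mu> j" for s j
    proof -
      have "\<mu> = single j s + (\<mu> - single j s)"
        using that by (intro poly_mapping_eqI) (auto simp: lookup_add lookup_minus lookup_single when_def)
      then have "mdeg \<mu> = s + mdeg (\<mu> - single j s)" by (metis mdeg_add mdeg_single)
      then show "mdeg (\<mu> - single j s) = mdeg \<mu> - s" "s \<le> mdeg \<mu>" by auto
    qed
    have rhs: "mps_nth (\<Sum>i\<le>n. fps_nth g i * - psum (Suc (n - i))) \<mu> =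
      - (\<Sum>i\<le>n. \<Sum>j | Suc (n - i) \<le> lookup \<mu> j. mps_nth (fps_nth g i) (\<mu> - single j (Suc (n - i))))"
      by (simp add: mps_nth_sum mps_nth_psum_mult mult.commute[of _ "psum _"] sum_negf)
    have lhs: "mps_nth (of_nat (Suc n) * fps_nth g (Suc n)) \<mu> =
        (if squarefree_mon \<mu> \<and> mdeg \<mu> = Suc n then - of_nat (Suc n) * (- 1) ^ n else 0)"
      by (simp add: of_nat_mps mps_nth_const_mult g del: of_nat_Suc)
    show "mps_nth (of_nat (Suc n) * fps_nth g (Suc n)) \<mu> =
          mps_nth (\<Sum>i\<le>n. fps_nth g i * - psum (Suc (n - i))) \<mu>"
    proof (cases "mdeg \<mu> = Suc n")
      case False
      have "mps_nth (fps_nth g i) (\<mu> - single j (Suc (n - i))) = 0"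
        if "i \<le> n" "Suc (n - i) \<le> lookup \<mu> j" for i j
        using mdeg[OF that(2)] that False by (auto simp: g)
      then show ?thesis unfolding lhs rhs using False by (simp add: sum.neutral)
    next
      case True
      have le: "lookup \<mu> j \<le> Suc n" for j using mdeg(2)[of "lookup \<mu> j" j] True by simp
      have inv: "Suc (n - (Suc n - b)) = b" if "Suc 0 \<le> b" "b \<le> lookup \<mu> a" for a b
        using that le[of a] by linarith
      have "(\<Sum>i\<le>n. \<Sum>j | Suc (n - i) \<le> lookup \<mu> j. mps_nth (fps_nth g i) (\<mu> - single j (Suc (n - i)))) =
        (\<Sum>(i, j)\<in>(SIGMA i:{..n}. {j. Suc (n - i) \<le> lookup \<mu> j}). mps_nth (fps_nth g i) (\<mu> - single j (Suc (n - i))))"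
        using fin by (subst sum.Sigma) auto
      \<comment> \<open>The pairs are regrouped by variable: x_j^s is the part of \<mu> supplied by
        the power sum p_s, so \<open>i = Suc n - s\<close>.\<close>
      also have "\<dots> = (\<Sum>(j, s)\<in>(SIGMA j:keys \<mu>. {1..lookup \<mu> j}).
          if squarefree_mon (\<mu> - single j s) then (- 1) ^ (Suc n - s) else 0)"
        by (rule sum.reindex_bij_witness[where i = "\<lambda>(j, s). (Suc n - s, j)" and j = "\<lambda>(i, j). (j, Suc (n - i))"])
           (use le in \<open>auto simp: in_keys_iff g mdeg True Suc_diff_le inv intro: le_trans\<close>)
      also have "\<dots> = (\<Sum>j\<in>keys \<mu>. \<Sum>s=1..lookup \<mu> j. if squarefree_mon (\<mu> - single j s) then (- 1) ^ (Suc n - s) else 0)"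
        by (subst sum.Sigma) auto
      also have "\<dots> = (\<Sum>j\<in>keys \<mu>. if squarefree_mon \<mu> then (- 1) ^ (Suc n - 1) else 0)"
        by (intro sum.cong refl newton_inner_sum) (use le in \<open>auto simp: in_keys_iff\<close>)
      also have "\<dots> = (if squarefree_mon \<mu> then of_nat (Suc n) * (- 1) ^ n else 0)"
      proof (cases "squarefree_mon \<mu>")
        case sq: True
        then have "card (keys \<mu>) = Suc n" using squarefree_mon_card_keys[of \<mu>] True by simp
        then show ?thesis using sq by (simp del: of_nat_Suc)
      qed simp
      finally show ?thesis unfolding lhs rhs using True by (simp del: of_nat_Suc)
    qed
  qed
  ultimately have "exp_solution (\<lambda>n. - psum n) g"
    by (simp add: exp_solution_iff)
  then have "Omega (\<lambda>n. - psum n) = g"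
    using exp_solution_unique exp_solution_Omega by blast
  then show ?thesis by (simp add: g)
qed

text \<open>In (1 - u)(1 - qtu)/((1 - tu)(1 - qu)) every u outside the factor 1 - u is accompanied
  by a q or a t; that factor accounts for the one extra power.\<close>

lemma Omega_minus_pM_degree:
  assumes "mps_nth (fps_nth (Omega (\<lambda>n. - pM n)) r) \<mu> \<noteq> 0"
  shows "r \<le> Suc (mdeg \<mu>)"
proof -
  define q t :: "'a qtseries" where "q = mps_var VarQ" and "t = mps_var VarT"
  define bounded :: "'a qtseries fps \<Rightarrow> bool" where
    "bounded = (\<lambda>g. \<forall>r \<mu>. mps_nth (fps_nth g r) \<mu> \<noteq> 0 \<longrightarrow> r \<le> mdeg \<mu>)"
  have mult: "bounded (f * g)" if "bounded f" "bounded g" for f g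
    unfolding bounded_def
  proof (intro allI impI)
    fix r \<mu> assume "mps_nth (fps_nth (f * g) r) \<mu> \<noteq> 0"
    then obtain i where i: "i \<le> r" "mps_nth (fps_nth f i * fps_nth g (r - i)) \<mu> \<noteq> 0"
      unfolding fps_mult_nth mps_nth_sum by (auto elim!: sum.not_neutral_contains_not_neutral)
    then obtain \<alpha> \<beta> where "\<alpha> + \<beta> = \<mu>" "mps_nth (fps_nth f i) \<alpha> * mps_nth (fps_nth g (r - i)) \<beta> \<noteq> 0"
      unfolding mps_nth_mult by (auto elim!: sum.not_neutral_contains_not_neutral simp: splits_def)
    then have "i \<le> mdeg \<alpha>" "r - i \<le> mdeg \<beta>" "mdeg \<mu> = mdeg \<alpha> + mdeg \<beta>"
      using that by (auto simp: bounded_def mdeg_add)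
    then show "r \<le> mdeg \<mu>" by linarith
  qed
  have geo: "bounded (Abs_fps (\<lambda>n. mps_var v ^ n))" for v
    by (auto simp: bounded_def mps_nth_var_power)
  have qt: "mps_nth (q * t) \<mu> \<noteq> 0 \<Longrightarrow> mdeg \<mu> = 2" for \<mu>
    unfolding mps_nth_mult
    by (auto elim!: sum.not_neutral_contains_not_neutral simp: splits_def q_def t_def mps_nth_var mdeg_add split: if_splits)
  have lin: "bounded (1 - fps_const (q * t) * fps_X)"
    using qt by (force simp: bounded_def fps_X_def mps_nth_1 split: if_splits)
  define g where "g = (1 - fps_const (q * t) * fps_X) * (Abs_fps (\<lambda>n. t ^ n) * Abs_fps (\<lambda>n. q ^ n))"
  have g: "bounded g" unfolding g_def q_def t_def by (intro mult geo lin[unfolded q_def t_def])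
  \<comment> \<open>The four factors match the four terms in the expansion of -(1 - t^n)(1 -
    q^n).\<close>
  have "exp_solution (\<lambda>n. - (1 ^ n) + (- ((q * t) ^ n) + (t ^ n + q ^ n))) ((1 - fps_const 1 * fps_X) * g)"
    unfolding g_def by (intro exp_solution_mult exp_solution_geometric exp_solution_linear)
  also have "(\<lambda>n. - (1 ^ n) + (- ((q * t) ^ n) + (t ^ n + q ^ n))) = (\<lambda>n. - pM n)"
    by (auto simp: pM_def q_def t_def algebra_simps)
  finally have "Omega (\<lambda>n. - pM n) = (1 - fps_const 1 * fps_X) * g"
    using exp_solution_unique exp_solution_Omega by blast
  then have eq: "Omega (\<lambda>n. - pM n) = g - fps_X * g" by (simp add: algebra_simps)
  show ?thesis
  proof (cases r)
    case (Suc k)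
    have "mps_nth (fps_nth g r) \<mu> \<noteq> 0 \<or> mps_nth (fps_nth g k) \<mu> \<noteq> 0"
      using assms by (auto simp: eq Suc)
    then show ?thesis using g Suc by (auto simp: bounded_def intro: le_SucI dest: Suc_leD)
  qed simp
qed

section \<open>Algebraic independence of the power sums\<close>

text \<open>Natural numbers cannot cancel, which is what \<open>mon_val_psum_witness\<close> needs;
  they also lie in \<open>Qqt\<close>.\<close>

lemma mon_val_psum_nat_coeff: "\<exists>c. \<forall>\<mu>. mps_nth (mon_val psum \<nu> :: (nat, 'a :: comm_ring_1) mps) \<mu> = of_nat (c \<mu>)"
proof (induction \<nu> rule: monomial_induct)
  case zero
  show ?case by (rule exI[of _ "\<lambda>\<mu>. if \<mu> = 0 then 1 else 0"]) (simp add: mps_nth_1)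
next
  case (add i \<nu>)
  then obtain c where "\<And>\<mu>. mps_nth (mon_val psum \<nu> :: (nat, 'a) mps) \<mu> = of_nat (c \<mu>)" by blast
  then show ?case
    by (intro exI[of _ "\<lambda>\<mu>. \<Sum>j | Suc i \<le> lookup \<mu> j. c (\<mu> - single j (Suc i))"])
       (simp add: mon_val_add mon_val_single mps_nth_psum_mult)
qed

text \<open>The exponents of a monomial, read as a product of power sums with one factor per variable.\<close>

definition mon_type :: "(nat \<Rightarrow>\<^sub>0 nat) \<Rightarrow> (nat \<Rightarrow>\<^sub>0 nat)" where
  "mon_type \<mu> = (\<Sum>i\<in>keys \<mu>. single (lookup \<mu> i - 1) 1)"

text \<open>Each power sum contributes one variable, so a product of them reaches at most as many
  variables as it has factors. Equality forces distinct variables, and then the exponents are the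
  indices of the power sums.\<close>

lemma mon_val_psum_support:
  assumes "mps_nth (mon_val psum \<nu> :: (nat, 'a :: comm_ring_1) mps) \<mu> \<noteq> 0"
  shows "card (keys \<mu>) \<le> mdeg \<nu> \<and> (card (keys \<mu>) = mdeg \<nu> \<longrightarrow> mon_type \<mu> = \<nu>)"
  using assms
proof (induction \<nu> arbitrary: \<mu> rule: monomial_induct)
  case zero
  then show ?case by (auto simp: mps_nth_1 mon_type_def split: if_splits)
next
  case (add n \<nu>)
  have "mps_nth (mon_val psum (single n 1 + \<nu>) :: (nat, 'a) mps) \<mu> =
      (\<Sum>i | Suc n \<le> lookup \<mu> i. mps_nth (mon_val psum \<nu>) (\<mu> - single i (Suc n)))"
    by (simp add: mon_val_add mon_val_single mps_nth_psum_mult)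
  then obtain i where i: "Suc n \<le> lookup \<mu> i" "mps_nth (mon_val psum \<nu> :: (nat, 'a) mps) (\<mu> - single i (Suc n)) \<noteq> 0"
    using add.prems by (auto elim!: sum.not_neutral_contains_not_neutral)
  define \<mu>' where "\<mu>' = \<mu> - single i (Suc n)"
  have lk: "lookup \<mu>' j = (if j = i then lookup \<mu> i - Suc n else lookup \<mu> j)" for j
    by (auto simp: \<mu>'_def lookup_minus lookup_single when_def)
  have IH: "card (keys \<mu>') \<le> mdeg \<nu>" "card (keys \<mu>') = mdeg \<nu> \<Longrightarrow> mon_type \<mu>' = \<nu>"
    using add.IH i(2) by (auto simp: \<mu>'_def)
  have keys: "keys \<mu> = insert i (keys \<mu>')"
    using i(1) by (auto simp: in_keys_iff lk split: if_splits)
  show ?case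
  proof (cases "i \<in> keys \<mu>'")
    case True
    then show ?thesis using IH(1) by (simp add: keys insert_absorb mdeg_add)
  next
    case False
    then have "lookup \<mu> i = Suc n" using i(1) by (simp add: in_keys_iff lk)
    moreover have "(\<Sum>j\<in>keys \<mu>'. single (lookup \<mu> j - 1) 1) = mon_type \<mu>'"
      unfolding mon_type_def by (rule sum.cong) (use False in \<open>auto simp: lk\<close>)
    ultimately have "mon_type \<mu> = single n 1 + mon_type \<mu>'"
      unfolding mon_type_def[of \<mu>] keys using False by simp
    then show ?thesis using IH False by (simp add: keys mdeg_add)
  qed
qed

text \<open>Every factor of the product gets a variable of its own.\<close>

lemma mon_val_psum_witness:
  "\<exists>\<mu>. mps_nth (mon_val psum \<nu> :: (nat, 'a :: {comm_ring_1, ring_char_0}) mps) \<mu> \<noteq> 0 \<and> card (keys \<mu>) = mdeg \<nu>"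
proof (induction \<nu> rule: monomial_induct)
  case zero
  show ?case by (rule exI[of _ 0]) (simp add: mps_nth_1)
next
  case (add n \<nu>)
  then obtain \<mu>' where \<mu>': "mps_nth (mon_val psum \<nu> :: (nat, 'a) mps) \<mu>' \<noteq> 0" "card (keys \<mu>') = mdeg \<nu>"
    by blast
  obtain c where c: "\<And>\<mu>. mps_nth (mon_val psum \<nu> :: (nat, 'a) mps) \<mu> = of_nat (c \<mu>)"
    using mon_val_psum_nat_coeff by blast
  obtain i where i: "i \<notin> keys \<mu>'" using ex_new_if_finite[OF infinite_UNIV_nat finite_keys] by blast
  define \<mu> where "\<mu> = single i (Suc n) + \<mu>'"
  have lk: "lookup \<mu> j = (if j = i then Suc n else lookup \<mu>' j)" for j
    using i by (auto simp: \<mu>_def lookup_add lookup_single when_def in_keys_iff)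
  have keys: "keys \<mu> = insert i (keys \<mu>')" by (auto simp: in_keys_iff lk split: if_splits)
  have "finite {j. Suc n \<le> lookup \<mu> j}"
    by (rule finite_subset[of _ "keys \<mu>"]) (auto simp: in_keys_iff)
  moreover have "c (\<mu> - single i (Suc n)) \<noteq> 0" using \<mu>' by (simp add: c \<mu>_def)
  ultimately have "(\<Sum>j | Suc n \<le> lookup \<mu> j. c (\<mu> - single j (Suc n))) \<noteq> 0"
    by (auto simp: lk intro!: exI[of _ i])
  moreover have "mps_nth (mon_val psum (single n 1 + \<nu>) :: (nat, 'a) mps) \<mu> =
      of_nat (\<Sum>j | Suc n \<le> lookup \<mu> j. c (\<mu> - single j (Suc n)))"
    by (simp add: mon_val_add mon_val_single mps_nth_psum_mult c)
  ultimately have "mps_nth (mon_val psum (single n 1 + \<nu>) :: (nat, 'a) mps) \<mu> \<noteq> 0"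
    by (metis of_nat_eq_0_iff)
  then show ?case using i \<mu>' keys by (auto simp: mdeg_add)
qed

text \<open>Triangularity: a product with the most factors in a relation is detected by a monomial
  with as many variables. Through \<open>mon_type\<close> this monomial determines the product, so
  all other terms vanish there.\<close>

lemma subst_psums_psum_inj:
  fixes P Q :: "(nat \<Rightarrow>\<^sub>0 nat) \<Rightarrow>\<^sub>0 'a :: {idom, ring_char_0}"
  assumes "subst_psums mps_const psum P = (subst_psums mps_const psum Q :: (nat, 'a) mps)"
  shows "P = Q"
proof (rule ccontr)
  assume "P \<noteq> Q"
  define R where "R = P - Q"
  interpret c: ring_morphism "mps_const :: 'a \<Rightarrow> (nat, 'a) mps" by (rule ring_morphism_mps_const)
  interpret s: ring_morphism "subst_psums mps_const (psum :: nat \<Rightarrow> (nat, 'a) mps)"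
    by (rule c.ring_morphism_subst_psums)
  have R0: "subst_psums mps_const (psum :: nat \<Rightarrow> (nat, 'a) mps) R = 0"
    unfolding R_def s.diff using assms by simp
  have "R \<noteq> 0" using \<open>P \<noteq> Q\<close> by (simp add: R_def)
  then have ne: "keys R \<noteq> {}"
    by (metis ex_in_conv in_keys_iff lookup_zero poly_mapping_eqI)
  define d where "d = Max (mdeg ` keys R)"
  have "d \<in> mdeg ` keys R" unfolding d_def using ne by (intro Max_in) auto
  then obtain \<nu> where \<nu>: "\<nu> \<in> keys R" "mdeg \<nu> = d" by auto
  have max: "mdeg \<nu>' \<le> mdeg \<nu>" if "\<nu>' \<in> keys R" for \<nu>'
    unfolding \<nu>(2) d_def using that by (intro Max_ge) auto
  obtain \<mu> where \<mu>: "mps_nth (mon_val psum \<nu> :: (nat, 'a) mps) \<mu> \<noteq> 0" "card (keys \<mu>) = mdeg \<nu>"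
    using mon_val_psum_witness by blast
  have other: "mps_nth (mon_val psum \<nu>' :: (nat, 'a) mps) \<mu> = 0" if "\<nu>' \<in> keys R" "\<nu>' \<noteq> \<nu>" for \<nu>'
  proof (rule ccontr)
    assume "mps_nth (mon_val psum \<nu>' :: (nat, 'a) mps) \<mu> \<noteq> 0"
    from mon_val_psum_support[OF this] max[OF that(1)] \<mu>(2) have "mon_type \<mu> = \<nu>'" by simp
    moreover from mon_val_psum_support[OF \<mu>(1)] \<mu>(2) have "mon_type \<mu> = \<nu>" by simp
    ultimately show False using that by simp
  qed
  have "0 = mps_nth (subst_psums mps_const (psum :: nat \<Rightarrow> (nat, 'a) mps) R) \<mu>" by (simp add: R0)
  also have "\<dots> = (\<Sum>\<nu>'\<in>keys R. lookup R \<nu>' * mps_nth (mon_val psum \<nu>') \<mu>)"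
    by (simp add: subst_psums_eq_pm_eval pm_eval_def mps_nth_sum mps_nth_const_mult)
  also have "\<dots> = (\<Sum>\<nu>'\<in>{\<nu>}. lookup R \<nu>' * mps_nth (mon_val psum \<nu>') \<mu>)"
    using \<nu> other by (intro sum.mono_neutral_right) auto
  finally show False using \<nu> \<mu> by (simp add: in_keys_iff)
qed

lemma psum_expansion_subst:
  fixes P :: "(nat \<Rightarrow>\<^sub>0 nat) \<Rightarrow>\<^sub>0 'a :: field_char_0"
  shows "psum_expansion (subst_psums mps_const psum P) = P"
  unfolding psum_expansion_def by (rule the_equality) (auto dest: subst_psums_psum_inj)

section \<open>Products of power sums as symmetric functions\<close>

lemma of_nat_in_Qqt: "(of_nat n :: 'a qtfield) \<in> Qqt"
proof -
  have "(of_nat n :: 'a qtseries) \<in> qt_polys" for n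
  proof -
    have "{\<mu>. mps_nth (of_nat n :: 'a qtseries) \<mu> \<noteq> 0} \<subseteq> {0}"
      by (auto simp: of_nat_mps mps_nth_const)
    moreover from this have "finite {\<mu>. mps_nth (of_nat n :: 'a qtseries) \<mu> \<noteq> 0}"
      by (rule finite_subset) simp
    ultimately show ?thesis by (auto simp: qt_polys_def)
  qed
  from this[of n] this[of 1] have "Fract (of_nat n) (1 :: 'a qtseries) \<in> Qqt"
    unfolding Qqt_def by (intro CollectI exI conjI) (rule refl, auto)
  then show ?thesis by (simp add: of_nat_fract)
qed

lemma map_key_add_bij: "bij \<pi> \<Longrightarrow> map_key \<pi> (\<alpha> + \<beta>) = map_key \<pi> \<alpha> + map_key \<pi> \<beta>"
  by (simp add: map_key_plus bij_is_inj)

lemma lookup_map_key: "inj \<pi> \<Longrightarrow> lookup (map_key \<pi> \<alpha>) i = lookup \<alpha> (\<pi> i)"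
  by (simp add: map_key.rep_eq)

lemma map_key_inverse:
  assumes "bij \<pi>"
  shows "map_key \<pi> (map_key (inv \<pi>) \<alpha>) = \<alpha>" "map_key (inv \<pi>) (map_key \<pi> \<alpha>) = \<alpha>"
  using assms
  by (auto intro!: poly_mapping_eqI simp: lookup_map_key bij_is_inj bij_imp_bij_inv bij_is_surj surj_f_inv_f)

lemma map_key_single_bij:
  assumes "bij \<pi>"
  shows "map_key \<pi> (single i n) = single (inv \<pi> i) n"
  using assms
  by (intro poly_mapping_eqI) (auto simp: lookup_map_key bij_is_inj lookup_single when_def bij_inv_eq_iff bij_is_surj surj_f_inv_f)

lemma symmetric_mult:
  fixes f g :: "('v, 'a :: comm_ring_1) mps"
  assumes "bij \<pi>" and f: "\<And>\<mu>. mps_nth f (map_key \<pi> \<mu>) = mps_nth f \<mu>"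
    and g: "\<And>\<mu>. mps_nth g (map_key \<pi> \<mu>) = mps_nth g \<mu>"
  shows "mps_nth (f * g) (map_key \<pi> \<mu>) = mps_nth (f * g) \<mu>"
  unfolding mps_nth_mult
  by (rule sum.reindex_bij_witness[where j = "map_prod (map_key (inv \<pi>)) (map_key (inv \<pi>))"
        and i = "map_prod (map_key \<pi>) (map_key \<pi>)"])
     (use assms(1) f[of "map_key (inv \<pi>) _"] g[of "map_key (inv \<pi>) _"] in
       \<open>auto simp: splits_def map_key_inverse bij_imp_bij_inv simp flip: map_key_add_bij\<close>)

lemma psum_symmetric:
  assumes "bij \<pi>"
  shows "mps_nth (psum n) (map_key \<pi> \<mu>) = mps_nth (psum n) \<mu>"
proof -
  have "(\<exists>i. map_key \<pi> \<mu> = single i n) \<longleftrightarrow> (\<exists>i. \<mu> = single i n)"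
    by (metis assms map_key_inverse map_key_single_bij bij_imp_bij_inv)
  then show ?thesis by (simp add: mps_nth_psum)
qed

lemma mon_val_psum_in_symfuns: "mon_val psum \<nu> \<in> symfuns"
proof -
  let ?F = "mon_val psum \<nu> :: (nat, 'a qtfield) mps"
  have "mps_nth ?F \<mu> \<in> Qqt" for \<mu>
    using mon_val_psum_nat_coeff[of \<nu>] by (metis of_nat_in_Qqt)
  moreover have "\<exists>d. \<forall>\<mu>. mps_nth ?F \<mu> \<noteq> 0 \<longrightarrow> mdeg \<mu> \<le> d"
  proof (induction \<nu> rule: monomial_induct)
    case zero
    show ?case by (rule exI[of _ 0]) (auto simp: mps_nth_1 split: if_splits)
  next
    case (add i \<nu>)
    then obtain d where d: "\<And>\<mu>. mps_nth (mon_val psum \<nu> :: (nat, 'a qtfield) mps) \<mu> \<noteq> 0 \<Longrightarrow> mdeg \<mu> \<le> d" by blast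
    have "mdeg \<mu> \<le> Suc i + d" if "mps_nth (mon_val psum (single i 1 + \<nu>) :: (nat, 'a qtfield) mps) \<mu> \<noteq> 0" for \<mu>
    proof -
      from that obtain \<alpha> \<beta> where "\<alpha> + \<beta> = \<mu>" "mps_nth (psum (Suc i)) \<alpha> * mps_nth (mon_val psum \<nu> :: (nat, 'a qtfield) mps) \<beta> \<noteq> 0"
        unfolding mon_val_add mps_nth_mult mon_val_single power_one_right
        by (auto elim!: sum.not_neutral_contains_not_neutral simp: splits_def)
      then show ?thesis using d[of \<beta>] by (auto simp: mdeg_add mps_nth_psum split: if_splits)
    qed
    then show ?case by blast
  qed
  moreover have "mps_nth ?F (map_key \<pi> \<mu>) = mps_nth ?F \<mu>" if "bij \<pi>" for \<pi> \<mu>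
  proof (induction \<nu> arbitrary: \<mu> rule: monomial_induct)
    case zero
    have "map_key \<pi> \<mu> = 0 \<longleftrightarrow> \<mu> = 0"
      by (metis that bij_is_inj bij_imp_bij_inv map_key_inverse(2) map_key_zero)
    then show ?case by (simp add: mps_nth_1)
  next
    case (add i \<nu>)
    then show ?case unfolding mon_val_add mon_val_single power_one_right
      by (intro symmetric_mult that psum_symmetric)
  qed
  ultimately show ?thesis by (simp add: symfuns_def mdeg_def)
qed

section \<open>Laurent polynomials acting on Laurent series\<close>

lemma ring_morphism_id: "ring_morphism (\<lambda>x. x)"
  by standard auto

lemma zmult_eq_pm_eval: "zmult h G c = pm_eval (\<lambda>x. x) (\<lambda>a. G (c - a)) h"
  by (simp add: zmult_def pm_eval_def)

lemma zmult_add: "zmult (h + h') G c = zmult h G c + zmult h' G c"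
  unfolding zmult_eq_pm_eval by (rule ring_morphism.pm_eval_add[OF ring_morphism_id])

lemma zmult_sum: "zmult (sum h A) G c = (\<Sum>x\<in>A. zmult (h x) G c)"
  unfolding zmult_eq_pm_eval by (rule ring_morphism.pm_eval_sum[OF ring_morphism_id])

lemma zmult_single: "zmult (single a x) G c = x * G (c - a)"
  unfolding zmult_eq_pm_eval by (rule pm_eval_single) simp

lemma zmult_0 [simp]: "zmult 0 G c = 0"
  by (simp add: zmult_def)

lemma zmult_mult: "zmult (h * h') G c = zmult h (zmult h' G) c"
proof -
  have "h * h' = (\<Sum>a\<in>keys h. \<Sum>b\<in>keys h'. single (a + b) (lookup h a * lookup h' b))"
    by (subst poly_mapping_eq_sum_single[of h], subst poly_mapping_eq_sum_single[of h'])
       (simp add: sum_product mult_single)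
  then have "zmult (h * h') G c = (\<Sum>a\<in>keys h. \<Sum>b\<in>keys h'. lookup h a * lookup h' b * G (c - (a + b)))"
    by (simp add: zmult_sum zmult_single)
  then show ?thesis by (simp add: zmult_def sum_distrib_left mult.assoc diff_diff_eq)
qed

lemma zmult_commute: "zmult h (zmult h' G) c = zmult h' (zmult h G) c"
  by (metis mult.commute zmult_mult)

lemma zmult_scalar: "zmult (single 0 x) G = (\<lambda>c. x * G c)"
  by (rule ext) (simp add: zmult_single)

lemma zmult_shift: "zmult h (\<lambda>a. G (a + d)) c = zmult h G (c + d)"
  by (simp add: zmult_def algebra_simps)

text \<open>Extends \<open>const_term\<close> to exponents other than 0, since words in the D_b pick
  out the coefficient of z^a.\<close>

definition zact :: "('v, 'a :: comm_ring_1 laurent) mps \<Rightarrow> 'a zseries \<Rightarrow> (nat \<Rightarrow>\<^sub>0 int) \<Rightarrow> ('v, 'a) mps" where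
  "zact H G c = Abs_mps (\<lambda>\<mu>. zmult (mps_nth H \<mu>) G c)"

lemma mps_nth_zact [simp]: "mps_nth (zact H G c) \<mu> = zmult (mps_nth H \<mu>) G c"
  by (simp add: zact_def)

lemma const_term_eq_zact: "const_term H G = zact H G 0"
  by (simp add: const_term_def zact_def)

lemma zact_add: "zact (H + H') G c = zact H G c + zact H' G c"
  by (rule mps_eqI) (simp add: zmult_add)

lemma zact_sum: "zact (sum H A) G c = (\<Sum>x\<in>A. zact (H x) G c)"
  by (rule mps_eqI) (simp add: mps_nth_sum zmult_sum)

lemma zact_mult_const: "zact (H * mps_const h) G c = zact H (zmult h G) c"
  by (rule mps_eqI) (simp add: mps_nth_mult_const zmult_mult)

definition inc :: "('v, 'a :: comm_ring_1) mps \<Rightarrow> ('v, 'a laurent) mps" where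
  "inc = mps_map (single 0)"

lemma ring_morphism_inc: "ring_morphism inc"
  unfolding inc_def by (rule ring_morphism.ring_morphism_mps_map[OF ring_morphism_single])

lemma inc_mps_const: "inc (mps_const c) = mps_const (single 0 c)"
  unfolding inc_def by (rule ring_morphism.mps_map_const[OF ring_morphism_single])

lemma inc_psum [simp]: "inc (psum n) = psum n"
  by (rule mps_eqI) (simp add: inc_def mps_nth_psum)

text \<open>A series in the x_i alone contains no z_i and leaves the coefficient extraction. The
  elimination of p_n[X] and the factors h_r[-X] both rely on this.\<close>

lemma zact_inc_mult: "zact (inc Y * H) G c = Y * zact H G c"
  by (rule mps_eqI)
     (simp add: mps_nth_mult zmult_sum zmult_mult split_beta inc_def zmult_scalar)

section \<open>The alphabet $X + \sum_{i \in I} M/z_i$\<close>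

definition scalar :: "'a :: comm_ring_1 \<Rightarrow> (nat, 'a laurent) mps" where
  "scalar c = mps_const (single 0 c)"

lemma ring_morphism_scalar: "ring_morphism scalar"
  unfolding scalar_def by (rule ring_morphism_comp[OF ring_morphism_mps_const ring_morphism_single])

text \<open>p_n of the sum of the M/z_i over \<open>I\<close>. General index sets occur because
  words of operators are taken apart one variable at a time.\<close>

definition shiftM :: "nat set \<Rightarrow> nat \<Rightarrow> (nat, 'w qtfield laurent) mps" where
  "shiftM I n = (\<Sum>i\<in>I. mps_const (single (single i (- int n)) (Fract (pM n) 1)))"

definition XM :: "nat set \<Rightarrow> nat \<Rightarrow> (nat, 'w qtfield laurent) mps" where
  "XM I n = psum n + shiftM I n"

definition OmX :: "nat set \<Rightarrow> (nat, 'w qtfield laurent) mps" where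
  "OmX I = (\<Prod>i\<in>I. Omega_at (\<lambda>n. - psum n) (single i 1))"

lemma X_part_eq:
  fixes F :: "(nat, 'a qtfield) mps"
  shows "X_part k F = subst_psums scalar (XM {1..k}) (psum_expansion F) * OmX {1..k}"
proof -
  have "pXM k = (XM {1..k} :: nat \<Rightarrow> (nat, 'a qtfield laurent) mps)"
    by (rule ext) (simp add: pXM_def XM_def shiftM_def)
  then show ?thesis by (simp add: X_part_def pleth_def OmX_def scalar_def[abs_def])
qed

text \<open>As h_r[-X] is homogeneous of degree r, only r = \<open>mdeg \<mu>\<close> contributes at
  \<mu>.\<close>

lemma mps_nth_Omega_at_minus_psum:
  "mps_nth (Omega_at (\<lambda>n. - psum n :: (nat, 'a :: field_char_0) mps) (single i 1)) \<mu> =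
     (if squarefree_mon \<mu> then single (single i (int (mdeg \<mu>))) ((- 1) ^ mdeg \<mu>) else 0)"
proof -
  have "Sum_any (\<lambda>r. single (Poly_Mapping.map (\<lambda>x. int r * x) (single i 1))
      (mps_nth (fps_nth (Omega (\<lambda>n. - psum n :: (nat, 'a) mps)) r) \<mu>)) =
    (\<Sum>r\<in>{mdeg \<mu>}. single (Poly_Mapping.map (\<lambda>x. int r * x) (single i 1))
      (mps_nth (fps_nth (Omega (\<lambda>n. - psum n :: (nat, 'a) mps)) r) \<mu>))"
    by (rule Sum_any.expand_superset) (auto simp: Omega_minus_psum)
  then show ?thesis by (simp add: Omega_at_def Omega_minus_psum)
qed

text \<open>Substitution of z_(\<sigma> i) for z_i. Exponent vectors are functions of the index and
  are pulled back along the inverse; coefficients then follow the convention of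
  \<open>Sym\<close>.\<close>

definition perm_laurent :: "(nat \<Rightarrow> nat) \<Rightarrow> 'a :: comm_ring_1 laurent \<Rightarrow> 'a laurent" where
  "perm_laurent \<sigma> = pm_eval (single 0) (\<lambda>a. single (map_key (inv \<sigma>) a) 1)"

lemma ring_morphism_perm_laurent:
  assumes "bij \<sigma>"
  shows "ring_morphism (perm_laurent \<sigma>)"
proof -
  have bij: "bij (inv \<sigma>)" using assms by (rule bij_imp_bij_inv)
  show ?thesis unfolding perm_laurent_def
    by (rule ring_morphism.ring_morphism_pm_eval[OF ring_morphism_single])
       (simp_all add: mult_single map_key_add_bij[OF bij] map_key_zero[OF bij_is_inj[OF bij]])
qed

lemma perm_laurent_single:
  assumes "bij \<sigma>"
  shows "perm_laurent \<sigma> (single a c) = single (map_key (inv \<sigma>) a) c"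
  by (simp add: perm_laurent_def pm_eval_single mult_single)

lemma lookup_perm_laurent:
  assumes "bij \<sigma>"
  shows "lookup (perm_laurent \<sigma> h) b = lookup h (map_key \<sigma> b)"
proof -
  have "lookup (perm_laurent \<sigma> h) b = (\<Sum>a\<in>keys h. if a = map_key \<sigma> b then lookup h a else 0)"
    unfolding perm_laurent_def pm_eval_def lookup_sum
  proof (intro sum.cong refl)
    fix a
    have "map_key (inv \<sigma>) a = b \<longleftrightarrow> a = map_key \<sigma> b"
      using map_key_inverse[OF assms] by metis
    then show "lookup (single 0 (lookup h a) * single (map_key (inv \<sigma>) a) 1) b =
        (if a = map_key \<sigma> b then lookup h a else 0)"
      by (auto simp: mult_single lookup_single when_def)
  qed
  also have "\<dots> = lookup h (map_key \<sigma> b)" by (simp add: in_keys_iff)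
  finally show ?thesis .
qed

lemma (in ring_morphism) subst_psums_map:
  fixes \<iota> :: "'c :: comm_ring_1 \<Rightarrow> 'a"
  shows "\<phi> (subst_psums \<iota> e P) = subst_psums (\<lambda>c. \<phi> (\<iota> c)) (\<lambda>n. \<phi> (e n)) P"
  by (simp add: subst_psums_eq_pm_eval pm_eval_def sum mult mon_val)

text \<open>A substitution in the coefficients commutes with plethysm, so it only permutes the terms
  M/z_i of the alphabet and the factors Omega[-z_i X].\<close>

lemma X_part_perm:
  fixes F :: "(nat, 'w qtfield) mps"
  assumes \<sigma>: "\<sigma> permutes {1..k}"
  shows "mps_map (perm_laurent \<sigma>) (X_part k F) = X_part k F"
proof -
  have bij: "bij \<sigma>" using \<sigma> by (rule permutes_bij)
  interpret p: ring_morphism "perm_laurent \<sigma> :: 'w qtfield laurent \<Rightarrow> _"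
    by (rule ring_morphism_perm_laurent[OF bij])
  interpret m: ring_morphism "mps_map (perm_laurent \<sigma>) :: (nat, 'w qtfield laurent) mps \<Rightarrow> _"
    by (rule p.ring_morphism_mps_map)
  have key: "map_key (inv \<sigma>) (single i n) = single (\<sigma> i) n" for i and n :: int
    using map_key_single_bij[OF bij_imp_bij_inv[OF bij], of i n] bij by (simp add: inv_inv_eq)
  have sh: "mps_map (perm_laurent \<sigma>) (shiftM {1..k} n :: (nat, 'w qtfield laurent) mps) = shiftM {1..k} n" for n
  proof -
    have "mps_map (perm_laurent \<sigma>) (shiftM {1..k} n :: (nat, 'w qtfield laurent) mps) =
        (\<Sum>i\<in>{1..k}. mps_const (single (single (\<sigma> i) (- int n)) (Fract (pM n) 1)))"
      by (simp add: shiftM_def m.sum p.mps_map_const perm_laurent_single bij key)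
    also have "\<dots> = shiftM {1..k} n"
      unfolding shiftM_def
      using sum.permute[OF \<sigma>, of "\<lambda>i. mps_const (single (single i (- int n)) (Fract (pM n) 1)) :: (nat, 'w qtfield laurent) mps"]
      by (simp add: o_def)
    finally show ?thesis .
  qed
  have ps: "mps_map (perm_laurent \<sigma>) (psum n :: (nat, 'w qtfield laurent) mps) = psum n" for n
    by (rule mps_eqI) (simp add: mps_nth_psum)
  have XM: "mps_map (perm_laurent \<sigma>) (XM {1..k} n :: (nat, 'w qtfield laurent) mps) = XM {1..k} n" for n
    by (simp only: XM_def m.add sh ps)
  have sc: "mps_map (perm_laurent \<sigma>) (scalar c) = scalar c" for c :: "'w qtfield"
    unfolding scalar_def p.mps_map_const perm_laurent_single[OF bij]
    by (simp add: map_key_zero[OF bij_is_inj[OF bij_imp_bij_inv[OF bij]]])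
  have "mps_map (perm_laurent \<sigma>) (Omega_at (\<lambda>n. - psum n) (single i 1) :: (nat, 'w qtfield laurent) mps) =
      Omega_at (\<lambda>n. - psum n) (single (\<sigma> i) 1)" for i
    by (rule mps_eqI) (simp add: mps_nth_Omega_at_minus_psum perm_laurent_single bij key)
  then have "mps_map (perm_laurent \<sigma>) (OmX {1..k} :: (nat, 'w qtfield laurent) mps) =
      (\<Prod>i\<in>{1..k}. Omega_at (\<lambda>n. - psum n) (single (\<sigma> i) 1))"
    by (simp add: OmX_def m.prod)
  also have "\<dots> = OmX {1..k}"
    unfolding OmX_def
    using prod.permute[OF \<sigma>, of "\<lambda>i. Omega_at (\<lambda>n. - psum n) (single i 1) :: (nat, 'w qtfield laurent) mps"]
    by (simp add: o_def)
  finally have Om: "mps_map (perm_laurent \<sigma>) (OmX {1..k} :: (nat, 'w qtfield laurent) mps) = OmX {1..k}" .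
  show ?thesis
    by (simp only: X_part_eq m.mult m.subst_psums_map XM sc Om)
qed

lemma map_key_uminus_bij: "bij \<pi> \<Longrightarrow> map_key \<pi> (- a) = - map_key \<pi> (a :: 'v \<Rightarrow>\<^sub>0 int)"
  by (rule poly_mapping_eqI) (simp add: lookup_map_key bij_is_inj)

text \<open>Symmetrization is self-adjoint for the pairing by constant terms: each permutation moves
  over to \<open>h\<close>, which absorbs it, and the k! equal terms cancel
  \<open>inverse (fact k)\<close>.\<close>

lemma zmult_Sym:
  assumes inv: "\<And>\<sigma> a. \<sigma> permutes {1..k} \<Longrightarrow> lookup h (map_key \<sigma> a) = lookup h a"
  shows "zmult h (Sym k G) 0 = zmult h G 0"
proof -
  have eq: "(\<Sum>a\<in>keys h. lookup h a * G (map_key \<sigma> (- a))) = zmult h G 0"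
    if \<sigma>: "\<sigma> permutes {1..k}" for \<sigma>
  proof -
    have bij: "bij \<sigma>" using \<sigma> by (rule permutes_bij)
    have inv': "lookup h (map_key (Hilbert_Choice.inv \<sigma>) a) = lookup h a" for a
      using inv[OF \<sigma>, of "map_key (Hilbert_Choice.inv \<sigma>) a"] by (simp add: map_key_inverse bij)
    show ?thesis unfolding zmult_def
      by (rule sum.reindex_bij_witness[where j = "map_key \<sigma>" and i = "map_key (Hilbert_Choice.inv \<sigma>)"])
         (auto simp: map_key_inverse bij in_keys_iff inv[OF \<sigma>] inv' map_key_uminus_bij)
  qed
  have "zmult h (Sym k G) 0 =
      (\<Sum>a\<in>keys h. \<Sum>\<sigma> | \<sigma> permutes {1..k}. inverse (fact k) * (lookup h a * G (map_key \<sigma> (- a))))"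
    by (simp add: zmult_def Sym_def sum_distrib_left mult_ac)
  also have "\<dots> = (\<Sum>\<sigma> | \<sigma> permutes {1..k}. inverse (fact k) * (\<Sum>a\<in>keys h. lookup h a * G (map_key \<sigma> (- a))))"
    by (subst sum.swap) (simp add: sum_distrib_left)
  also have "\<dots> = (\<Sum>\<sigma> | \<sigma> permutes {1..k}. inverse (fact k) * zmult h G 0)"
    by (intro sum.cong refl) (simp add: eq)
  also have "\<dots> = zmult h G 0"
    by (simp add: card_permutations)
  finally show ?thesis .
qed

text \<open>Gives one direction of the equivalence; in the other it removes the top summand once its
  symmetrization is known to vanish.\<close>

lemma const_term_X_part_eq_0:
  assumes "Sym k G = (\<lambda>_. 0)"
  shows "const_term (X_part k F) G = 0"
proof (rule mps_eqI)
  fix \<mu>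
  have "lookup (mps_nth (X_part k F) \<mu>) (map_key \<sigma> a) = lookup (mps_nth (X_part k F) \<mu>) a"
    if "\<sigma> permutes {1..k}" for \<sigma> a
    using arg_cong[OF X_part_perm[OF that, of F], of "\<lambda>H. lookup (mps_nth H \<mu>) a"]
    by (simp add: lookup_perm_laurent[OF permutes_bij[OF that]])
  from zmult_Sym[where k = k, OF this, where G = G] show "mps_nth (const_term (X_part k F) G) \<mu> = mps_nth 0 \<mu>"
    by (simp add: const_term_eq_zact assms) (simp add: zmult_def)
qed

section \<open>Separating the symmetric parts\<close>

definition inj_maps :: "'j set \<Rightarrow> 'i set \<Rightarrow> ('j \<Rightarrow> 'i) set" where
  "inj_maps J T = {\<phi> \<in> J \<rightarrow>\<^sub>E T. inj_on \<phi> J}"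

text \<open>For positive exponents, a monomial symmetric function in the \<open>y i\<close> up to an
  integer factor. Summing over injections instead of distinct monomials avoids stabilizers.\<close>

definition orbit_sum :: "('i \<Rightarrow> 'b :: comm_ring_1) \<Rightarrow> 'i set \<Rightarrow> 'j set \<Rightarrow> ('j \<Rightarrow> nat) \<Rightarrow> 'b" where
  "orbit_sum y T J a = (\<Sum>\<phi>\<in>inj_maps J T. \<Prod>j\<in>J. y (\<phi> j) ^ a j)"

lemma finite_inj_maps: "finite J \<Longrightarrow> finite T \<Longrightarrow> finite (inj_maps J T)"
  unfolding inj_maps_def by (rule finite_subset[OF _ finite_PiE[of J "\<lambda>_. T"]]) auto

text \<open>In the product with a further power sum, the new index is either distinct from all the others or
  equal to exactly one of them.\<close>

lemma orbit_sum_insert: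
  fixes y :: "'i \<Rightarrow> 'b :: comm_ring_1"
  assumes fin: "finite T" "finite J" and j0: "j0 \<notin> J"
  shows "(\<Sum>i\<in>T. y i ^ a j0) * orbit_sum y T J a =
    orbit_sum y T (insert j0 J) a + (\<Sum>j\<in>J. orbit_sum y T J (a(j := a j + a j0)))"
proof -
  define w where "w = (\<lambda>\<phi>. \<Prod>j\<in>J. y (\<phi> j) ^ a j)"
  have "(\<Sum>i\<in>T. y i ^ a j0) * orbit_sum y T J a = (\<Sum>\<phi>\<in>inj_maps J T. (\<Sum>i\<in>T. y i ^ a j0) * w \<phi>)"
    by (simp add: orbit_sum_def w_def sum_distrib_left)
  also have "\<dots> = (\<Sum>\<phi>\<in>inj_maps J T. (\<Sum>i\<in>T - \<phi> ` J. y i ^ a j0 * w \<phi>) + (\<Sum>j\<in>J. y (\<phi> j) ^ a j0 * w \<phi>))"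
  proof (intro sum.cong refl)
    fix \<phi> assume "\<phi> \<in> inj_maps J T"
    then have \<phi>: "\<phi> ` J \<subseteq> T" "inj_on \<phi> J" by (auto simp: inj_maps_def)
    have "(\<Sum>i\<in>T. y i ^ a j0) = (\<Sum>i\<in>T - \<phi> ` J. y i ^ a j0) + (\<Sum>i\<in>\<phi> ` J. y i ^ a j0)"
      using fin \<phi>(1) by (simp add: sum.subset_diff)
    then show "(\<Sum>i\<in>T. y i ^ a j0) * w \<phi> = (\<Sum>i\<in>T - \<phi> ` J. y i ^ a j0 * w \<phi>) + (\<Sum>j\<in>J. y (\<phi> j) ^ a j0 * w \<phi>)"
      using \<phi>(2) by (simp add: sum.reindex distrib_right sum_distrib_right)
  qed
  also have "\<dots> = (\<Sum>\<phi>\<in>inj_maps J T. \<Sum>i\<in>T - \<phi> ` J. y i ^ a j0 * w \<phi>) +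
      (\<Sum>j\<in>J. \<Sum>\<phi>\<in>inj_maps J T. y (\<phi> j) ^ a j0 * w \<phi>)"
    by (subst sum.swap) (simp add: sum.distrib)
  also have "(\<Sum>\<phi>\<in>inj_maps J T. \<Sum>i\<in>T - \<phi> ` J. y i ^ a j0 * w \<phi>) = orbit_sum y T (insert j0 J) a"
  proof -
    have "(\<Sum>\<phi>\<in>inj_maps J T. \<Sum>i\<in>T - \<phi> ` J. y i ^ a j0 * w \<phi>) =
        (\<Sum>(\<phi>, i)\<in>(SIGMA \<phi>:inj_maps J T. T - \<phi> ` J). y i ^ a j0 * w \<phi>)"
      using fin by (subst sum.Sigma) (auto simp: finite_inj_maps)
    also have "\<dots> = (\<Sum>\<psi>\<in>inj_maps (insert j0 J) T. y (\<psi> j0) ^ a j0 * w \<psi>)"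
    proof (rule sum.reindex_bij_witness[where j = "\<lambda>(\<phi>, i). \<phi>(j0 := i)" and i = "\<lambda>\<psi>. (\<psi>(j0 := undefined), \<psi> j0)"])
      fix x assume "x \<in> (SIGMA \<phi>:inj_maps J T. T - \<phi> ` J)"
      then obtain \<phi> i where x: "x = (\<phi>, i)" "\<phi> \<in> inj_maps J T" "i \<in> T - \<phi> ` J" by auto
      have "\<phi> j0 = undefined" using x(2) j0 by (auto simp: inj_maps_def PiE_def extensional_def)
      then show "(((case x of (\<phi>, i) \<Rightarrow> \<phi>(j0 := i))(j0 := undefined)), (case x of (\<phi>, i) \<Rightarrow> \<phi>(j0 := i)) j0) = x"
        by (auto simp: x(1))
      show "(case x of (\<phi>, i) \<Rightarrow> \<phi>(j0 := i)) \<in> inj_maps (insert j0 J) T"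
        using x j0 by (auto simp: inj_maps_def PiE_def extensional_def inj_on_def)
      have "w (\<phi>(j0 := i)) = w \<phi>" unfolding w_def by (rule prod.cong) (use j0 in auto)
      then show "y ((case x of (\<phi>, i) \<Rightarrow> \<phi>(j0 := i)) j0) ^ a j0 * w (case x of (\<phi>, i) \<Rightarrow> \<phi>(j0 := i)) =
          (case x of (\<phi>, i) \<Rightarrow> y i ^ a j0 * w \<phi>)"
        by (simp add: x(1))
    next
      fix \<psi> assume \<psi>: "\<psi> \<in> inj_maps (insert j0 J) T"
      have "\<psi> j0 \<notin> \<psi> ` J" using \<psi> j0 by (auto simp: inj_maps_def inj_on_def)
      then show "(\<psi>(j0 := undefined), \<psi> j0) \<in> (SIGMA \<phi>:inj_maps J T. T - \<phi> ` J)"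
        using \<psi> j0 by (auto simp: inj_maps_def PiE_def extensional_def inj_on_def)
    qed auto
    finally show ?thesis using fin j0 by (simp add: orbit_sum_def w_def)
  qed
  also have "(\<Sum>j\<in>J. \<Sum>\<phi>\<in>inj_maps J T. y (\<phi> j) ^ a j0 * w \<phi>) = (\<Sum>j\<in>J. orbit_sum y T J (a(j := a j + a j0)))"
    unfolding orbit_sum_def
  proof (intro sum.cong refl)
    fix j \<phi> assume j: "j \<in> J"
    have "(\<Prod>l\<in>J - {j}. y (\<phi> l) ^ (a(j := a j + a j0)) l) = (\<Prod>l\<in>J - {j}. y (\<phi> l) ^ a l)"
      by (rule prod.cong) auto
    then show "y (\<phi> j) ^ a j0 * w \<phi> = (\<Prod>l\<in>J. y (\<phi> l) ^ (a(j := a j + a j0)) l)"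
      unfolding w_def by (simp add: prod.remove[OF fin(2) j] power_add mult_ac)
  qed
  finally show ?thesis .
qed

text \<open>\<open>orbit_sum_insert\<close> is solved for the orbit sum over
  \<open>insert j0 J\<close>; the other terms live on \<open>J\<close>, with one more power sum or a
  larger exponent, hence the induction over all \<open>\<nu>\<close> and \<open>a\<close>. Only
  signs occur as coefficients, so an additive \<Lambda> suffices. Positive exponents keep p_0
  out.\<close>

lemma orbit_sum_in_power_sum_span:
  fixes y :: "'i \<Rightarrow> 'b :: comm_ring_1" and J :: "'j set" and \<Lambda> :: "'b \<Rightarrow> 'c :: comm_ring_1"
  assumes add: "\<And>u v. \<Lambda> (u + v) = \<Lambda> u + \<Lambda> v"
    and pow: "\<And>\<nu>. \<Lambda> (mon_val (\<lambda>n. \<Sum>i\<in>T. y i ^ n) \<nu>) = 0"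
    and fin: "finite T" "finite J" and pos: "\<And>j. j \<in> J \<Longrightarrow> a j > 0"
  shows "\<Lambda> (mon_val (\<lambda>n. \<Sum>i\<in>T. y i ^ n) \<nu> * orbit_sum y T J a) = 0"
  using fin(2) pos
proof (induction J arbitrary: a \<nu> rule: finite_induct)
  case empty
  have "(inj_maps {} T :: ('j \<Rightarrow> 'i) set) = {\<lambda>_. undefined}" by (auto simp: inj_maps_def)
  then show ?case by (simp add: orbit_sum_def pow)
next
  case (insert j0 J)
  have \<Lambda>0: "\<Lambda> 0 = 0" using add[of 0 0] by simp
  have \<Lambda>sum: "\<Lambda> (sum f A) = (\<Sum>x\<in>A. \<Lambda> (f x))" for f and A :: "'j set"
    by (induction A rule: infinite_finite_induct) (auto simp: add \<Lambda>0)
  let ?p = "\<lambda>n. \<Sum>i\<in>T. y i ^ n"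
  have "?p (a j0) * mon_val ?p \<nu> = mon_val ?p (single (a j0 - 1) 1 + \<nu>)"
    using insert.prems[of j0] by (simp add: mon_val_add mon_val_single)
  then have "mon_val ?p (single (a j0 - 1) 1 + \<nu>) * orbit_sum y T J a =
      mon_val ?p \<nu> * (?p (a j0) * orbit_sum y T J a)"
    by (simp add: mult_ac)
  also have "\<dots> = mon_val ?p \<nu> * orbit_sum y T (insert j0 J) a +
      (\<Sum>j\<in>J. mon_val ?p \<nu> * orbit_sum y T J (a(j := a j + a j0)))"
    using orbit_sum_insert[OF fin(1) insert.hyps(1,2), of y a] by (simp add: distrib_left sum_distrib_left)
  finally have "\<Lambda> (mon_val ?p (single (a j0 - 1) 1 + \<nu>) * orbit_sum y T J a) =
      \<Lambda> (mon_val ?p \<nu> * orbit_sum y T (insert j0 J) a) +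
      (\<Sum>j\<in>J. \<Lambda> (mon_val ?p \<nu> * orbit_sum y T J (a(j := a j + a j0))))"
    by (simp add: add \<Lambda>sum)
  moreover have "\<Lambda> (mon_val ?p (single (a j0 - 1) 1 + \<nu>) * orbit_sum y T J a) = 0"
    by (rule insert.IH) (use insert.prems in auto)
  moreover have "\<Lambda> (mon_val ?p \<nu> * orbit_sum y T J (a(j := a j + a j0))) = 0" for j
    by (rule insert.IH) (use insert.prems in auto)
  ultimately show ?case by simp
qed

section \<open>Coefficients at the test monomials (x_0 ... x_(N-1))^c\<close>

definition rect :: "nat \<Rightarrow> nat \<Rightarrow> (nat \<Rightarrow>\<^sub>0 nat)" where
  "rect N c = (\<Sum>j<N. single j c)"

lemma lookup_rect: "lookup (rect N c) j = (if j < N then c else 0)"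
  by (simp add: rect_def lookup_sum lookup_single when_def)

lemma OmX_insert: "finite I \<Longrightarrow> i \<notin> I \<Longrightarrow> OmX (insert i I) = Omega_at (\<lambda>n. - psum n) (single i 1) * OmX I"
  by (simp add: OmX_def)

text \<open>Each factor is squarefree in the x_j, so \<open>card I\<close> factors cannot produce a
  higher exponent than \<open>card I\<close>.\<close>

lemma OmX_nth_eq_0:
  assumes "finite I" "lookup \<mu> j > card I"
  shows "mps_nth (OmX I :: (nat, 'w qtfield laurent) mps) \<mu> = 0"
  using assms
proof (induction I arbitrary: \<mu> rule: finite_induct)
  case empty
  then show ?case by (auto simp: OmX_def mps_nth_1)
next
  case (insert i I)
  have "mps_nth (Omega_at (\<lambda>n. - psum n) (single i 1)) \<alpha> * mps_nth (OmX I :: (nat, 'w qtfield laurent) mps) \<beta> = 0" if "\<alpha> + \<beta> = \<mu>" for \<alpha> \<beta>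
  proof (cases "squarefree_mon \<alpha>")
    case True
    then have "lookup \<alpha> j \<le> 1" by (simp add: squarefree_mon_def)
    then have "lookup \<beta> j > card I" using insert that by (auto simp: lookup_add)
    then show ?thesis using insert.IH by simp
  qed (simp add: mps_nth_Omega_at_minus_psum)
  then show ?case using insert.hyps by (auto simp: OmX_insert mps_nth_mult splits_def intro!: sum.neutral)
qed

text \<open>The exponent \<open>card I\<close> is the largest possible, so every factor must
  contribute all of x_0, ..., x_(N-1), with coefficient (-z_i)^N.\<close>

lemma OmX_nth_rect:
  assumes "finite I"
  shows "mps_nth (OmX I :: (nat, 'w qtfield laurent) mps) (rect N (card I)) = single (\<Sum>i\<in>I. single i (int N)) ((- 1) ^ (N * card I))"
  using assms
proof (induction I rule: finite_induct)
  case empty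
  have "rect N 0 = 0" by (simp add: rect_def)
  then show ?case by (simp add: OmX_def mps_nth_1)
next
  case (insert i I)
  have sum: "rect N 1 + rect N (card I) = rect N (Suc (card I))"
    by (rule poly_mapping_eqI) (simp add: lookup_add lookup_rect)
  have "mps_nth (OmX (insert i I) :: (nat, 'w qtfield laurent) mps) (rect N (Suc (card I))) =
      (\<Sum>(\<alpha>, \<beta>)\<in>{(rect N 1, rect N (card I))}.
         mps_nth (Omega_at (\<lambda>n. - psum n) (single i 1)) \<alpha> * mps_nth (OmX I) \<beta>)"
    unfolding OmX_insert[OF insert.hyps] mps_nth_mult
  proof (intro sum.mono_neutral_right finite_splits ballI)
    show "{(rect N 1, rect N (card I))} \<subseteq> splits (rect N (Suc (card I)))"
      using sum by (simp add: splits_def)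
    fix x assume x: "x \<in> splits (rect N (Suc (card I))) - {(rect N 1, rect N (card I))}"
    then obtain \<alpha> \<beta> where ab: "x = (\<alpha>, \<beta>)" "\<alpha> + \<beta> = rect N (Suc (card I))" by (auto simp: splits_def)
    have lk: "lookup \<alpha> j + lookup \<beta> j = (if j < N then Suc (card I) else 0)" for j
      using arg_cong[OF ab(2), of "\<lambda>f. lookup f j"] by (simp add: lookup_add lookup_rect)
    have "\<not> squarefree_mon \<alpha> \<or> (\<exists>j. lookup \<beta> j > card I)"
    proof (rule ccontr)
      assume "\<not> (\<not> squarefree_mon \<alpha> \<or> (\<exists>j. lookup \<beta> j > card I))"
      then have le: "lookup \<alpha> j \<le> 1" "lookup \<beta> j \<le> card I" for j
        by (auto simp: squarefree_mon_def not_less)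
      have "lookup \<beta> j = (if j < N then card I else 0)" "lookup \<alpha> j = (if j < N then 1 else 0)" for j
        using lk[of j] le[of j] by (auto split: if_splits)
      then have "\<alpha> = rect N 1" "\<beta> = rect N (card I)" by (auto intro!: poly_mapping_eqI simp: lookup_rect)
      then show False using x ab by simp
    qed
    then show "(case x of (\<alpha>, \<beta>) \<Rightarrow> mps_nth (Omega_at (\<lambda>n. - psum n) (single i 1)) \<alpha> * mps_nth (OmX I) \<beta>) = 0"
      using OmX_nth_eq_0[OF insert.hyps(1)] by (auto simp: ab(1) mps_nth_Omega_at_minus_psum)
  qed
  moreover have "squarefree_mon (rect N 1)" by (simp add: squarefree_mon_def lookup_rect)
  moreover have "mdeg (rect N 1) = N"
    by (subst mdeg_superset[of "{..<N}"]) (auto simp: in_keys_iff lookup_rect split: if_splits)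
  ultimately show ?case
    using insert.hyps by (simp add: mps_nth_Omega_at_minus_psum insert.IH mult_single power_add)
qed

section \<open>Moments of the top series\<close>

lemma pM_neq_0:
  assumes "n > 0"
  shows "pM n \<noteq> 0"
proof -
  have "single v n \<noteq> 0" for v :: "'a qtvar"
    using assms by (metis lookup_single_eq lookup_zero not_gr_zero)
  then have "mps_nth (pM n :: 'a qtseries) 0 = 1"
    by (auto simp: pM_def mps_nth_mult mps_nth_1 mps_nth_var_power split: if_splits dest: sym)
  then show ?thesis by (metis mps_nth_0 zero_neq_one)
qed

lemma prod_single:
  "finite J \<Longrightarrow> (\<Prod>j\<in>J. single (f j) (1 :: 'a :: comm_ring_1)) = single (\<Sum>j\<in>J. f j) 1"
  by (induction J rule: finite_induct) (auto simp: mult_single)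

lemma single_single_power:
  "single (single i c) (1 :: 'a :: comm_ring_1) ^ n = single (single i (int n * c)) 1"
  by (induction n) (auto simp: mult_single algebra_simps simp flip: single_add)

lemma shiftM_eq:
  "shiftM I n = mps_const (single 0 (Fract (pM n) 1) * (\<Sum>i\<in>I. single (single i (- 1)) 1 ^ n))"
  by (simp add: shiftM_def single_single_power sum_distrib_left mult_single
      ring_morphism.sum[OF ring_morphism_mps_const])

lemma X_part_mon_val:
  "X_part k (mon_val psum \<nu>) = mon_val (XM {1..k}) \<nu> * OmX {1..k}"
proof -
  have "mon_val psum \<nu> = subst_psums mps_const psum (single \<nu> (1 :: 'a qtfield))"
    by (subst subst_psums_single) (auto intro!: mps_eqI simp: mps_nth_const mps_nth_const_mult mps_nth_1)
  then have "psum_expansion (mon_val psum \<nu> :: (nat, 'a qtfield) mps) = single \<nu> 1"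
    by (metis psum_expansion_subst)
  moreover have "scalar (0 :: 'a qtfield) = 0" "scalar (1 :: 'a qtfield) = 1"
    using ring_morphism.zero[OF ring_morphism_scalar] ring_morphism.one[OF ring_morphism_scalar] by auto
  ultimately show ?thesis by (simp add: X_part_eq subst_psums_single)
qed

text \<open>Each factor $p_n[M]\sum_i z_i^{-n}$ is $p_n[X+\sum_i M/z_i] - p_n[X]$, where $p_n[X]$ can be taken out
  of the constant term.\<close>

lemma psum_moments_eq_0:
  fixes G :: "nat \<Rightarrow> 'w qtfield zseries"
  assumes "\<And>\<nu>. (\<Sum>k=1..m. const_term (X_part k (mon_val psum \<nu>)) (G k)) = 0"
  shows "(\<Sum>k=1..m. zact (mon_val (shiftM {1..k}) \<nu>1 * mon_val (XM {1..k}) \<nu>2 * OmX {1..k}) (G k) 0) = 0"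
proof (induction \<nu>1 arbitrary: \<nu>2 rule: monomial_induct)
  case zero
  then show ?case using assms by (simp add: X_part_mon_val const_term_eq_zact)
next
  case (add i \<nu>)
  \<comment> \<open>\<open>\<nu>2\<close> is kept arbitrary because it absorbs the factor
    p_n[X + ...] for which a factor of the first product is traded.\<close>
  define R where "R = (\<lambda>k \<nu>2. mon_val (shiftM {1..k}) \<nu> * mon_val (XM {1..k}) \<nu>2 * OmX {1..k} :: (nat, 'w qtfield laurent) mps)"
  have "zact (mon_val (shiftM {1..k}) (single i 1 + \<nu>) * mon_val (XM {1..k}) \<nu>2 * OmX {1..k}) (G k) 0 =
      zact (R k (single i 1 + \<nu>2)) (G k) 0 - psum (Suc i) * zact (R k \<nu>2) (G k) 0" for k
  proof -
    have "R k (single i 1 + \<nu>2) =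
        mon_val (shiftM {1..k}) (single i 1 + \<nu>) * mon_val (XM {1..k}) \<nu>2 * OmX {1..k} + inc (psum (Suc i)) * R k \<nu>2"
      by (simp add: R_def mon_val_add mon_val_single XM_def[of _ "Suc i"] algebra_simps)
    then show ?thesis by (simp only: zact_add zact_inc_mult) simp
  qed
  then have "(\<Sum>k=1..m. zact (mon_val (shiftM {1..k}) (single i 1 + \<nu>) * mon_val (XM {1..k}) \<nu>2 * OmX {1..k}) (G k) 0) =
      (\<Sum>k=1..m. zact (R k (single i 1 + \<nu>2)) (G k) 0) - psum (Suc i) * (\<Sum>k=1..m. zact (R k \<nu>2) (G k) 0)"
    by (simp add: sum_subtractf sum_distrib_left)
  then show ?case using add.IH by (simp add: R_def)
qed

lemma top_moments_eq_0:
  fixes G :: "nat \<Rightarrow> 'w qtfield zseries"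
  assumes "m \<ge> 1" "N \<ge> 1"
    and "\<And>\<nu>. (\<Sum>k=1..m. const_term (X_part k (mon_val psum \<nu>)) (G k)) = 0"
  shows "zmult (mon_val (\<lambda>n. \<Sum>i\<in>{1..m}. single (single i (- 1)) 1 ^ n) \<nu> * single (\<Sum>i\<in>{1..m}. single i (int N)) 1) (G m) 0 = 0"
    (is "zmult (mon_val (?p m) \<nu> * ?z) _ _ = 0")
proof -
  interpret c: ring_morphism "mps_const :: 'w qtfield laurent \<Rightarrow> (nat, _) mps" by (rule ring_morphism_mps_const)
  interpret s: ring_morphism "single 0 :: 'w qtfield \<Rightarrow> 'w qtfield laurent" by (rule ring_morphism_single)
  \<comment> \<open>The factors p_n[M] are scalars; being nonzero, their product can be cancelled at
    the end.\<close>
  define C where "C = mon_val (\<lambda>n. Fract (pM n) 1 :: 'w qtfield) \<nu>"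
  have "C \<noteq> 0"
  proof -
    have "Fract (pM (Suc i)) 1 \<noteq> (0 :: 'w qtfield)" for i
      by (simp add: Zero_fract_def eq_fract pM_neq_0)
    then show ?thesis by (simp add: C_def mon_val_def)
  qed
  have sh: "mon_val (shiftM {1..k}) \<nu> = mps_const (single 0 C * mon_val (?p k) \<nu>)" for k
    unfolding shiftM_eq[abs_def] c.mon_val[symmetric] mon_val_times C_def s.mon_val ..
  define t where "t = (\<lambda>k. zmult (single 0 C * mon_val (?p k) \<nu> * mps_nth (OmX {1..k}) (rect N m)) (G k) 0)"
  have eq: "mps_nth (zact (mon_val (shiftM {1..k}) \<nu> * OmX {1..k}) (G k) 0) (rect N m) = t k" for k
    by (simp only: mps_nth_zact sh mps_nth_const_mult t_def)
  \<comment> \<open>As \<open>N\<close> is at least 1, x_0 occurs in \<open>rect N m\<close> with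
    exponent m, more than k factors can supply.\<close>
  have vanish: "t k = 0" if "k < m" for k
  proof -
    have "mps_nth (OmX {1..k}) (rect N m) = (0 :: 'w qtfield laurent)"
      by (rule OmX_nth_eq_0[where j = 0]) (use assms that in \<open>auto simp: lookup_rect\<close>)
    then show ?thesis by (simp only: t_def mult_zero_right zmult_0)
  qed
  have "0 = (\<Sum>k=1..m. mps_nth (zact (mon_val (shiftM {1..k}) \<nu> * OmX {1..k}) (G k) 0) (rect N m))"
    using arg_cong[OF psum_moments_eq_0[OF assms(3), of \<nu> 0], of "\<lambda>F. mps_nth F (rect N m)"]
    by (simp add: mps_nth_sum)
  also have "\<dots> = (\<Sum>k=1..m. t k)" by (simp only: eq)
  also have "\<dots> = (\<Sum>k\<in>{m}. t k)"
    by (intro sum.mono_neutral_right) (use assms(1) vanish in auto)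
  also have "\<dots> = zmult (single 0 C * mon_val (?p m) \<nu> * single (\<Sum>i\<in>{1..m}. single i (int N)) ((- 1) ^ (N * m))) (G m) 0"
    using OmX_nth_rect[of "{1..m}" N, where ?'w = 'w] by (simp add: t_def)
  also have "single 0 C * mon_val (?p m) \<nu> * single (\<Sum>i\<in>{1..m}. single i (int N)) ((- 1) ^ (N * m)) =
      single 0 (C * (- 1) ^ (N * m)) * (mon_val (?p m) \<nu> * ?z)"
  proof -
    have z: "single 0 ((- 1) ^ (N * m)) * ?z = single (\<Sum>i\<in>{1..m}. single i (int N)) ((- 1) ^ (N * m) :: 'w qtfield)"
      by (simp add: mult_single)
    show ?thesis unfolding s.mult z[symmetric] by (simp only: mult_ac)
  qed
  finally show ?thesis using \<open>C \<noteq> 0\<close> by (simp only: zmult_mult zmult_scalar) simp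
qed

text \<open>The sum of \<open>G m\<close> over the rearrangements of \<open>b\<close> is the
  constant term of \<open>G m\<close> against the symmetric Laurent polynomial formed from z^(-b),
  which is reached by the vanishing moments.\<close>

lemma Sym_top_eq_0:
  fixes G :: "nat \<Rightarrow> 'w qtfield zseries"
  assumes m: "m \<ge> 1"
    and supp: "\<And>a. \<not> keys a \<subseteq> {1..m} \<Longrightarrow> G m a = 0"
    and hyp: "\<And>\<nu>. (\<Sum>k=1..m. const_term (X_part k (mon_val psum \<nu>)) (G k)) = 0"
  shows "Sym m (G m) b = 0"
proof (cases "keys b \<subseteq> {1..m}")
  case False
  then obtain x where x: "x \<in> keys b" "x \<notin> {1..m}" by blast
  have "G m (map_key \<sigma> b) = 0" if "\<sigma> permutes {1..m}" for \<sigma>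
  proof (rule supp)
    have "lookup (map_key \<sigma> b) x = lookup b x"
      using permutes_not_in[OF that x(2)] by (simp add: lookup_map_key permutes_inj[OF that])
    then show "\<not> keys (map_key \<sigma> b) \<subseteq> {1..m}" using x unfolding subset_iff in_keys_iff by metis
  qed
  then show ?thesis by (simp add: Sym_def)
next
  case True
  define T where "T = {1..m}"
  \<comment> \<open>Shifting by \<open>N\<close> makes all exponents
    \<open>lookup b j + int N\<close> strictly positive, as orbit sums require. Since
    \<open>y i\<close> is 1/z_i, the factor (z_1 ... z_m)^N undoes the shift.\<close>
  define N where "N = 1 + (\<Sum>i\<in>T. nat \<bar>lookup b i\<bar>)"
  define a where "a = (\<lambda>j. nat (lookup b j + int N))"
  have aj: "int (a j) = lookup b j + int N" "a j > 0" if "j \<in> T" for j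
  proof -
    have "nat \<bar>lookup b j\<bar> < N"
      using member_le_sum[of j T "\<lambda>i. nat \<bar>lookup b i\<bar>"] that by (simp add: N_def T_def less_Suc_eq_le)
    then show "int (a j) = lookup b j + int N" "a j > 0" by (auto simp: a_def)
  qed
  define y :: "nat \<Rightarrow> 'w qtfield laurent" where "y = (\<lambda>i. single (single i (- 1)) 1)"
  define z :: "'w qtfield laurent" where "z = single (\<Sum>i\<in>T. single i (int N)) 1"
  have fin: "finite T" by (simp add: T_def)
  have "zmult (mon_val (\<lambda>n. \<Sum>i\<in>T. y i ^ n) 0 * orbit_sum y T T a * z) (G m) 0 = 0"
  proof (rule orbit_sum_in_power_sum_span[where \<Lambda> = "\<lambda>h. zmult (h * z) (G m) 0"])
    show "zmult (mon_val (\<lambda>n. \<Sum>i\<in>T. y i ^ n) \<nu> * z) (G m) 0 = 0" for \<nu>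
      using top_moments_eq_0[OF m _ hyp, of N \<nu>] by (simp add: N_def T_def y_def z_def)
  qed (auto simp: fin aj distrib_right zmult_add)
  then have "0 = zmult (orbit_sum y T T a * z) (G m) 0" by simp
  also have "\<dots> = (\<Sum>\<phi>\<in>inj_maps T T. G m (\<Sum>j\<in>T. single (\<phi> j) (lookup b j)))"
    unfolding orbit_sum_def sum_distrib_right zmult_sum
  proof (intro sum.cong refl)
    fix \<phi> assume "\<phi> \<in> inj_maps T T"
    then have \<phi>: "inj_on \<phi> T" "\<phi> ` T \<subseteq> T" by (auto simp: inj_maps_def)
    then have "\<phi> ` T = T" using fin endo_inj_surj by blast
    then have N: "(\<Sum>i\<in>T. single i (int N)) = (\<Sum>j\<in>T. single (\<phi> j) (int N))"
      using sum.reindex[OF \<phi>(1), of "\<lambda>i. single i (int N)"] by simp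
    have "(\<Prod>j\<in>T. y (\<phi> j) ^ a j) * z =
        single ((\<Sum>j\<in>T. single (\<phi> j) (- int (a j))) + (\<Sum>j\<in>T. single (\<phi> j) (int N))) 1"
      using fin by (simp add: y_def z_def single_single_power prod_single mult_single flip: N)
    also have "(\<Sum>j\<in>T. single (\<phi> j) (- int (a j))) + (\<Sum>j\<in>T. single (\<phi> j) (int N)) =
        - (\<Sum>j\<in>T. single (\<phi> j) (lookup b j))"
      unfolding sum.distrib[symmetric] sum_negf[symmetric]
      by (intro sum.cong refl) (simp add: aj single_uminus flip: single_add)
    finally show "zmult ((\<Prod>j\<in>T. y (\<phi> j) ^ a j) * z) (G m) 0 = G m (\<Sum>j\<in>T. single (\<phi> j) (lookup b j))"
      by (simp add: zmult_single)
  qed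
  \<comment> \<open>Injections of a finite set into itself are its permutations; outside
    \<open>T\<close> the former are \<open>undefined\<close> and the latter the identity.\<close>
  also have "\<dots> = (\<Sum>\<sigma> | \<sigma> permutes T. G m (map_key (inv \<sigma>) b))"
  proof (rule sum.reindex_bij_witness[where i = "\<lambda>\<sigma>. restrict \<sigma> T" and j = "\<lambda>\<phi> x. if x \<in> T then \<phi> x else x"])
    fix \<phi> assume "\<phi> \<in> inj_maps T T"
    then have \<phi>: "inj_on \<phi> T" "\<phi> ` T \<subseteq> T" "\<phi> \<in> extensional T" by (auto simp: inj_maps_def PiE_def)
    then show "restrict (\<lambda>x. if x \<in> T then \<phi> x else x) T = \<phi>"
      by (auto simp: restrict_def extensional_def)
    define \<sigma> where "\<sigma> = (\<lambda>x. if x \<in> T then \<phi> x else x)"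
    have "\<phi> ` T = T" using fin endo_inj_surj \<phi> by blast
    then have "bij_betw \<sigma> T T" using \<phi> by (auto simp: \<sigma>_def bij_betw_def inj_on_def)
    then have \<sigma>: "\<sigma> permutes T" by (rule bij_imp_permutes) (simp add: \<sigma>_def)
    then show "(\<lambda>x. if x \<in> T then \<phi> x else x) \<in> {\<sigma>. \<sigma> permutes T}" by (simp add: \<sigma>_def)
    have "map_key (inv \<sigma>) b = (\<Sum>j\<in>T. map_key (inv \<sigma>) (single j (lookup b j)))"
    proof -
      have "b = (\<Sum>j\<in>T. single j (lookup b j))"
        by (subst poly_mapping_eq_sum_single)
           (rule sum.mono_neutral_left, use True fin in \<open>auto simp: T_def in_keys_iff\<close>)
      moreover have "map_key (inv \<sigma>) (sum f A) = (\<Sum>j\<in>A. map_key (inv \<sigma>) (f j))" for f :: "nat \<Rightarrow> (nat \<Rightarrow>\<^sub>0 int)" and A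
        by (rule poly_mapping_eqI)
           (simp add: lookup_map_key bij_is_inj[OF permutes_bij[OF permutes_inv[OF \<sigma>]]] lookup_sum)
      ultimately show ?thesis by metis
    qed
    also have "\<dots> = (\<Sum>j\<in>T. single (\<phi> j) (lookup b j))"
      by (intro sum.cong refl)
         (simp add: map_key_single_bij[OF permutes_bij[OF permutes_inv[OF \<sigma>]]]
            inv_inv_eq[OF permutes_bij[OF \<sigma>]], simp add: \<sigma>_def)
    finally show "G m (map_key (inv (\<lambda>x. if x \<in> T then \<phi> x else x)) b) = G m (\<Sum>j\<in>T. single (\<phi> j) (lookup b j))"
      by (simp add: \<sigma>_def)
  next
    fix \<sigma> assume "\<sigma> \<in> {\<sigma>. \<sigma> permutes T}"
    then have \<sigma>: "\<sigma> permutes T" by simp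
    show "(\<lambda>x. if x \<in> T then restrict \<sigma> T x else x) = \<sigma>"
      using permutes_not_in[OF \<sigma>] by auto
    show "restrict \<sigma> T \<in> inj_maps T T"
      using permutes_in_image[OF \<sigma>] permutes_inj[OF \<sigma>] by (auto simp: inj_maps_def inj_on_def)
  qed
  also have "\<dots> = (\<Sum>\<sigma> | \<sigma> permutes T. G m (map_key \<sigma> b))"
    by (rule sum_permutations_inverse[symmetric])
  finally show ?thesis by (simp add: Sym_def T_def)
qed

text \<open>Arbitrary series \<open>G k\<close> are allowed so that both halves of the theorem, with
  FP_k and with \<open>Pi_V\<close>, are instances.\<close>

lemma const_terms_eq_0_iff:
  fixes G :: "nat \<Rightarrow> 'w qtfield zseries"
  assumes "\<And>k a. k \<in> {1..m} \<Longrightarrow> \<not> keys a \<subseteq> {1..k} \<Longrightarrow> G k a = 0"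
  shows "(\<forall>F\<in>symfuns. (\<Sum>k=1..m. const_term (X_part k F) (G k)) = 0) \<longleftrightarrow>
         (\<forall>k\<in>{1..m}. Sym k (G k) = (\<lambda>_. 0))"
proof
  assume "\<forall>k\<in>{1..m}. Sym k (G k) = (\<lambda>_. 0)"
  then show "\<forall>F\<in>symfuns. (\<Sum>k=1..m. const_term (X_part k F) (G k)) = 0"
    by (auto intro!: sum.neutral const_term_X_part_eq_0)
next
  assume "\<forall>F\<in>symfuns. (\<Sum>k=1..m. const_term (X_part k F) (G k)) = 0"
  then show "\<forall>k\<in>{1..m}. Sym k (G k) = (\<lambda>_. 0)"
    using assms
  proof (induction m)
    case (Suc m)
    have top: "Sym (Suc m) (G (Suc m)) = (\<lambda>_. 0)"
    proof (rule ext, rule Sym_top_eq_0)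
      show "(\<Sum>k=1..Suc m. const_term (X_part k (mon_val psum \<nu>)) (G k)) = 0" for \<nu>
        using Suc.prems(1) mon_val_psum_in_symfuns by blast
    qed (use Suc.prems(2) in auto)
    have "\<forall>F\<in>symfuns. (\<Sum>k=1..m. const_term (X_part k F) (G k)) = 0"
      using Suc.prems(1) by (simp add: const_term_X_part_eq_0[OF top])
    then have "\<forall>k\<in>{1..m}. Sym k (G k) = (\<lambda>_. 0)" using Suc by auto
    then show ?case using top by (auto simp: le_Suc_eq)
  qed simp
qed

section \<open>Variables occurring in a series\<close>

text \<open>Records that z_j is absent from a series, so that powers of z_j in a product can be
  attributed to the other factors.\<close>

definition zvars :: "nat set \<Rightarrow> ('v, 'a :: comm_ring_1 laurent) mps \<Rightarrow> bool" where
  "zvars I H \<longleftrightarrow> (\<forall>\<mu>. \<forall>a\<in>keys (mps_nth H \<mu>). keys a \<subseteq> I)"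

lemma zvars_const_single: "keys a \<subseteq> I \<Longrightarrow> zvars I (mps_const (single a c))"
  by (auto simp: zvars_def mps_nth_const)

lemma zvars_0 [simp]: "zvars I 0"
  by (simp add: zvars_def)

lemma zvars_1 [simp]: "zvars I 1"
  by (simp add: zvars_def mps_nth_1)

lemma zvars_add: "zvars I H \<Longrightarrow> zvars I H' \<Longrightarrow> zvars I (H + H')"
  unfolding zvars_def mps_nth_add by (fast dest: set_mp[OF keys_add])

lemma zvars_sum: "(\<And>x. x \<in> A \<Longrightarrow> zvars I (H x)) \<Longrightarrow> zvars I (sum H A)"
  by (induction A rule: infinite_finite_induct) (auto intro: zvars_add)

lemma zvars_mult:
  assumes "zvars I H" "zvars I H'"
  shows "zvars I (H * H')"
  unfolding zvars_def
proof (intro allI ballI)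
  fix \<mu> a assume "a \<in> keys (mps_nth (H * H') \<mu>)"
  then have "a \<in> (\<Union>x\<in>splits \<mu>. keys (mps_nth H (fst x) * mps_nth H' (snd x)))"
    unfolding mps_nth_mult split_beta by (rule set_mp[OF keys_sum])
  then obtain x where "a \<in> keys (mps_nth H (fst x) * mps_nth H' (snd x))" by blast
  then obtain b c where bc: "a = b + c" "b \<in> keys (mps_nth H (fst x))" "c \<in> keys (mps_nth H' (snd x))"
    by (auto dest!: set_mp[OF keys_mult])
  then have "keys b \<subseteq> I" "keys c \<subseteq> I" using assms by (auto simp: zvars_def)
  then show "keys a \<subseteq> I" unfolding bc(1) using keys_add[of b c] by blast
qed

lemma zvars_prod: "(\<And>x. x \<in> A \<Longrightarrow> zvars I (H x)) \<Longrightarrow> zvars I (prod H A)"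
  by (induction A rule: infinite_finite_induct) (auto intro: zvars_mult)

lemma zvars_power: "zvars I H \<Longrightarrow> zvars I (H ^ n)"
  by (induction n) (auto intro: zvars_mult)

lemma zvars_psum [simp]: "zvars I (psum n)"
  by (auto simp: zvars_def mps_nth_psum)

lemma lookup_map_scale: "lookup (Poly_Mapping.map (\<lambda>x. int r * x) a) i = int r * lookup a i"
  by (simp add: map.rep_eq when_def)

lemma zvars_Omega_at:
  assumes "keys a \<subseteq> I"
  shows "zvars I (Omega_at e a)"
  unfolding zvars_def
proof (intro allI ballI)
  fix \<mu> b assume "b \<in> keys (mps_nth (Omega_at e a) \<mu>)"
  then obtain r where "b \<in> keys (single (Poly_Mapping.map (\<lambda>x. int r * x) a) (mps_nth (fps_nth (Omega e) r) \<mu>))"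
    unfolding Omega_at_def mps_nth_Abs Sum_any.expand_set by (auto dest!: set_mp[OF keys_sum])
  then have "b = Poly_Mapping.map (\<lambda>x. int r * x) a" by (auto split: if_splits)
  then show "keys b \<subseteq> I" using assms by (auto simp: in_keys_iff lookup_map_scale subset_iff)
qed

lemma zvars_subst_psums:
  assumes "\<And>n. zvars I (e n)"
  shows "zvars I (subst_psums scalar e f)"
  unfolding subst_psums_def scalar_def
  by (intro zvars_sum zvars_mult zvars_prod zvars_power assms zvars_const_single) simp

lemma zvars_XM: "zvars I (XM I n)"
  unfolding XM_def shiftM_def
  by (intro zvars_add zvars_psum zvars_sum zvars_const_single) auto

lemma zvars_OmX: "zvars I (OmX I)"
  unfolding OmX_def by (intro zvars_prod zvars_Omega_at) auto

definition OmM :: "nat set \<Rightarrow> ('w qtvar, rat laurent) mps" where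
  "OmM I = (\<Prod>(i, j)\<in>{(i, j). i \<in> I \<and> j \<in> I \<and> i < j}. Omega_at (\<lambda>n. - pM n) (single i 1 - single j 1))"

lemma Omega_pairs_eq: "Omega_pairs k = OmM {1..k}"
  unfolding Omega_pairs_def OmM_def by (rule prod.cong) auto

lemma zvars_OmM: "zvars I (OmM I)"
  unfolding OmM_def
proof (intro zvars_prod, safe)
  fix i j assume "i \<in> I" "j \<in> I"
  then show "zvars I (Omega_at (\<lambda>n. - pM n) (single i 1 - single j 1))"
    using keys_diff[of "single i (1::int)" "single j 1"] by (intro zvars_Omega_at) auto
qed

text \<open>As \<open>j\<close> lies below \<open>I\<close>, it is the first member of every new
  pair, and z_j enters only with nonnegative powers.\<close>

lemma OmM_insert:
  assumes "finite I" "\<And>i. i \<in> I \<Longrightarrow> j < i"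
  shows "OmM (insert j I) = OmM I * (\<Prod>i\<in>I. Omega_at (\<lambda>n. - pM n) (single j 1 - single i 1))"
proof -
  have eq: "{(i, i'). i \<in> insert j I \<and> i' \<in> insert j I \<and> i < i'} =
      {(i, i'). i \<in> I \<and> i' \<in> I \<and> i < i'} \<union> Pair j ` I"
    using assms(2) by (auto dest: less_asym)
  have "finite {(i, i'). i \<in> I \<and> i' \<in> I \<and> i < i'}"
    by (rule finite_subset[of _ "I \<times> I"]) (use assms in auto)
  moreover have "{(i, i'). i \<in> I \<and> i' \<in> I \<and> i < i'} \<inter> Pair j ` I = {}"
    using assms(2) by auto
  ultimately show ?thesis
    unfolding OmM_def eq using assms(1)
    by (subst prod.union_disjoint) (auto simp: prod.reindex inj_on_def)
qed

lemma zcoeff_eq_0_iff: "zcoeff G a = 0 \<longleftrightarrow> (\<forall>\<mu>. lookup (mps_nth G \<mu>) a = 0)"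
proof -
  have "zcoeff G a = 0 \<longleftrightarrow> Abs_mps (\<lambda>\<mu>. lookup (mps_nth G \<mu>) a) = 0"
    by (simp add: zcoeff_def Zero_fract_def eq_fract)
  then show ?thesis by (simp add: mps_eq_iff)
qed

lemma zcoeff_zvars:
  assumes "zvars I G" "\<not> keys a \<subseteq> I"
  shows "zcoeff G a = 0"
proof -
  have "a \<notin> keys (mps_nth G \<mu>)" for \<mu> using assms by (auto simp: zvars_def)
  then show ?thesis by (simp add: zcoeff_eq_0_iff in_keys_iff)
qed

lemma zcoeff_1: "zcoeff 1 a = (if a = 0 then 1 else 0)"
proof -
  have "Abs_mps (\<lambda>\<mu>. lookup (mps_nth (1 :: ('a qtvar, rat laurent) mps) \<mu>) a) = (if a = 0 then 1 else 0)"
    by (rule mps_eqI) (auto simp: mps_nth_1 lookup_one)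
  then show ?thesis by (simp add: zcoeff_def One_fract_def Zero_fract_def)
qed

section \<open>Products with $\Omega[-Mz_j/z_i]$\<close>

definition hM :: "nat \<Rightarrow> 'w qtseries" where
  "hM r = fps_nth (Omega (\<lambda>n. - pM n)) r"

lemma hM_nth_eq_0: "r > Suc (mdeg \<mu>) \<Longrightarrow> mps_nth (hM r) \<mu> = 0"
  using Omega_minus_pM_degree unfolding hM_def by (metis not_less)

text \<open>The degree bound on h_r[-M] truncates the sum over r in front of each monomial in q,
  t.\<close>

lemma mps_nth_Omega_at_minus_pM:
  "mps_nth (Omega_at (\<lambda>n. - pM n) d) \<mu> =
     (\<Sum>r\<le>Suc (mdeg \<mu>). single (Poly_Mapping.map (\<lambda>x. int r * x) d) (mps_nth (hM r) \<mu>))"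
  unfolding Omega_at_def mps_nth_Abs hM_def[symmetric]
proof (rule Sum_any.expand_superset)
  have "r \<le> Suc (mdeg \<mu>)" if "single (Poly_Mapping.map (\<lambda>x. int r * x) d) (mps_nth (hM r) \<mu>) \<noteq> 0" for r
    using that hM_nth_eq_0[of \<mu> r] by (metis not_less single_zero)
  then show "{r. single (Poly_Mapping.map (\<lambda>x. int r * x) d) (mps_nth (hM r) \<mu>) \<noteq> 0} \<subseteq> {..Suc (mdeg \<mu>)}"
    by blast
qed simp

text \<open>The truncation at \<open>Suc (mdeg \<beta>)\<close> depends on the monomial \<beta>. The
  hypothesis supplies a uniform bound \<open>R\<close>, which lets the sum over r leave the series
  in q, t; both truncations agree with the one at the smaller bound.\<close>

lemma zcoeff_mult_Omega_at:
  fixes H :: "('w qtvar, rat laurent) mps"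
  assumes "\<And>r. r > R \<Longrightarrow> zcoeff H (c - Poly_Mapping.map (\<lambda>x. int r * x) d) = 0"
  shows "zcoeff (H * Omega_at (\<lambda>n. - pM n) d) c =
    (\<Sum>r\<le>R. zcoeff H (c - Poly_Mapping.map (\<lambda>x. int r * x) d) * Fract (hM r) 1)"
proof -
  interpret F: ring_morphism "\<lambda>x :: 'w qtseries. Fract x 1" by (rule ring_morphism_Fract)
  define s where "s = (\<lambda>r. Poly_Mapping.map (\<lambda>x. int r * x) d)"
  have "Abs_mps (\<lambda>\<mu>. lookup (mps_nth (H * Omega_at (\<lambda>n. - pM n) d) \<mu>) c) =
      (\<Sum>r\<le>R. Abs_mps (\<lambda>\<mu>. lookup (mps_nth H \<mu>) (c - s r)) * hM r)"
  proof (rule mps_eqI)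
    fix \<mu> :: "'w qtvar \<Rightarrow>\<^sub>0 nat"
    have "(\<Sum>r\<le>Suc (mdeg \<beta>). lookup (mps_nth H \<alpha>) (c - s r) * mps_nth (hM r) \<beta>) =
        (\<Sum>r\<le>R. lookup (mps_nth H \<alpha>) (c - s r) * mps_nth (hM r) \<beta>)" for \<alpha> and \<beta> :: "'w qtvar \<Rightarrow>\<^sub>0 nat"
    proof -
      have vanish: "lookup (mps_nth H \<alpha>) (c - s r) * mps_nth (hM r) \<beta> = 0" if "r > min R (Suc (mdeg \<beta>))" for r
        using that assms[of r] hM_nth_eq_0[of \<beta> r] by (auto simp: min_less_iff_disj zcoeff_eq_0_iff s_def)
      have eq: "(\<Sum>r\<le>B. lookup (mps_nth H \<alpha>) (c - s r) * mps_nth (hM r) \<beta>) =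
          (\<Sum>r\<le>min R (Suc (mdeg \<beta>)). lookup (mps_nth H \<alpha>) (c - s r) * mps_nth (hM r) \<beta>)"
        if "B \<ge> min R (Suc (mdeg \<beta>))" for B
      proof (intro sum.mono_neutral_right ballI)
        fix r assume "r \<in> {..B} - {..min R (Suc (mdeg \<beta>))}"
        then have "r > min R (Suc (mdeg \<beta>))" by auto
        then show "lookup (mps_nth H \<alpha>) (c - s r) * mps_nth (hM r) \<beta> = 0" by (rule vanish)
      qed (use that in auto)
      show ?thesis by (rule trans[OF eq[OF min.cobounded2] eq[OF min.cobounded1, symmetric]])
    qed
    then show "mps_nth (Abs_mps (\<lambda>\<mu>. lookup (mps_nth (H * Omega_at (\<lambda>n. - pM n) d) \<mu>) c)) \<mu> =
        mps_nth (\<Sum>r\<le>R. Abs_mps (\<lambda>\<mu>. lookup (mps_nth H \<mu>) (c - s r)) * hM r) \<mu>"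
      unfolding mps_nth_sum mps_nth_mult mps_nth_Abs
      by (subst sum.swap)
         (simp add: split_beta lookup_sum mps_nth_Omega_at_minus_pM sum_distrib_left lookup_mult_single s_def del: sum.atMost_Suc)
  qed
  then show ?thesis by (simp only: zcoeff_def F.sum F.mult s_def)
qed

text \<open>Omega[-u M/z_i] as a power series in u; thus \<open>Theta I\<close> is Omega[-u E] for E
  the sum of the M/z_i over \<open>I\<close>.\<close>

definition Gam :: "nat \<Rightarrow> 'w qtfield laurent fps" where
  "Gam i = Abs_fps (\<lambda>t. single (single i (- int t)) (Fract (hM t) 1))"

definition Theta :: "nat set \<Rightarrow> 'w qtfield laurent fps" where
  "Theta I = (\<Prod>i\<in>I. Gam i)"

text \<open>\<open>G\<close> is free of z_j, so all powers of z_j come from the factors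
  Omega[-M z_j/z_i], where z_j plays the part of u in \<open>Theta J\<close>.\<close>

lemma zcoeff_mult_Omega_prod:
  fixes G :: "('w qtvar, rat laurent) mps"
  assumes "finite J" "j \<notin> J" and free: "zvars I G" "j \<notin> I"
  shows "zcoeff (G * (\<Prod>i\<in>J. Omega_at (\<lambda>n. - pM n) (single j 1 - single i 1))) c =
    (if lookup c j < 0 then 0
     else zmult (fps_nth (Theta J) (nat (lookup c j))) (zcoeff G) (c - single j (lookup c j)))"
  using assms(1,2)
proof (induction J arbitrary: c rule: finite_induct)
  case empty
  have "zcoeff G c = 0" if "lookup c j \<noteq> 0"
    using that free by (intro zcoeff_zvars[OF free(1)]) (auto simp: in_keys_iff)
  moreover have "zmult (1 :: 'w qtfield laurent) (zcoeff G) c = zcoeff G c"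
    by (simp add: zmult_single flip: single_one)
  ultimately show ?case by (auto simp: Theta_def)
next
  case (insert i J)
  let ?Om = "\<lambda>i. Omega_at (\<lambda>n. - pM n) (single j 1 - single i 1) :: ('w qtvar, rat laurent) mps"
  define H where "H = G * (\<Prod>i\<in>J. ?Om i)"
  define s where "s = (\<lambda>r. Poly_Mapping.map (\<lambda>x. int r * x) (single j 1 - single i 1))"
  have s: "s r = single j (int r) - single i (int r)" for r
    by (rule poly_mapping_eqI) (auto simp: s_def lookup_map_scale lookup_minus lookup_single when_def)
  have ij: "i \<noteq> j" using insert by auto
  have lj: "lookup (c - s r) j = lookup c j - int r" for r
    using ij by (simp add: s lookup_minus lookup_single when_def)
  have IH: "zcoeff H c = (if lookup c j < 0 then 0
      else zmult (fps_nth (Theta J) (nat (lookup c j))) (zcoeff G) (c - single j (lookup c j)))" for c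
    unfolding H_def by (rule insert.IH) (use insert in auto)
  have "zcoeff (G * (\<Prod>i\<in>insert i J. ?Om i)) c = zcoeff (H * ?Om i) c"
    using insert by (simp add: H_def mult_ac)
  \<comment> \<open>The exponent of z_j bounds r: beyond it a negative power of z_j would be left
    for \<open>H\<close>.\<close>
  also have "\<dots> = (\<Sum>r\<le>nat (lookup c j). zcoeff H (c - s r) * Fract (hM r) 1)"
    unfolding s_def
  proof (rule zcoeff_mult_Omega_at)
    fix r assume "r > nat (lookup c j)"
    then show "zcoeff H (c - Poly_Mapping.map (\<lambda>x. int r * x) (single j 1 - single i 1)) = 0"
      using lj[of r] by (simp add: IH s_def)
  qed
  also have "\<dots> = (if lookup c j < 0 then 0
     else zmult (fps_nth (Theta (insert i J)) (nat (lookup c j))) (zcoeff G) (c - single j (lookup c j)))"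
  proof (cases "lookup c j < 0")
    case True
    then show ?thesis by (simp add: IH lj)
  next
    case False
    define n where "n = nat (lookup c j)"
    have n: "lookup c j = int n" using False by (simp add: n_def)
    have "zcoeff H (c - s r) * Fract (hM r) 1 =
        zmult (fps_nth (Gam i) r * fps_nth (Theta J) (n - r)) (zcoeff G) (c - single j (int n))" if "r \<le> n" for r
    proof -
      have "c - s r - single j (int n - int r) = c - single j (int n) - single i (- int r)"
        by (rule poly_mapping_eqI) (auto simp: s lookup_minus lookup_single when_def)
      moreover have "nat (int n - int r) = n - r" by simp
      moreover have "\<not> int n - int r < 0" using that by simp
      ultimately show ?thesis
        by (simp only: IH lj n if_False zmult_mult Gam_def fps_nth_Abs_fps zmult_single)
           (rule mult.commute)
    qed
    then have "(\<Sum>r\<le>n. zcoeff H (c - s r) * Fract (hM r) 1) =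
        zmult (\<Sum>r\<le>n. fps_nth (Gam i) r * fps_nth (Theta J) (n - r)) (zcoeff G) (c - single j (int n))"
      by (simp add: zmult_sum)
    also have "(\<Sum>r\<le>n. fps_nth (Gam i) r * fps_nth (Theta J) (n - r)) = fps_nth (Theta (insert i J) :: 'w qtfield laurent fps) n"
      using insert.hyps by (simp add: Theta_def fps_mult_nth atLeast0AtMost)
    finally show ?thesis using False by (simp add: n)
  qed
  finally show ?case .
qed

section \<open>The operators $D_b$ on polynomials in the power sums\<close>

definition pvar :: "nat \<Rightarrow> ((nat \<Rightarrow>\<^sub>0 nat) \<Rightarrow>\<^sub>0 'a :: comm_ring_1)" where
  "pvar n = single (single (n - 1) 1) 1"

text \<open>$h_r[-X]$ as a polynomial in the power sums.\<close>

fun hX :: "nat \<Rightarrow> ((nat \<Rightarrow>\<^sub>0 nat) \<Rightarrow>\<^sub>0 'a :: field_char_0)" where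
  "hX 0 = 1"
| "hX (Suc r) = single 0 (- inverse (of_nat (Suc r))) * (\<Sum>i\<le>r. hX i * pvar (Suc (r - i)))"

text \<open>The index \<open>b + int s\<close> in \<open>D_poly\<close> may be negative; h_n[-X] is
  0 there.\<close>

definition hX_int :: "int \<Rightarrow> ((nat \<Rightarrow>\<^sub>0 nat) \<Rightarrow>\<^sub>0 'a :: field_char_0)" where
  "hX_int n = (if n < 0 then 0 else hX (nat n))"

lemma (in ring_morphism) subst_psums_pvar: "subst_psums \<phi> e (pvar (Suc n)) = e (Suc n)"
  by (simp add: pvar_def subst_psums_single mon_val_single)

text \<open>Newton's recursion is built into \<open>hX\<close>, so substituting the p_n[E] gives
  Omega[-uE] for every alphabet E.\<close>

lemma exp_solution_subst_hX:
  fixes \<phi> :: "'a :: field_char_0 \<Rightarrow> 'b :: comm_ring_1"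
  assumes "ring_morphism \<phi>"
  shows "exp_solution (\<lambda>n. - e n) (Abs_fps (\<lambda>r. subst_psums \<phi> e (hX r)))"
proof -
  interpret f: ring_morphism \<phi> by fact
  interpret s: ring_morphism "subst_psums \<phi> e" by (rule f.ring_morphism_subst_psums)
  have "of_nat (Suc r) * subst_psums \<phi> e (hX (Suc r)) =
      (\<Sum>i\<le>r. subst_psums \<phi> e (hX i) * - e (Suc (r - i)))" for r
  proof -
    have "of_nat (Suc r) * subst_psums \<phi> e (hX (Suc r)) =
        of_nat (Suc r) * \<phi> (- inverse (of_nat (Suc r))) * (\<Sum>i\<le>r. subst_psums \<phi> e (hX i) * e (Suc (r - i)))"
      by (simp add: s.mult s.sum f.subst_psums_pvar subst_psums_single mult.assoc del: of_nat_Suc)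
    also have "of_nat (Suc r) * \<phi> (- inverse (of_nat (Suc r))) = \<phi> (of_nat (Suc r) * - inverse (of_nat (Suc r)))"
      by (simp only: f.mult f.of_nat)
    also have "of_nat (Suc r) * - inverse (of_nat (Suc r) :: 'a) = - 1"
      by (simp del: of_nat_Suc)
    finally show ?thesis by (simp add: f.uminus sum_negf)
  qed
  then show ?thesis by (simp add: exp_solution_iff del: of_nat_Suc hX.simps(2))
qed

text \<open>The coefficient of $y^s$ in $f[X + My]$ is the coefficient of \<open>shift_M f\<close> at \<open>s\<close>.\<close>

definition shift_M :: "((nat \<Rightarrow>\<^sub>0 nat) \<Rightarrow>\<^sub>0 'w qtfield) \<Rightarrow> (nat \<Rightarrow>\<^sub>0 ((nat \<Rightarrow>\<^sub>0 nat) \<Rightarrow>\<^sub>0 'w qtfield))" where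
  "shift_M = subst_psums (\<lambda>c. single 0 (single 0 c))
     (\<lambda>n. single 0 (pvar n) + single n (single 0 (Fract (pM n) 1)))"

text \<open>D_b on polynomials in the power sums: with y = 1/z the coefficient of y^s comes with
  z^(-s), which Omega[-zX] completes to z^b by its term z^(b+s).\<close>

definition D_poly :: "int \<Rightarrow> ((nat \<Rightarrow>\<^sub>0 nat) \<Rightarrow>\<^sub>0 'w qtfield) \<Rightarrow> ((nat \<Rightarrow>\<^sub>0 nat) \<Rightarrow>\<^sub>0 'w qtfield)" where
  "D_poly b f = (\<Sum>s\<in>keys (shift_M f). lookup (shift_M f) s * hX_int (b + int s))"

definition subst_XM :: "nat set \<Rightarrow> ((nat \<Rightarrow>\<^sub>0 nat) \<Rightarrow>\<^sub>0 'w qtfield) \<Rightarrow> (nat, 'w qtfield laurent) mps" where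
  "subst_XM I = subst_psums scalar (XM I)"

lemma ring_morphism_subst_XM: "ring_morphism (subst_XM I)"
  unfolding subst_XM_def by (rule ring_morphism.ring_morphism_subst_psums[OF ring_morphism_scalar])

lemma zvars_subst_XM: "zvars I (subst_XM I f)"
  unfolding subst_XM_def by (rule zvars_subst_psums) (rule zvars_XM)

text \<open>This is f[X + My] with X enlarged by the M/z_i over \<open>I\<close> and y = 1/z_j. Both
  sides are ring morphisms in \<open>f\<close>, so scalars and single power sums decide.\<close>

lemma subst_XM_insert:
  fixes f :: "(nat \<Rightarrow>\<^sub>0 nat) \<Rightarrow>\<^sub>0 'w qtfield"
  assumes "finite I" "j \<notin> I"
  shows "subst_XM (insert j I) f =
    (\<Sum>s\<in>keys (shift_M f). subst_XM I (lookup (shift_M f) s) * mps_const (single (single j (- int s)) 1))"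
proof -
  define \<chi> :: "nat \<Rightarrow> (nat, 'w qtfield laurent) mps" where "\<chi> = (\<lambda>s. mps_const (single (single j (- int s)) 1))"
  interpret c: ring_morphism "mps_const :: 'w qtfield laurent \<Rightarrow> (nat, _) mps" by (rule ring_morphism_mps_const)
  interpret sc: ring_morphism "scalar :: 'w qtfield \<Rightarrow> _" by (rule ring_morphism_scalar)
  interpret S: ring_morphism "subst_XM I :: _ \<Rightarrow> (nat, 'w qtfield laurent) mps" by (rule ring_morphism_subst_XM)
  have \<chi>: "\<chi> 0 = 1" "\<chi> (s + t) = \<chi> s * \<chi> t" for s t
  proof -
    have "single (single j (- int (s + t))) (1 :: 'w qtfield) = single (single j (- int s)) 1 * single (single j (- int t)) 1"
      by (simp add: mult_single flip: single_add)
    then show "\<chi> (s + t) = \<chi> s * \<chi> t" by (simp only: \<chi>_def c.mult)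
    show "\<chi> 0 = 1" by (simp add: \<chi>_def)
  qed
  interpret ss: ring_morphism "\<lambda>c :: 'w qtfield. single (0 :: nat) (single (0 :: nat \<Rightarrow>\<^sub>0 nat) c)"
    by (rule ring_morphism_comp[OF ring_morphism_single ring_morphism_single])
  have sh: "ring_morphism (shift_M :: _ \<Rightarrow> (nat \<Rightarrow>\<^sub>0 ((nat \<Rightarrow>\<^sub>0 nat) \<Rightarrow>\<^sub>0 'w qtfield)))"
    unfolding shift_M_def by (rule ss.ring_morphism_subst_psums)
  have ev: "ring_morphism (pm_eval (subst_XM I) \<chi> :: (nat \<Rightarrow>\<^sub>0 ((nat \<Rightarrow>\<^sub>0 nat) \<Rightarrow>\<^sub>0 'w qtfield)) \<Rightarrow> _)"
    by (rule S.ring_morphism_pm_eval) (rule \<chi>)+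
  interpret ev: ring_morphism "pm_eval (subst_XM I) \<chi> :: (nat \<Rightarrow>\<^sub>0 ((nat \<Rightarrow>\<^sub>0 nat) \<Rightarrow>\<^sub>0 'w qtfield)) \<Rightarrow> _" by (rule ev)
  have const: "subst_XM J (single 0 c) = scalar c" for J and c :: "'w qtfield"
    by (simp add: subst_XM_def subst_psums_single)
  have var: "subst_XM J (pvar (Suc i)) = (XM J (Suc i) :: (nat, 'w qtfield laurent) mps)" for J i
    unfolding subst_XM_def by (rule sc.subst_psums_pvar)
  have "subst_XM (insert j I) f = pm_eval (subst_XM I) \<chi> (shift_M f)"
  proof (rule ring_morphism_subst_eqI[OF ring_morphism_subst_XM ring_morphism_comp[OF ev sh]])
    fix c :: "'w qtfield"
    show "subst_XM (insert j I) (single 0 c) = pm_eval (subst_XM I) \<chi> (shift_M (single 0 c))"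
      by (simp add: const shift_M_def subst_psums_single pm_eval_single \<chi>)
  next
    fix i
    have p: "single (single i 1) 1 = (pvar (Suc i) :: (nat \<Rightarrow>\<^sub>0 nat) \<Rightarrow>\<^sub>0 'w qtfield)" by (simp add: pvar_def)
    have "pm_eval (subst_XM I) \<chi> (shift_M (pvar (Suc i))) =
        XM I (Suc i) + scalar (Fract (pM (Suc i)) 1) * \<chi> (Suc i)"
      unfolding shift_M_def ss.subst_psums_pvar ev.add
      by (simp add: pm_eval_single \<chi>(1) var const)
    also have "scalar (Fract (pM (Suc i)) 1) * \<chi> (Suc i) =
        mps_const (single (single j (- int (Suc i))) (Fract (pM (Suc i)) 1))"
      unfolding scalar_def \<chi>_def c.mult[symmetric] by (simp add: mult_single)
    also have "XM I (Suc i) + \<dots> = XM (insert j I) (Suc i)"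
      using assms by (simp add: XM_def shiftM_def add_ac)
    finally show "subst_XM (insert j I) (single (single i 1) 1) = pm_eval (subst_XM I) \<chi> (shift_M (single (single i 1) 1))"
      unfolding p var by simp
  qed
  then show ?thesis by (simp add: pm_eval_def \<chi>_def)
qed

text \<open>p_n[-M/z_i] is p_n[-M] times z_i^(-n), so \<open>Gam i\<close> is Omega[-uM] rescaled by
  1/z_i.\<close>

lemma exp_solution_Gam: "exp_solution (\<lambda>n. - single (single i (- int n)) (Fract (pM n) 1)) (Gam i)"
proof -
  interpret F: ring_morphism "\<lambda>x :: 'a qtseries. single 0 (Fract x 1) :: 'a qtfield laurent"
    by (rule ring_morphism_comp[OF ring_morphism_single ring_morphism_Fract])
  have "exp_solution (\<lambda>n. single (single i (- 1)) 1 ^ n * single 0 (Fract (- pM n) 1))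
      (Abs_fps (\<lambda>n. single (single i (- 1)) 1 ^ n * single 0 (Fract (hM n) 1)) :: 'a qtfield laurent fps)"
    unfolding hM_def
    using exp_solution_scale[OF F.exp_solution_map[OF exp_solution_Omega[of "\<lambda>n. - pM n"]],
        of "single (single i (- 1)) 1"]
    by simp
  moreover have "single (single i (- 1)) 1 ^ n * single 0 (Fract x 1) =
      (single (single i (- int n)) (Fract x 1) :: 'a qtfield laurent)" for n and x :: "'a qtseries"
    by (simp add: single_single_power mult_single)
  moreover have "single d (Fract (- x) 1) = (- single d (Fract x 1) :: 'a qtfield laurent)" for d and x :: "'a qtseries"
    by (simp only: single_uminus minus_fract[symmetric])
  ultimately show ?thesis by (simp only: Gam_def mult_minus_right)
qed

definition hX_mps :: "nat \<Rightarrow> (nat, 'w qtfield) mps" where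
  "hX_mps r = fps_nth (Omega (\<lambda>n. - psum n)) r"

text \<open>Omega turns the sum of X and the M/z_i into a product; the coefficient of u^n is the
  convolution.\<close>

lemma subst_XM_hX:
  assumes "finite I"
  shows "subst_XM I (hX n) = (\<Sum>r\<le>n. inc (hX_mps r) * mps_const (fps_nth (Theta I) (n - r)) :: (nat, 'w qtfield laurent) mps)"
proof -
  interpret c: ring_morphism "mps_const :: 'w qtfield laurent \<Rightarrow> (nat, _) mps" by (rule ring_morphism_mps_const)
  interpret inc: ring_morphism "inc :: (nat, 'w qtfield) mps \<Rightarrow> _" by (rule ring_morphism_inc)
  have "exp_solution (\<lambda>n. inc (- psum n)) (Abs_fps (\<lambda>n. inc (hX_mps n :: (nat, 'w qtfield) mps)))"
    using inc.exp_solution_map[OF exp_solution_Omega] by (simp add: hX_mps_def)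
  moreover have "exp_solution (\<lambda>n. \<Sum>i\<in>I. - single (single i (- int n)) (Fract (pM n) 1 :: 'w qtfield)) (Theta I)"
    unfolding Theta_def by (rule exp_solution_prod) (rule exp_solution_Gam)
  from c.exp_solution_map[OF this]
  have "exp_solution (\<lambda>n. mps_const (\<Sum>i\<in>I. - single (single i (- int n)) (Fract (pM n) 1)) :: (nat, 'w qtfield laurent) mps)
      (Abs_fps (\<lambda>n. mps_const (fps_nth (Theta I) n)))" .
  ultimately have "exp_solution (\<lambda>n. inc (- psum n) + mps_const (\<Sum>i\<in>I. - single (single i (- int n)) (Fract (pM n) 1 :: 'w qtfield)))
      (Abs_fps (\<lambda>n. inc (hX_mps n)) * Abs_fps (\<lambda>n. mps_const (fps_nth (Theta I) n)))"
    by (rule exp_solution_mult)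
  also have "(\<lambda>n. inc (- psum n) + mps_const (\<Sum>i\<in>I. - single (single i (- int n)) (Fract (pM n) 1 :: 'w qtfield))) = (\<lambda>n. - XM I n)"
    by (simp add: inc.uminus XM_def shiftM_def c.sum c.uminus sum_negf)
  finally have "Abs_fps (\<lambda>r. subst_XM I (hX r)) =
      Abs_fps (\<lambda>n. inc (hX_mps n :: (nat, 'w qtfield) mps)) * Abs_fps (\<lambda>n. mps_const (fps_nth (Theta I) n))"
    using exp_solution_unique exp_solution_subst_hX[OF ring_morphism_scalar] unfolding subst_XM_def by blast
  from arg_cong[OF this, of "\<lambda>g. fps_nth g n"] show ?thesis
    by (simp add: fps_mult_nth atLeast0AtMost)
qed

lemma zact_zmult_single: "zact H (zmult (single d 1) G) c = zact H G (c - d)"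
proof -
  have "zmult (single d 1) G = (\<lambda>a. G (a + - d))" by (rule ext) (simp add: zmult_single)
  then show ?thesis using zmult_shift[of _ G "- d" c] by (intro mps_eqI) simp
qed

text \<open>A monomial \<beta> in the x_i sees only r = \<open>mdeg \<beta>\<close>. The uniform
  bound \<open>R\<close> allows whole series h_r[-X] to be taken out.\<close>

lemma zact_mult_Omega_at:
  fixes G :: "'w qtfield zseries"
  assumes "\<And>r. r > R \<Longrightarrow> zact H G (c - single j (int r)) = 0"
  shows "zact (H * Omega_at (\<lambda>n. - psum n) (single j 1)) G c =
    (\<Sum>r\<le>R. zact H G (c - single j (int r)) * hX_mps r)"
proof (rule mps_eqI)
  fix \<mu>
  have summand: "zmult (mps_nth H \<alpha> * mps_nth (Omega_at (\<lambda>n. - psum n) (single j 1)) \<beta>) G c =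
      (\<Sum>r\<le>R. zmult (mps_nth H \<alpha>) G (c - single j (int r)) * mps_nth (hX_mps r) \<beta>)" for \<alpha> \<beta>
  proof (cases "squarefree_mon \<beta>")
    case True
    let ?r = "mdeg \<beta>"
    have "zmult (mps_nth H \<alpha> * mps_nth (Omega_at (\<lambda>n. - psum n) (single j 1)) \<beta>) G c =
        zmult (single 0 ((- 1) ^ ?r) * (mps_nth H \<alpha> * single (single j (int ?r)) 1)) G c"
      using True by (simp add: mps_nth_Omega_at_minus_psum mult.left_commute[of "single 0 _"] mult_single)
    also have "\<dots> = (- 1) ^ ?r * zmult (mps_nth H \<alpha>) (zmult (single (single j (int ?r)) 1) G) c"
      by (simp add: zmult_mult zmult_scalar)
    also have "\<dots> = (- 1) ^ ?r * zmult (mps_nth H \<alpha>) G (c - single j (int ?r))"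
      using arg_cong[OF zact_zmult_single[of H "single j (int ?r)" G c], of "\<lambda>F. mps_nth F \<alpha>"] by simp
    also have "\<dots> = (\<Sum>r\<le>R. if r = ?r then (- 1) ^ ?r * zmult (mps_nth H \<alpha>) G (c - single j (int ?r)) else 0)"
      using arg_cong[OF assms, of ?r "\<lambda>F. mps_nth F \<alpha>"] by (auto simp: not_le)
    also have "\<dots> = (\<Sum>r\<le>R. zmult (mps_nth H \<alpha>) G (c - single j (int r)) * mps_nth (hX_mps r) \<beta>)"
      using True by (intro sum.cong refl) (auto simp: hX_mps_def Omega_minus_psum)
    finally show ?thesis .
  qed (simp add: mps_nth_Omega_at_minus_psum hX_mps_def Omega_minus_psum)
  have "mps_nth (zact (H * Omega_at (\<lambda>n. - psum n) (single j 1)) G c) \<mu> =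
      (\<Sum>(\<alpha>, \<beta>)\<in>splits \<mu>. \<Sum>r\<le>R. zmult (mps_nth H \<alpha>) G (c - single j (int r)) * mps_nth (hX_mps r) \<beta>)"
    by (simp add: mps_nth_mult zmult_sum split_beta summand)
  also have "\<dots> = mps_nth (\<Sum>r\<le>R. zact H G (c - single j (int r)) * hX_mps r) \<mu>"
    unfolding mps_nth_sum mps_nth_mult mps_nth_zact split_beta by (rule sum.swap)
  finally show "mps_nth (zact (H * Omega_at (\<lambda>n. - psum n) (single j 1)) G c) \<mu> =
      mps_nth (\<Sum>r\<le>R. zact H G (c - single j (int r)) * hX_mps r) \<mu>" .
qed

text \<open>Neither \<open>H\<close> nor z^a contains z_j, so z_j^k has to come from the factors
  Omega[-M z_j/z_i].\<close>

lemma zact_OmM_insert: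
  fixes H :: "(nat, 'w qtfield laurent) mps"
  assumes "finite I" "\<And>i. i \<in> I \<Longrightarrow> j < i" "zvars I H" "keys a \<subseteq> I"
  shows "zact H (zcoeff (OmM (insert j I))) (a + single j k) =
    (if k < 0 then 0 else zact H (zmult (fps_nth (Theta I) (nat k)) (zcoeff (OmM I))) a)"
proof (rule mps_eqI)
  fix \<mu>
  have j: "j \<notin> I" using assms(2) by blast
  have "zcoeff (OmM (insert j I)) (a + single j k - e) =
      (if k < 0 then 0 else zmult (fps_nth (Theta I) (nat k)) (zcoeff (OmM I)) (a - e) :: 'w qtfield)"
    if "e \<in> keys (mps_nth H \<mu>)" for e
  proof -
    have "keys e \<subseteq> I" using assms(3) that by (auto simp: zvars_def)
    then have "lookup e j = 0" "lookup a j = 0" using j assms(4) by (auto simp: in_keys_iff subset_iff)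
    then have lj: "lookup (a + single j k - e) j = k" by (simp add: lookup_add lookup_minus)
    have eq: "a + single j k - e - single j k = a - e" by simp
    show ?thesis
      using zcoeff_mult_Omega_prod[OF assms(1) j zvars_OmM[of I] j, of "a + single j k - e", where ?'w = 'w]
      by (simp only: OmM_insert[OF assms(1,2)] lj eq)
  qed
  then show "mps_nth (zact H (zcoeff (OmM (insert j I))) (a + single j k)) \<mu> =
      mps_nth (if k < 0 then 0 else zact H (zmult (fps_nth (Theta I) (nat k)) (zcoeff (OmM I))) a) \<mu>"
    by (simp add: zmult_def[of "mps_nth H \<mu>"])
qed

text \<open>z_j^n splits into z_j^r from Omega[-z_j X] and z_j^(n-r) from the Omega[-M z_j/z_i]; by
  \<open>subst_XM_hX\<close> the convolution is h_n of minus the alphabet over \<open>I\<close>. For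
  n < 0 both sides vanish.\<close>

lemma zact_Omega_at_step:
  fixes H :: "(nat, 'w qtfield laurent) mps"
  assumes "finite I" "\<And>i. i \<in> I \<Longrightarrow> j < i" "zvars I H" "keys a \<subseteq> I"
  shows "zact (H * Omega_at (\<lambda>n. - psum n) (single j 1)) (zcoeff (OmM (insert j I))) (a + single j n) =
    zact (H * subst_XM I (hX_int n)) (zcoeff (OmM I)) a"
proof -
  let ?G = "zcoeff (OmM (insert j I)) :: 'w qtfield zseries"
  have shift: "a + single j n - single j (int r) = a + single j (n - int r)" for r
    by (simp add: single_diff)
  have act: "zact H ?G (a + single j n - single j (int r)) =
      (if n - int r < 0 then 0 else zact H (zmult (fps_nth (Theta I) (nat (n - int r))) (zcoeff (OmM I))) a)" for r
    unfolding shift by (rule zact_OmM_insert[OF assms])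
  have "zact (H * Omega_at (\<lambda>n. - psum n) (single j 1)) ?G (a + single j n) =
      (\<Sum>r\<le>nat n. zact H ?G (a + single j n - single j (int r)) * hX_mps r)"
    by (rule zact_mult_Omega_at) (simp only: act, simp)
  also have "\<dots> = zact (H * subst_XM I (hX_int n)) (zcoeff (OmM I)) a"
  proof (cases "n < 0")
    case True
    interpret ring_morphism "subst_XM I :: _ \<Rightarrow> (nat, 'w qtfield laurent) mps" by (rule ring_morphism_subst_XM)
    have "zact 0 (zcoeff (OmM I)) a = (0 :: (nat, 'w qtfield) mps)" by (rule mps_eqI) simp
    moreover have "zact H ?G (a + single j n - single j (int r)) = 0" for r
      unfolding act using True by simp
    ultimately show ?thesis using True by (simp only: hX_int_def) simp
  next
    case False
    have "zact H ?G (a + single j n - single j (int r)) * hX_mps r =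
        zact (inc (hX_mps r) * (H * mps_const (fps_nth (Theta I) (nat n - r)))) (zcoeff (OmM I)) a"
      if "r \<le> nat n" for r
    proof -
      have "\<not> n - int r < 0" "nat (n - int r) = nat n - r" using that False by auto
      then show ?thesis unfolding act zact_inc_mult zact_mult_const by (simp add: mult.commute)
    qed
    then have "(\<Sum>r\<le>nat n. zact H ?G (a + single j n - single j (int r)) * hX_mps r) =
        zact (\<Sum>r\<le>nat n. inc (hX_mps r) * (H * mps_const (fps_nth (Theta I) (nat n - r)))) (zcoeff (OmM I)) a"
      unfolding zact_sum by (intro sum.cong refl) auto
    also have "(\<Sum>r\<le>nat n. inc (hX_mps r) * (H * mps_const (fps_nth (Theta I) (nat n - r)))) = H * subst_XM I (hX_int n)"
      using False by (simp add: hX_int_def subst_XM_hX[OF assms(1)] sum_distrib_left mult.left_commute)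
    finally show ?thesis .
  qed
  finally show ?thesis .
qed

text \<open>Trades one operator for one variable: a factor z_j^(-s) from M/z_j raises the exponent
  demanded of the rest to b + s, which \<open>zact_Omega_at_step\<close> turns into the
  \<open>hX_int\<close> factor of \<open>D_poly\<close>.\<close>

lemma D_poly_step:
  fixes f :: "(nat \<Rightarrow>\<^sub>0 nat) \<Rightarrow>\<^sub>0 'w qtfield"
  assumes "finite I" "\<And>i. i \<in> I \<Longrightarrow> j < i" "keys a \<subseteq> I"
  shows "zact (subst_XM I (D_poly b f) * OmX I) (zcoeff (OmM I)) a =
    zact (subst_XM (insert j I) f * OmX (insert j I)) (zcoeff (OmM (insert j I))) (a + single j b)"
proof -
  interpret ring_morphism "subst_XM I :: _ \<Rightarrow> (nat, 'w qtfield laurent) mps" by (rule ring_morphism_subst_XM)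
  have j: "j \<notin> I" using assms(2) by blast
  let ?Om = "Omega_at (\<lambda>n. - psum n) (single j 1) :: (nat, 'w qtfield laurent) mps"
  let ?c = "\<lambda>s. lookup (shift_M f) s"
  have "zact (subst_XM (insert j I) f * OmX (insert j I)) (zcoeff (OmM (insert j I))) (a + single j b) =
    (\<Sum>s\<in>keys (shift_M f). zact (subst_XM I (?c s) * OmX I * ?Om * mps_const (single (single j (- int s)) 1))
       (zcoeff (OmM (insert j I))) (a + single j b))"
    unfolding subst_XM_insert[OF assms(1) j] OmX_insert[OF assms(1) j] sum_distrib_right zact_sum
    by (simp only: mult_ac)
  also have "\<dots> = (\<Sum>s\<in>keys (shift_M f). zact (subst_XM I (?c s) * OmX I * ?Om)
       (zcoeff (OmM (insert j I))) (a + single j (b + int s)))"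
    unfolding zact_mult_const zact_zmult_single by (simp add: single_add single_uminus add.assoc)
  also have "\<dots> = (\<Sum>s\<in>keys (shift_M f). zact (subst_XM I (?c s) * OmX I * subst_XM I (hX_int (b + int s))) (zcoeff (OmM I)) a)"
    by (intro sum.cong refl zact_Omega_at_step assms zvars_mult zvars_subst_XM zvars_OmX)
  also have "\<dots> = zact (subst_XM I (D_poly b f) * OmX I) (zcoeff (OmM I)) a"
    unfolding D_poly_def sum mult sum_distrib_right zact_sum by (simp only: mult_ac)
  finally show ?thesis ..
qed

section \<open>Words in the operators D_b\<close>

lemma OmM_empty: "OmM {} = 1"
  by (simp add: OmM_def)

lemma OmM_singleton: "OmM {j} = 1"
proof -
  have "{(i, i'). i \<in> {j} \<and> i' \<in> {j} \<and> i < i'} = {}" by auto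
  then show ?thesis unfolding OmM_def by (simp only: prod.empty)
qed

lemma zmult_zcoeff_1: "zmult h (zcoeff 1) c = lookup h c"
proof -
  have "zmult h (zcoeff 1) c = (\<Sum>a\<in>keys h. if a = c then lookup h a else 0)"
    unfolding zmult_def by (intro sum.cong refl) (auto simp: zcoeff_1)
  then show ?thesis by (simp add: in_keys_iff)
qed

lemma zact_empty:
  "zact (subst_XM {} f * OmX {}) (zcoeff (OmM {})) 0 = subst_psums mps_const psum f"
  for f :: "(nat \<Rightarrow>\<^sub>0 nat) \<Rightarrow>\<^sub>0 'w qtfield"
proof -
  interpret inc: ring_morphism "inc :: (nat, 'w qtfield) mps \<Rightarrow> _" by (rule ring_morphism_inc)
  have "subst_XM {} f = inc (subst_psums mps_const psum f)"
    unfolding inc.subst_psums_map subst_XM_def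
    by (simp add: inc_mps_const scalar_def[abs_def] XM_def[abs_def] shiftM_def)
  then show ?thesis
    by (intro mps_eqI) (simp add: OmX_def OmM_empty zmult_zcoeff_1 inc_def)
qed

text \<open>This does not assume that \<open>F\<close> is a polynomial in the power sums: for any other \<open>F\<close> both sides
  are computed from the same unspecified value of \<open>psum_expansion F\<close>.\<close>

lemma D_op_eq_D_poly: "D_op b F = subst_psums mps_const psum (D_poly b (psum_expansion F))"
  for F :: "(nat, 'w qtfield) mps"
proof -
  have "subst_psums mps_const psum (D_poly b (psum_expansion F)) =
      zact (subst_XM {1} (psum_expansion F) * OmX {1}) (zcoeff (OmM {1})) (single 1 b)"
    using D_poly_step[of "{}" 1 0 b "psum_expansion F"] by (simp add: zact_empty)
  also have "\<dots> = D_op b F"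
    by (intro mps_eqI) (simp add: D_op_def X_part_eq subst_XM_def OmM_singleton zmult_zcoeff_1)
  finally show ?thesis ..
qed

text \<open>\<open>psum_expansion\<close> undoes the substitution after every operator, so the whole
  word runs on polynomials.\<close>

lemma fold_D_op:
  fixes f :: "(nat \<Rightarrow>\<^sub>0 nat) \<Rightarrow>\<^sub>0 'w qtfield"
  shows "fold (\<lambda>i. D_op (a i)) l (subst_psums mps_const psum f) =
     subst_psums mps_const psum (fold (\<lambda>i. D_poly (a i)) l f)"
  by (induction l arbitrary: f) (simp_all add: D_op_eq_D_poly psum_expansion_subst)

text \<open>The induction runs downward in \<open>j\<close>: the operator applied first carries the
  smallest index, and that is the variable \<open>D_poly_step\<close> adds.\<close>

lemma fold_D_poly:
  fixes f :: "(nat \<Rightarrow>\<^sub>0 nat) \<Rightarrow>\<^sub>0 'w qtfield"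
  assumes "keys a \<subseteq> {j..k}" "j \<le> Suc k"
  shows "subst_psums mps_const psum (fold (\<lambda>i. D_poly (lookup a i)) [j..<Suc k] f) =
    zact (subst_XM {j..k} f * OmX {j..k}) (zcoeff (OmM {j..k})) a"
  using assms(2,1)
proof (induction j arbitrary: a f rule: inc_induct)
  case base
  then have "a = 0" by simp
  then show ?case by (simp add: zact_empty)
next
  case (step j)
  define a' where "a' = a - single j (lookup a j)"
  have lk: "lookup a' i = (if i = j then 0 else lookup a i)" for i
    by (simp add: a'_def lookup_minus lookup_single when_def)
  have keys: "keys a' \<subseteq> {Suc j..k}"
    using step.prems by (force simp: subset_iff in_keys_iff lk split: if_splits)
  have set: "{j..k} = insert j {Suc j..k}" using step.hyps by auto
  have "fold (\<lambda>i. D_poly (lookup a i)) [j..<Suc k] f =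
      fold (\<lambda>i. D_poly (lookup a i)) [Suc j..<Suc k] (D_poly (lookup a j) f)"
    using step.hyps by (subst upt_conv_Cons) auto
  also have "\<dots> = fold (\<lambda>i. D_poly (lookup a' i)) [Suc j..<Suc k] (D_poly (lookup a j) f)"
    by (rule fold_cong) (auto simp: lk)
  also have "subst_psums mps_const psum \<dots> =
      zact (subst_XM {Suc j..k} (D_poly (lookup a j) f) * OmX {Suc j..k}) (zcoeff (OmM {Suc j..k})) a'"
    by (rule step.IH[OF keys])
  also have "\<dots> = zact (subst_XM {j..k} f * OmX {j..k}) (zcoeff (OmM {j..k})) (a' + single j (lookup a j))"
    unfolding set by (rule D_poly_step) (use keys in auto)
  also have "a' + single j (lookup a j) = a" by (simp add: a'_def)
  finally show ?case .
qed

text \<open>The first operator lands among the polynomials in the power sums whatever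
  \<open>F\<close> is, by \<open>D_op_eq_D_poly\<close>; the remaining ones stay there.\<close>

lemma D_word_eq_zact:
  fixes F :: "(nat, 'w qtfield) mps"
  assumes "k \<ge> 1" "keys a \<subseteq> {1..k}"
  shows "D_word k a F = zact (X_part k F) (zcoeff (Omega_pairs k)) a"
proof -
  have up: "[1..<Suc k] = 1 # [Suc 1..<Suc k]" using assms(1) by (subst upt_conv_Cons) auto
  have "D_word k a F = fold (\<lambda>i. D_op (lookup a i)) [Suc 1..<Suc k]
      (subst_psums mps_const psum (D_poly (lookup a 1) (psum_expansion F)))"
    unfolding D_word_def up by (simp add: D_op_eq_D_poly)
  also have "\<dots> = subst_psums mps_const psum (fold (\<lambda>i. D_poly (lookup a i)) [1..<Suc k] (psum_expansion F))"
    unfolding fold_D_op up by simp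
  also have "\<dots> = zact (X_part k F) (zcoeff (Omega_pairs k)) a"
    using fold_D_poly[OF assms(2), of "psum_expansion F"] assms(1)
    by (simp only: X_part_eq subst_XM_def Omega_pairs_eq)
  finally show ?thesis .
qed

text \<open>The coefficient of z^a is the constant term after multiplication by z^(-a), which
  explains the signs in \<open>Pi_V\<close>.\<close>

lemma V_op_eq_const_term:
  fixes F :: "(nat, 'w qtfield) mps"
  assumes "k \<ge> 1" "laurent_in k c"
  shows "V_op k c F = const_term (X_part k F) (zmult (Pi_V c) (zcoeff (Omega_pairs k)))"
proof (rule mps_eqI)
  fix \<mu>
  have "mps_nth (V_op k c F) \<mu> =
      (\<Sum>a\<in>keys c. lookup c a * zmult (mps_nth (X_part k F) \<mu>) (zcoeff (Omega_pairs k)) a)"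
    using assms by (simp add: V_op_def mps_nth_sum mps_nth_const_mult D_word_eq_zact laurent_in_def)
  also have "\<dots> = zmult (Pi_V c) (zmult (mps_nth (X_part k F) \<mu>) (zcoeff (Omega_pairs k))) 0"
    by (simp add: Pi_V_def zmult_sum zmult_single)
  also have "\<dots> = mps_nth (const_term (X_part k F) (zmult (Pi_V c) (zcoeff (Omega_pairs k)))) \<mu>"
    by (simp add: const_term_eq_zact zmult_commute)
  finally show "mps_nth (V_op k c F) \<mu> = mps_nth (const_term (X_part k F) (zmult (Pi_V c) (zcoeff (Omega_pairs k)))) \<mu>" .
qed

theorem theorem2p1:
  fixes m :: nat
  assumes "m \<ge> 1"
  shows "(\<forall>FP :: nat \<Rightarrow> ('w qtvar, rat laurent) mps.
            (\<forall>k\<in>{1..m}. \<forall>\<mu>. laurent_in k (mps_nth (FP k) \<mu>)) \<longrightarrow>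
            ((\<forall>F\<in>symfuns. (\<Sum>k=1..m. const_term (X_part k F) (zcoeff (FP k * Omega_pairs k))) = 0) \<longleftrightarrow>
             (\<forall>k\<in>{1..m}. Sym k (zcoeff (FP k * Omega_pairs k)) = (\<lambda>_. 0)))) \<and>
         (\<forall>c :: nat \<Rightarrow> 'w qtfield laurent.
            (\<forall>k\<in>{1..m}. laurent_in k (c k) \<and> (\<forall>a. Poly_Mapping.lookup (c k) a \<in> Qqt)) \<longrightarrow>
            ((\<forall>F\<in>symfuns. (\<Sum>k=1..m. V_op k (c k) F) = 0) \<longleftrightarrow>
             (\<forall>k\<in>{1..m}. Sym k (zmult (Pi_V (c k)) (zcoeff (Omega_pairs k))) = (\<lambda>_. 0))))"
proof (intro conjI allI impI)
  fix FP :: "nat \<Rightarrow> ('w qtvar, rat laurent) mps"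
  assume FP: "\<forall>k\<in>{1..m}. \<forall>\<mu>. laurent_in k (mps_nth (FP k) \<mu>)"
  show "(\<forall>F\<in>symfuns. (\<Sum>k=1..m. const_term (X_part k F) (zcoeff (FP k * Omega_pairs k))) = 0) \<longleftrightarrow>
      (\<forall>k\<in>{1..m}. Sym k (zcoeff (FP k * Omega_pairs k)) = (\<lambda>_. 0))"
  proof (rule const_terms_eq_0_iff)
    fix k and a :: "nat \<Rightarrow>\<^sub>0 int" assume k: "k \<in> {1..m}" "\<not> keys a \<subseteq> {1..k}"
    have "zvars {1..k} (FP k)" using FP k(1) by (auto simp: zvars_def laurent_in_def)
    then have "zvars {1..k} (FP k * Omega_pairs k)"
      unfolding Omega_pairs_eq by (intro zvars_mult zvars_OmM)
    then show "zcoeff (FP k * Omega_pairs k) a = 0" using k(2) by (rule zcoeff_zvars)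
  qed
next
  fix c :: "nat \<Rightarrow> 'w qtfield laurent"
  assume c: "\<forall>k\<in>{1..m}. laurent_in k (c k) \<and> (\<forall>a. Poly_Mapping.lookup (c k) a \<in> Qqt)"
  have V: "(\<Sum>k=1..m. V_op k (c k) F) =
      (\<Sum>k=1..m. const_term (X_part k F) (zmult (Pi_V (c k)) (zcoeff (Omega_pairs k))))" for F
    using c by (intro sum.cong refl V_op_eq_const_term) auto
  show "(\<forall>F\<in>symfuns. (\<Sum>k=1..m. V_op k (c k) F) = 0) \<longleftrightarrow>
      (\<forall>k\<in>{1..m}. Sym k (zmult (Pi_V (c k)) (zcoeff (Omega_pairs k))) = (\<lambda>_. 0))"
    unfolding V
  proof (rule const_terms_eq_0_iff)
    fix k and a :: "nat \<Rightarrow>\<^sub>0 int" assume k: "k \<in> {1..m}" "\<not> keys a \<subseteq> {1..k}"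
    have "zmult (Pi_V (c k)) (zcoeff (Omega_pairs k)) a =
        (\<Sum>b\<in>keys (c k). lookup (c k) b * zcoeff (Omega_pairs k) (a + b))"
      by (simp add: Pi_V_def zmult_sum zmult_single)
    also have "\<dots> = 0"
    proof (intro sum.neutral ballI)
      fix b assume "b \<in> keys (c k)"
      then have "keys b \<subseteq> {1..k}" using c k(1) by (auto simp: laurent_in_def)
      \<comment> \<open>A variable outside {1..k} does not occur in \<open>b\<close>, so adding
        \<open>b\<close> cannot remove it from \<open>a\<close>.\<close>
      moreover have "keys a \<subseteq> keys (a + b) \<union> keys b" using keys_diff[of "a + b" b] by simp
      ultimately have "\<not> keys (a + b) \<subseteq> {1..k}" using k(2) by blast
      then have "zcoeff (Omega_pairs k) (a + b) = (0 :: 'w qtfield)"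
        unfolding Omega_pairs_eq by (rule zcoeff_zvars[OF zvars_OmM])
      then show "lookup (c k) b * zcoeff (Omega_pairs k) (a + b) = 0" by simp
    qed
    finally show "zmult (Pi_V (c k)) (zcoeff (Omega_pairs k)) a = 0" .
  qed
qed

end
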